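(* Let $\mathbb{G}_a$ act linearly and non-trivially on a complex affine space $V$, with moment map $\mu_{\mathbb{G}_a}: T^*V \to \mathbb{C}$ for the cotangent lift. Let $\xi \in \mathbb{C}$ with $\xi \neq 0$, and let $H_V(\xi) := \mu_{\mathbb{G}_a}^{-1}(\xi)$. Then: (i) $H_V(\xi)^{\overline{s}} = H_V(\xi)^{ms} = H_V(\xi)$, where $H_V(\xi)^{\overline{s}}$ and $H_V(\xi)^{ms}$ denote the completely stable and the Mumford stable loci; (ii) $H_V(\xi)$ admits a (Zariski) locally trivial geometric quotient $H_V(\xi)/\mathbb{G}_a$, which is smooth; (iii) $H_V(\xi)/\mathbb{G}_a$ is affine, and so $\mathbb{C}[H_V(\xi)]^{\mathbb{G}_a}$ is finitely generated; (iv) every invariant in $\mathbb{C}[H_V(\xi)]^{\mathbb{G}_a}$ is the restriction of an invariant in $\mathbb{C}[T^*V]^{\mathbb{G}_a}$; (v) $H_V(\xi) \to H_V(\xi)/\mathbb{G}_a$ is a trivial $\mathbb{G}_a$-torsor. In particular, $H_V(\xi)/\mathbb{G}_a = H_V(\xi)/\!/\mathbb{G}_a := \mathrm{Spec}\, \mathbb{C}[H_V(\xi)]^{\mathbb{G}_a}$, and the quotient map $\pi: H_V(\xi) \to H_V(\xi)/\!/\mathbb{G}_a$ is surjective.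
   Context: Everything is over $\mathbb{C}$. $\mathbb{G}_a$ is embedded in $\mathrm{SL}_2$ as the upper triangular unipotent subgroup. A linear $\mathbb{G}_a$-action on $V \cong \mathbb{A}^n$ extends to a representation $\rho: \mathrm{SL}_2 \to \mathrm{GL}(V)$; fix such an extension. Identify $T^*V \cong V \times V^*$ (elements of $V$ are column vectors, elements of $V^*$ row vectors); the cotangent lift of the action is $g\cdot(x,\alpha) = (\rho(g)x, \alpha\rho(g)^{-1})$. The moment map of the $\mathbb{G}_a$-action on $T^*V$ is $\mu_{\mathbb{G}_a}(x,\alpha) = \alpha(\rho_*(E)x)$, where $E = \begin{pmatrix} 0&1\\0&0\end{pmatrix} \in \mathfrak{sl}_2$ and $\rho_*$ is the derivative of $\rho$. Each level set is $\mathbb{G}_a$-invariant. Completely stable: for an $\mathrm{SL}_2$-representation $Y$, let $\mathrm{SL}_2$ act on $\mathbb{P}(\mathbb{A}^1 \times Y \times \mathbb{A}^2)$ with trivial action on $\mathbb{A}^1$ and the standard action on $\mathbb{A}^2$, canonically linearised on $\mathcal{O}(1)$. A point $p \in Y$ is completely stable if $[1:p:1:0]$ is $\mathrm{SL}_2$-stable in the sense of Mumford (semistable, orbit closed in the semistable locus, finite stabiliser). The set of these is $Y^{\overline{s}}$, and $H_V(\xi)^{\overline{s}} := H_V(\xi) \cap (T^*V)^{\overline{s}}$. Mumford stable: for an affine $\mathbb{G}_a$-variety $X$, a point $p \in X$ is Mumford stable if $[p,I]$ is stable in Mumford's sense for the $\mathrm{SL}_2$-action on $X \times_{\mathbb{G}_a}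 \mathrm{SL}_2$ (the quotient of $X \times \mathrm{SL}_2$ by the diagonal $\mathbb{G}_a$-action) with respect to the structure sheaf with its canonical linearisation. The set of these is $X^{ms}$. *)

theory Defs
  imports "HOL-Analysis.Analysis"
begin

text \<open>
  A variety over the complex numbers is rendered in the classical way, as a space with functions:
  its set of closed points with the Zariski topology, and for every open set the algebra of regular
  complex-valued functions on it. All varieties are reduced; for the level sets below nothing is lost,
  because the differential of the moment map vanishes nowhere on a level set of nonzero level, so that
  the scheme-theoretic fibre is smooth, hence reduced.
\<close>

section \<open>Affine spaces and polynomial functions\<close>

text \<open>
  An affine space over the complex numbers together with a linear coordinate system. The second
  axiom says that the coordinates identify the type with the space of all families of complex numbers
  indexed by the coordinates.
\<close>

class affine_space =
  fixes coords :: "('a \<Rightarrow> complex) set"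
    and cscale :: "complex \<Rightarrow> 'a \<Rightarrow> 'a"
  assumes finite_coords: "finite coords"
    and ex1_coords: "\<exists>!x. \<forall>k\<in>coords. k x = v k"
    and coords_cscale: "k \<in> coords \<Longrightarrow> k (cscale c x) = c * k x"

instantiation complex :: affine_space
begin

definition coords_complex :: "(complex \<Rightarrow> complex) set" where
  "coords_complex = {\<lambda>z. z}"

definition cscale_complex :: "complex \<Rightarrow> complex \<Rightarrow> complex" where
  "cscale_complex c z = c * z"

instance
  by standard (auto simp: coords_complex_def cscale_complex_def)

end

instantiation prod :: (affine_space, affine_space) affine_space
begin

definition coords_prod :: "('a \<times> 'b \<Rightarrow> complex) set" where
  "coords_prod = (\<lambda>k. k \<circ> fst) ` coords \<union> (\<lambda>k. k \<circ> snd) ` coords"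

definition cscale_prod :: "complex \<Rightarrow> 'a \<times> 'b \<Rightarrow> 'a \<times> 'b" where
  "cscale_prod c p = (cscale c (fst p), cscale c (snd p))"

instance
proof
  show "finite (coords :: ('a \<times> 'b \<Rightarrow> complex) set)"
    by (simp add: coords_prod_def finite_coords)
next
  fix v :: "('a \<times> 'b \<Rightarrow> complex) \<Rightarrow> complex"
  obtain x :: 'a where x: "\<forall>k\<in>coords. k x = v (k \<circ> fst)"
      "\<And>x'. \<forall>k\<in>coords. k x' = v (k \<circ> fst) \<Longrightarrow> x' = x"
    using ex1_coords[of "\<lambda>k. v (k \<circ> fst)"] by blast
  obtain y :: 'b where y: "\<forall>k\<in>coords. k y = v (k \<circ> snd)"
      "\<And>y'. \<forall>k\<in>coords. k y' = v (k \<circ> snd) \<Longrightarrow> y' = y"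
    using ex1_coords[of "\<lambda>k. v (k \<circ> snd)"] by blast
  show "\<exists>!p. \<forall>k\<in>coords. k p = v k"
  proof (rule ex1I[of _ "(x, y)"])
    show "\<forall>k\<in>coords. k (x, y) = v k"
      using x(1) y(1) by (auto simp: coords_prod_def)
  next
    fix p :: "'a \<times> 'b"
    assume p: "\<forall>k\<in>coords. k p = v k"
    have "fst p = x" by (rule x(2)) (use p in \<open>auto simp: coords_prod_def\<close>)
    moreover have "snd p = y" by (rule y(2)) (use p in \<open>auto simp: coords_prod_def\<close>)
    ultimately show "p = (x, y)" by (simp add: prod_eq_iff)
  qed
next
  fix k :: "'a \<times> 'b \<Rightarrow> complex" and c x
  assume "k \<in> coords"
  then show "k (cscale c x) = c * k x"
    by (auto simp: coords_prod_def cscale_prod_def coords_cscale)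
qed

end

instantiation vec :: (affine_space, finite) affine_space
begin

definition coords_vec :: "('a ^ 'b \<Rightarrow> complex) set" where
  "coords_vec = (\<Union>i. (\<lambda>k v. k (v $ i)) ` coords)"

definition cscale_vec :: "complex \<Rightarrow> 'a ^ 'b \<Rightarrow> 'a ^ 'b" where
  "cscale_vec c x = (\<chi> i. cscale c (x $ i))"

instance
proof
  show "finite (coords :: ('a ^ 'b \<Rightarrow> complex) set)"
    by (simp add: coords_vec_def finite_coords)
next
  fix v :: "('a ^ 'b \<Rightarrow> complex) \<Rightarrow> complex"
  have "\<forall>i. \<exists>x::'a. (\<forall>k\<in>coords. k x = v (\<lambda>w. k (w $ i))) \<and>
      (\<forall>x'. (\<forall>k\<in>coords. k x' = v (\<lambda>w. k (w $ i))) \<longrightarrow> x' = x)"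
  proof
    fix i
    show "\<exists>x::'a. (\<forall>k\<in>coords. k x = v (\<lambda>w. k (w $ i))) \<and>
      (\<forall>x'. (\<forall>k\<in>coords. k x' = v (\<lambda>w. k (w $ i))) \<longrightarrow> x' = x)"
      using ex1_coords[of "\<lambda>k. v (\<lambda>w. k (w $ i))"] by blast
  qed
  then obtain x :: "'b \<Rightarrow> 'a" where x: "\<And>i. \<forall>k\<in>coords. k (x i) = v (\<lambda>w. k (w $ i))"
      "\<And>i x'. \<forall>k\<in>coords. k x' = v (\<lambda>w. k (w $ i)) \<Longrightarrow> x' = x i"
    by metis
  show "\<exists>!p. \<forall>k\<in>coords. k p = v k"
  proof (rule ex1I[of _ "\<chi> i. x i"])
    show "\<forall>k\<in>coords. k (\<chi> i. x i) = v k"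
      using x(1) by (auto simp: coords_vec_def)
  next
    fix p :: "'a ^ 'b"
    assume p: "\<forall>k\<in>coords. k p = v k"
    have "p $ i = x i" for i by (rule x(2)) (use p in \<open>auto simp: coords_vec_def\<close>)
    then show "p = (\<chi> i. x i)" by (simp add: vec_eq_iff)
  qed
next
  fix k :: "'a ^ 'b \<Rightarrow> complex" and c x
  assume "k \<in> coords"
  then show "k (cscale c x) = c * k x"
    by (auto simp: coords_vec_def cscale_vec_def coords_cscale)
qed

end

text \<open>The algebra of complex-valued functions generated by a set of functions.\<close>

inductive_set alg_gen :: "('a \<Rightarrow> complex) set \<Rightarrow> ('a \<Rightarrow> complex) set"
  for C :: "('a \<Rightarrow> complex) set" where
  const: "(\<lambda>_. c) \<in> alg_gen C"
| gen: "k \<in> C \<Longrightarrow> k \<in> alg_gen C"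
| add: "f \<in> alg_gen C \<Longrightarrow> g \<in> alg_gen C \<Longrightarrow> (\<lambda>x. f x + g x) \<in> alg_gen C"
| mult: "f \<in> alg_gen C \<Longrightarrow> g \<in> alg_gen C \<Longrightarrow> (\<lambda>x. f x * g x) \<in> alg_gen C"

definition polynomials :: "('a::affine_space \<Rightarrow> complex) set" where
  "polynomials = alg_gen coords"

text \<open>
  Affine \<open>N\<close>-space for a varying natural number \<open>N\<close>: sequences that vanish from index \<open>N\<close> on.
\<close>

definition aspace :: "nat \<Rightarrow> (nat \<Rightarrow> complex) set" where
  "aspace N = {x. \<forall>i\<ge>N. x i = 0}"

definition apoly :: "nat \<Rightarrow> ((nat \<Rightarrow> complex) \<Rightarrow> complex) set" where
  "apoly N = alg_gen {\<lambda>x. x i | i. i < N}"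

definition azeros :: "nat \<Rightarrow> ((nat \<Rightarrow> complex) \<Rightarrow> complex) set \<Rightarrow> (nat \<Rightarrow> complex) set" where
  "azeros N P = {x \<in> aspace N. \<forall>p\<in>P. p x = 0}"

definition azariski_closed :: "nat \<Rightarrow> (nat \<Rightarrow> complex) set \<Rightarrow> bool" where
  "azariski_closed N Z \<longleftrightarrow> (\<exists>P \<subseteq> apoly N. Z = azeros N P)"

section \<open>Spaces with functions and varieties\<close>

text \<open>
  \<open>Reg X U\<close> is only meaningful for open \<open>U\<close>, and a function in \<open>Reg X U\<close> only matters
  through its values on \<open>U\<close>.
\<close>

record 'a fspace =
  Top :: "'a topology"
  Reg :: "'a set \<Rightarrow> ('a \<Rightarrow> complex) set"

abbreviation points :: "'a fspace \<Rightarrow> 'a set" where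
  "points X \<equiv> topspace (Top X)"

definition is_sheaf :: "'a fspace \<Rightarrow> bool" where
  "is_sheaf X \<longleftrightarrow>
     (\<forall>\<W>. (\<forall>W\<in>\<W>. openin (Top X) W) \<longrightarrow> Reg X (\<Union>\<W>) = (\<Inter>W\<in>\<W>. Reg X W)) \<and>
     (\<forall>U f g. openin (Top X) U \<longrightarrow> (\<forall>x\<in>U. f x = g x) \<longrightarrow> f \<in> Reg X U \<longrightarrow> g \<in> Reg X U)"

text \<open>
  The Zariski topology and the sheaf of regular functions (locally fractions) determined on a set by
  an algebra of functions. The fraction in the definition of \<open>Reg\<close> lives on a whole principal open set:
  any smaller neighbourhood of \<open>x\<close> contains one, and the fraction can be expanded accordingly.
\<close>

definition fun_space :: "'a set \<Rightarrow> ('a \<Rightarrow> complex) set \<Rightarrow> 'a fspace" where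
  "fun_space X A =
     \<lparr> Top = topology_generated_by {{x\<in>X. a x \<noteq> 0} | a. a \<in> A},
       Reg = (\<lambda>U. {f. \<forall>x\<in>U. \<exists>a\<in>A. \<exists>b\<in>A. b x \<noteq> 0 \<and> (\<forall>y\<in>U. b y \<noteq> 0 \<longrightarrow> f y = a y / b y)}) \<rparr>"

definition subvariety :: "'a::affine_space set \<Rightarrow> 'a fspace" where
  "subvariety Z = fun_space Z polynomials"

definition A1 :: "complex fspace" where
  "A1 = subvariety UNIV"

definition open_sub :: "'a fspace \<Rightarrow> 'a set \<Rightarrow> 'a fspace" where
  "open_sub X U = \<lparr> Top = subtopology (Top X) U, Reg = Reg X \<rparr>"

definition morphism :: "'a fspace \<Rightarrow> 'b fspace \<Rightarrow> ('a \<Rightarrow> 'b) \<Rightarrow> bool" where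
  "morphism X Y \<phi> \<longleftrightarrow> continuous_map (Top X) (Top Y) \<phi> \<and>
     (\<forall>U f. openin (Top Y) U \<longrightarrow> f \<in> Reg Y U \<longrightarrow> f \<circ> \<phi> \<in> Reg X {x \<in> points X. \<phi> x \<in> U})"

definition isomorphism :: "'a fspace \<Rightarrow> 'b fspace \<Rightarrow> ('a \<Rightarrow> 'b) \<Rightarrow> bool" where
  "isomorphism X Y \<phi> \<longleftrightarrow> morphism X Y \<phi> \<and>
     (\<exists>\<psi>. morphism Y X \<psi> \<and> (\<forall>x\<in>points X. \<psi> (\<phi> x) = x) \<and> (\<forall>y\<in>points Y. \<phi> (\<psi> y) = y))"

text \<open>
  The product in the category of spaces with functions: its structure is generated by the tensor
  products of regular functions on the factors.
\<close>

definition tensor_alg ::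
    "'a fspace \<Rightarrow> 'b fspace \<Rightarrow> 'a set \<Rightarrow> 'b set \<Rightarrow> ('a \<times> 'b \<Rightarrow> complex) set" where
  "tensor_alg X Y U V = alg_gen ((\<lambda>f. f \<circ> fst) ` Reg X U \<union> (\<lambda>g. g \<circ> snd) ` Reg Y V)"

definition prod_space :: "'a fspace \<Rightarrow> 'b fspace \<Rightarrow> ('a \<times> 'b) fspace" where
  "prod_space X Y =
     \<lparr> Top = topology_generated_by {{p \<in> U \<times> V. a p \<noteq> 0} | U V a.
                openin (Top X) U \<and> openin (Top Y) V \<and> a \<in> tensor_alg X Y U V},
       Reg = (\<lambda>W. {h. \<forall>p\<in>W. \<exists>U V. openin (Top X) U \<and> openin (Top Y) V \<and> p \<in> U \<times> V \<and>
                (\<exists>a\<in>tensor_alg X Y U V. \<exists>b\<in>tensor_alg X Y U V. b p \<noteq> 0 \<and>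
                   (\<forall>q \<in> W \<inter> U \<times> V. b q \<noteq> 0 \<longrightarrow> h q = a q / b q))}) \<rparr>"

definition affine_variety :: "'a fspace \<Rightarrow> bool" where
  "affine_variety X \<longleftrightarrow> is_sheaf X \<and>
     (\<exists>N Z \<phi>. azariski_closed N Z \<and> isomorphism X (fun_space Z (apoly N)) \<phi>)"

definition separated :: "'a fspace \<Rightarrow> bool" where
  "separated X \<longleftrightarrow>
     (\<forall>N Z \<phi> \<psi>. azariski_closed N Z \<longrightarrow>
        morphism (fun_space Z (apoly N)) X \<phi> \<longrightarrow> morphism (fun_space Z (apoly N)) X \<psi> \<longrightarrow>
        closedin (Top (fun_space Z (apoly N))) {z\<in>Z. \<phi> z = \<psi> z})"

definition variety :: "'a fspace \<Rightarrow> bool" where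
  "variety X \<longleftrightarrow> is_sheaf X \<and> separated X \<and>
     (\<exists>\<U>. finite \<U> \<and> \<Union>\<U> = points X \<and>
        (\<forall>U\<in>\<U>. openin (Top X) U \<and> affine_variety (open_sub X U)))"

text \<open>
  Smoothness over the complex numbers in Mumford's form (Red Book, III.10): near every point, \<open>X\<close> is
  isomorphic to an open subset of the zero locus of \<open>r\<close> polynomials whose Jacobian matrix has rank
  \<open>r\<close> at that point.
\<close>

definition jacobian_full_rank ::
    "nat \<Rightarrow> nat \<Rightarrow> (nat \<Rightarrow> (nat \<Rightarrow> complex) \<Rightarrow> complex) \<Rightarrow> (nat \<Rightarrow> complex) \<Rightarrow> bool" where
  "jacobian_full_rank N r p z \<longleftrightarrow>
     (\<forall>c. (\<forall>j<N. (\<Sum>i<r. c i * deriv (\<lambda>t. p i (z(j := t))) (z j)) = 0) \<longrightarrow> (\<forall>i<r. c i = 0))"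

definition smooth_variety :: "'a fspace \<Rightarrow> bool" where
  "smooth_variety X \<longleftrightarrow> variety X \<and>
     (\<forall>x\<in>points X. \<exists>U N r p W \<phi>.
        openin (Top X) U \<and> x \<in> U \<and> (\<forall>i<r. p i \<in> apoly N) \<and>
        openin (Top (fun_space (azeros N (p ` {..<r})) (apoly N))) W \<and>
        isomorphism (open_sub X U)
          (open_sub (fun_space (azeros N (p ` {..<r})) (apoly N)) W) \<phi> \<and>
        jacobian_full_rank N r p (\<phi> x))"

section \<open>Group actions and quotients\<close>

definition orb :: "'g set \<Rightarrow> ('g \<Rightarrow> 'a \<Rightarrow> 'a) \<Rightarrow> 'a \<Rightarrow> 'a set" where
  "orb G act x = (\<lambda>g. act g x) ` G"

text \<open>
  The set of orbits with the quotient topology and the sheaf of invariant regular functions. It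
  carries the only possible structure of a geometric quotient, but need not be a variety.
\<close>

definition orbit_space :: "'g set \<Rightarrow> ('g \<Rightarrow> 'a \<Rightarrow> 'a) \<Rightarrow> 'a fspace \<Rightarrow> 'a set fspace" where
  "orbit_space G act X =
     \<lparr> Top = topology (\<lambda>U. U \<subseteq> orb G act ` points X \<and>
                openin (Top X) {x \<in> points X. orb G act x \<in> U}),
       Reg = (\<lambda>U. {f. f \<circ> orb G act \<in> Reg X {x \<in> points X. orb G act x \<in> U}}) \<rparr>"

lemma openin_orbit_space:
  "openin (Top (orbit_space G act X)) U \<longleftrightarrow>
     U \<subseteq> orb G act ` points X \<and> openin (Top X) {x \<in> points X. orb G act x \<in> U}"
proof -
  have "istopology (\<lambda>U. U \<subseteq> orb G act ` points X \<and>
      openin (Top X) {x \<in> points X. orb G act x \<in> U})"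
    unfolding istopology_def
  proof (intro conjI allI impI)
    fix S T
    assume S: "S \<subseteq> orb G act ` points X \<and> openin (Top X) {x \<in> points X. orb G act x \<in> S}"
      and T: "T \<subseteq> orb G act ` points X \<and> openin (Top X) {x \<in> points X. orb G act x \<in> T}"
    show "S \<inter> T \<subseteq> orb G act ` points X" using S by blast
    have "{x \<in> points X. orb G act x \<in> S \<inter> T} =
        {x \<in> points X. orb G act x \<in> S} \<inter> {x \<in> points X. orb G act x \<in> T}" by blast
    then show "openin (Top X) {x \<in> points X. orb G act x \<in> S \<inter> T}"
      using S T by (simp add: openin_Int)
  next
    fix \<K>
    assume K: "\<forall>K\<in>\<K>. K \<subseteq> orb G act ` points X \<and>
        openin (Top X) {x \<in> points X. orb G act x \<in> K}"
    show "\<Union>\<K> \<subseteq> orb G act ` points X" using K by blast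
    have "{x \<in> points X. orb G act x \<in> \<Union>\<K>} =
        \<Union>((\<lambda>K. {x \<in> points X. orb G act x \<in> K}) ` \<K>)" by blast
    then show "openin (Top X) {x \<in> points X. orb G act x \<in> \<Union>\<K>}"
      using K by (metis (no_types, lifting) imageE openin_Union)
  qed
  then show ?thesis by (simp add: orbit_space_def)
qed

text \<open>
  Mumford's geometric quotient. The last condition says that pulling back along \<open>\<pi>\<close> identifies the
  regular functions on \<open>U\<close> with the invariant regular functions on the preimage of \<open>U\<close>: as the
  fibres are the orbits, the invariant functions there are exactly the functions \<open>f \<circ> \<pi>\<close>.
\<close>

definition geometric_quotient ::
    "'g set \<Rightarrow> ('g \<Rightarrow> 'a \<Rightarrow> 'a) \<Rightarrow> 'a fspace \<Rightarrow> 'q fspace \<Rightarrow> ('a \<Rightarrow> 'q) \<Rightarrow> bool" where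
  "geometric_quotient G act X Q \<pi> \<longleftrightarrow>
     variety Q \<and> morphism X Q \<pi> \<and>
     (\<forall>x\<in>points X. \<forall>y\<in>points X. \<pi> x = \<pi> y \<longleftrightarrow> y \<in> orb G act x) \<and>
     quotient_map (Top X) (Top Q) \<pi> \<and>
     (\<forall>U. openin (Top Q) U \<longrightarrow> Reg Q U = {f. f \<circ> \<pi> \<in> Reg X {x \<in> points X. \<pi> x \<in> U}})"

definition trivial_Ga_torsor_over ::
    "(complex \<Rightarrow> 'a \<Rightarrow> 'a) \<Rightarrow> 'a fspace \<Rightarrow> 'q fspace \<Rightarrow> ('a \<Rightarrow> 'q) \<Rightarrow> 'q set \<Rightarrow> bool" where
  "trivial_Ga_torsor_over act X Q \<pi> U \<longleftrightarrow>
     (\<exists>\<phi>. isomorphism (open_sub X {x \<in> points X. \<pi> x \<in> U}) (prod_space (open_sub Q U) A1) \<phi> \<and>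
        (\<forall>x\<in>points X. \<pi> x \<in> U \<longrightarrow> fst (\<phi> x) = \<pi> x \<and>
           (\<forall>t. \<phi> (act t x) = (\<pi> x, snd (\<phi> x) + t))))"

definition trivial_Ga_torsor ::
    "(complex \<Rightarrow> 'a \<Rightarrow> 'a) \<Rightarrow> 'a fspace \<Rightarrow> 'q fspace \<Rightarrow> ('a \<Rightarrow> 'q) \<Rightarrow> bool" where
  "trivial_Ga_torsor act X Q \<pi> \<longleftrightarrow> trivial_Ga_torsor_over act X Q \<pi> (points Q)"

definition locally_trivial_Ga_quotient ::
    "(complex \<Rightarrow> 'a \<Rightarrow> 'a) \<Rightarrow> 'a fspace \<Rightarrow> 'q fspace \<Rightarrow> ('a \<Rightarrow> 'q) \<Rightarrow> bool" where
  "locally_trivial_Ga_quotient act X Q \<pi> \<longleftrightarrow>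
     geometric_quotient UNIV act X Q \<pi> \<and>
     (\<forall>q\<in>points Q. \<exists>U. openin (Top Q) U \<and> q \<in> U \<and> trivial_Ga_torsor_over act X Q \<pi> U)"

section \<open>Invariant rings and their spectra\<close>

text \<open>
  The coordinate ring of a closed subset \<open>Z\<close> of an affine space, realised as a ring of functions that
  are undefined outside \<open>Z\<close>, so that equality in the ring is equality of functions on \<open>Z\<close>.
\<close>

definition coord_ring :: "'a::affine_space set \<Rightarrow> ('a \<Rightarrow> complex) set" where
  "coord_ring Z = (\<lambda>f. restrict f Z) ` polynomials"

definition invariant_ring ::
    "'g set \<Rightarrow> ('g \<Rightarrow> 'a \<Rightarrow> 'a) \<Rightarrow> 'a::affine_space set \<Rightarrow> ('a \<Rightarrow> complex) set" where
  "invariant_ring G act Z = {f \<in> coord_ring Z. \<forall>g\<in>G. \<forall>x\<in>Z. f (act g x) = f x}"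

definition finitely_generated_algebra :: "'a set \<Rightarrow> ('a \<Rightarrow> complex) set \<Rightarrow> bool" where
  "finitely_generated_algebra Z A \<longleftrightarrow>
     (\<exists>B\<subseteq>A. finite B \<and> A = (\<lambda>f. restrict f Z) ` alg_gen B)"

text \<open>
  The closed points of the spectrum of an algebra \<open>A\<close> of functions on \<open>Z\<close>: its unital complex algebra
  homomorphisms to the complex numbers. The spectrum carries the topology generated by the principal
  open sets and the sheaf of local fractions.
\<close>

definition alg_points :: "'a set \<Rightarrow> ('a \<Rightarrow> complex) set \<Rightarrow> (('a \<Rightarrow> complex) \<Rightarrow> complex) set" where
  "alg_points Z A = {\<phi> \<in> extensional A.
     (\<forall>c. \<phi> (\<lambda>x\<in>Z. c) = c) \<and>
     (\<forall>f\<in>A. \<forall>g\<in>A. \<phi> (\<lambda>x\<in>Z. f x + g x) = \<phi> f + \<phi> g \<and> \<phi> (\<lambda>x\<in>Z. f x * g x) = \<phi> f * \<phi> g)}"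

definition Spec :: "'a set \<Rightarrow> ('a \<Rightarrow> complex) set \<Rightarrow> (('a \<Rightarrow> complex) \<Rightarrow> complex) fspace" where
  "Spec Z A = fun_space (alg_points Z A) ((\<lambda>f \<phi>. \<phi> f) ` A)"

text \<open>The map \<open>Z \<rightarrow> Spec A\<close> induced by the inclusion of \<open>A\<close> into the functions on \<open>Z\<close>.\<close>

definition spec_map :: "('a \<Rightarrow> complex) set \<Rightarrow> 'a \<Rightarrow> ('a \<Rightarrow> complex) \<Rightarrow> complex" where
  "spec_map A x = (\<lambda>f\<in>A. f x)"

section \<open>The special linear group and its representations\<close>

definition SL2 :: "(complex^2^2) set" where
  "SL2 = {g. det g = 1}"

definition unip :: "complex \<Rightarrow> complex^2^2" where
  "unip t = vector [vector [1, t], vector [0, 1]]"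

definition linear_Ga_action :: "(complex \<Rightarrow> complex^'n^'n) \<Rightarrow> bool" where
  "linear_Ga_action \<sigma> \<longleftrightarrow> \<sigma> 0 = mat 1 \<and> (\<forall>s t. \<sigma> (s + t) = \<sigma> s ** \<sigma> t) \<and>
     (\<forall>i j. (\<lambda>t. \<sigma> t $ i $ j) \<in> polynomials)"

definition SL2_representation :: "(complex^2^2 \<Rightarrow> complex^'n^'n) \<Rightarrow> bool" where
  "SL2_representation \<rho> \<longleftrightarrow> \<rho> (mat 1) = mat 1 \<and>
     (\<forall>g\<in>SL2. \<forall>h\<in>SL2. \<rho> (g ** h) = \<rho> g ** \<rho> h) \<and>
     (\<forall>i j. \<exists>p\<in>polynomials. \<forall>g\<in>SL2. \<rho> g $ i $ j = p g)"

section \<open>Stability\<close>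

definition stable_point ::
    "'a topology \<Rightarrow> 'g set \<Rightarrow> ('g \<Rightarrow> 'a \<Rightarrow> 'a) \<Rightarrow> 'a set \<Rightarrow> 'a \<Rightarrow> bool" where
  "stable_point T G act SS p \<longleftrightarrow> p \<in> SS \<and>
     closedin (subtopology T SS) (orb G act p) \<and> finite {g\<in>G. act g p = p}"

text \<open>
  Points of the projective space of \<open>'w\<close> are punctured lines. Sections of the \<open>m\<close>-th power of
  \<open>\<O>(1)\<close> are homogeneous polynomials of degree \<open>m\<close>; the nonvanishing locus of such a section is
  automatically affine for \<open>m > 0\<close>, so Mumford's definition of semistability needs no such condition.
\<close>

definition homogeneous :: "nat \<Rightarrow> ('w::affine_space \<Rightarrow> complex) set" where
  "homogeneous m = {F \<in> polynomials. \<forall>c w. F (cscale c w) = c ^ m * F w}"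

definition nonzero :: "'w::affine_space \<Rightarrow> bool" where
  "nonzero w \<longleftrightarrow> (\<exists>k\<in>coords. k w \<noteq> 0)"

definition proj_pt :: "'w::affine_space \<Rightarrow> 'w set" where
  "proj_pt w = {cscale c w | c. c \<noteq> 0}"

definition proj_topology :: "'w::affine_space set topology" where
  "proj_topology = topology_generated_by
     {proj_pt ` {w. nonzero w \<and> F w \<noteq> 0} | F. \<exists>m. F \<in> homogeneous m}"

definition proj_semistable :: "'g set \<Rightarrow> ('g \<Rightarrow> 'w \<Rightarrow> 'w) \<Rightarrow> 'w::affine_space set set" where
  "proj_semistable G act = {proj_pt w | w. nonzero w \<and>
     (\<exists>m>0. \<exists>F\<in>homogeneous m. (\<forall>g\<in>G. \<forall>v. F (act g v) = F v) \<and> F w \<noteq> 0)}"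

definition proj_stable :: "'g set \<Rightarrow> ('g \<Rightarrow> 'w \<Rightarrow> 'w) \<Rightarrow> 'w::affine_space set set" where
  "proj_stable G act =
     {L. stable_point proj_topology G (\<lambda>g. image (act g)) (proj_semistable G act) L}"

definition completely_stable_locus ::
    "(complex^2^2 \<Rightarrow> 'y \<Rightarrow> 'y) \<Rightarrow> 'y::affine_space set" where
  "completely_stable_locus act =
     {p. proj_pt (1::complex, p, vector [1, 0] :: complex^2) \<in>
           proj_stable SL2 (\<lambda>g (z, y, v). (z, act g y, g *v v))}"

text \<open>
  Stability with respect to the structure sheaf with its canonical linearisation: all powers of the
  linearisation are again the structure sheaf, with invariant regular functions as invariant sections.
\<close>

definition O_semistable :: "'g set \<Rightarrow> ('g \<Rightarrow> 'a \<Rightarrow> 'a) \<Rightarrow> 'a fspace \<Rightarrow> 'a set" where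
  "O_semistable G act E = {p \<in> points E. \<exists>f\<in>Reg E (points E).
     (\<forall>g\<in>G. \<forall>y\<in>points E. f (act g y) = f y) \<and> f p \<noteq> 0 \<and>
     affine_variety (open_sub E {y \<in> points E. f y \<noteq> 0})}"

definition O_stable :: "'g set \<Rightarrow> ('g \<Rightarrow> 'a \<Rightarrow> 'a) \<Rightarrow> 'a fspace \<Rightarrow> 'a set" where
  "O_stable G act E = {p. stable_point (Top E) G act (O_semistable G act E) p}"

text \<open>
  The diagonal action on \<open>X \<times> SL2\<close> uses the action of the unipotent subgroup on \<open>SL2\<close> by right
  translations, \<open>t \<cdot> g = g u(t)\<inverse> = g u(-t)\<close>; the residual action of \<open>SL2\<close> is by left translations.
\<close>

definition diag_act :: "(complex \<Rightarrow> 'a \<Rightarrow> 'a) \<Rightarrow> complex \<Rightarrow> 'a \<times> (complex^2^2) \<Rightarrow> 'a \<times> (complex^2^2)" where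
  "diag_act act t = (\<lambda>(x, g). (act t x, g ** unip (- t)))"

definition induced_space ::
    "(complex \<Rightarrow> 'a \<Rightarrow> 'a) \<Rightarrow> 'a fspace \<Rightarrow> ('a \<times> (complex^2^2)) set fspace" where
  "induced_space act X = orbit_space UNIV (diag_act act) (prod_space X (subvariety SL2))"

definition induced_act ::
    "complex^2^2 \<Rightarrow> ('a \<times> (complex^2^2)) set \<Rightarrow> ('a \<times> (complex^2^2)) set" where
  "induced_act h = image (\<lambda>(x, g). (x, h ** g))"

definition mumford_stable_locus :: "(complex \<Rightarrow> 'a \<Rightarrow> 'a) \<Rightarrow> 'a fspace \<Rightarrow> 'a set" where
  "mumford_stable_locus act X = {p \<in> points X.
     orb UNIV (diag_act act) (p, mat 1) \<in> O_stable SL2 induced_act (induced_space act X)}"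

section \<open>The cotangent lift and the moment map\<close>

text \<open>
  A point of the cotangent space of \<open>V\<close> is a pair of a column vector and a row vector.
\<close>

definition cotangent_lift ::
    "complex^'n^'n \<Rightarrow> (complex^'n) \<times> (complex^'n) \<Rightarrow> (complex^'n) \<times> (complex^'n)" where
  "cotangent_lift A = (\<lambda>(x, \<alpha>). (A *v x, \<alpha> v* matrix_inv A))"

text \<open>
  The value of the derivative of \<open>\<rho>\<close> at the matrix \<open>E\<close> with rows \<open>(0, 1)\<close>, \<open>(0, 0)\<close>, computed along
  the curve \<open>exp (t E) = I + t E = u(t)\<close>.
\<close>

definition drho_E :: "(complex^2^2 \<Rightarrow> complex^'n^'n) \<Rightarrow> complex^'n^'n" where
  "drho_E \<rho> = (\<chi> i j. deriv (\<lambda>t. \<rho> (unip t) $ i $ j) 0)"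

definition moment_map ::
    "(complex^2^2 \<Rightarrow> complex^'n^'n) \<Rightarrow> (complex^'n) \<times> (complex^'n) \<Rightarrow> complex" where
  "moment_map \<rho> = (\<lambda>(x, \<alpha>). \<Sum>i\<in>UNIV. \<alpha> $ i * (drho_E \<rho> *v x) $ i)"

definition level_set ::
    "(complex^2^2 \<Rightarrow> complex^'n^'n) \<Rightarrow> complex \<Rightarrow> ((complex^'n) \<times> (complex^'n)) set" where
  "level_set \<rho> \<xi> = {y. moment_map \<rho> y = \<xi>}"

end

theory Submission
  imports Defs
begin

text \<open>
  The Lie algebra element \<open>h = diag(1, -1)\<close> gives a second component \<open>\<eta>(x, \<alpha>) = \<alpha>(\<rho>\<^sub>*(h) x)\<close> of the moment
  map, and \<open>u(-t) h u(t) = h + 2 t E\<close> implies \<open>\<eta>(t \<cdot> y) = \<eta>(y) + 2 t \<mu>(y)\<close>. Hence \<open>s = \<eta> / (2 \<xi>)\<close> satisfies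
  \<open>s(t \<cdot> y) = s(y) + t\<close> on the level set \<open>\<mu> = \<xi>\<close>, which is therefore the product of the additive group
  with the smooth closed subset \<open>S = {\<mu> = \<xi>, \<eta> = 0}\<close>; the quotient is \<open>S\<close>. The same function trivialises
  the action on the product of the level set with \<open>SL2\<close>, so the induced space is affine with closed orbits.

  For complete stability, the orbit of \<open>[1 : y : e\<^sub>1]\<close> lies in the locus where the first coordinate \<open>z\<close>, an
  invariant section, does not vanish, and so does its closure in the semistable locus. There the quadratic
  form \<open>q\<^sub>y(v) = \<langle>\<mu>\<^bsub>SL2\<^esub>(y), v v\<^sup>T J\<rangle>\<close> on the plane is preserved by \<open>SL2\<close>, and a vector \<open>v\<close> with \<open>q\<^sub>y(v) = \<xi>\<close> has a
  canonical orthogonal complement; this reduces any \<open>(y, v)\<close> to a normal form depending polynomially on it.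
\<close>

section \<open>Polynomial functions\<close>

text \<open>The extension of the action to \<open>SL2\<close> is what supplies h, and the factor 2
  is that of the bracket [h, E] = 2 E. But \<rho> is controlled only on the group. The straight
  lines I + t X that stay in \<open>SL2\<close> are those with X nilpotent, so equivariance of the
  derivative is proved for the matrices \<open>nilp v\<close> alone. The element h enters by
  polarisation: \<eta> is minus the mixed coefficient of the quadratic form q_y, and the behaviour
  of mu, eta and the frame is read off from the invariance of this one form at a few vectors.

  Orbit spaces, products and spectra are at first only spaces with functions. The polynomial
  retraction y -> (-s(y)) . y onto S gives access to them: it identifies the orbit space with S, the
  invariants with polynomials composed with the retraction, and the characters of the ring of
  invariants with points of S.

  In projective space a semistable point with z = 0 has to be kept away from the orbit as well; its
  own invariant section does this. Where z is nonzero, what remains is that the orbit of (y, e1) is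
  closed in an affine space.\<close>

lemma alg_gen_cmult: "f \<in> alg_gen C \<Longrightarrow> (\<lambda>x. c * f x) \<in> alg_gen C"
  using alg_gen.mult[OF alg_gen.const] .

lemma alg_gen_uminus: "f \<in> alg_gen C \<Longrightarrow> (\<lambda>x. - f x) \<in> alg_gen C"
  using alg_gen_cmult[of f C "-1"] by simp

lemma alg_gen_diff: "f \<in> alg_gen C \<Longrightarrow> g \<in> alg_gen C \<Longrightarrow> (\<lambda>x. f x - g x) \<in> alg_gen C"
  using alg_gen.add[of f C "\<lambda>x. - g x"] alg_gen_uminus[of g C] by simp

lemma alg_gen_divide: "f \<in> alg_gen C \<Longrightarrow> (\<lambda>x. f x / c) \<in> alg_gen C"
  using alg_gen_cmult[of f C "inverse c"] by (simp add: field_simps)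

lemma alg_gen_power: "f \<in> alg_gen C \<Longrightarrow> (\<lambda>x. f x ^ n) \<in> alg_gen C"
  by (induction n) (auto intro: alg_gen.intros)

lemma alg_gen_sum: "(\<And>i. i \<in> I \<Longrightarrow> f i \<in> alg_gen C) \<Longrightarrow> (\<lambda>x. \<Sum>i\<in>I. f i x) \<in> alg_gen C"
  by (induction I rule: infinite_finite_induct) (auto intro: alg_gen.intros)

lemmas alg_gen_intros = alg_gen.const alg_gen.add alg_gen.mult alg_gen_cmult alg_gen_uminus
  alg_gen_diff alg_gen_divide alg_gen_power alg_gen_sum

lemma alg_gen_compose:
  assumes "p \<in> alg_gen C" and "\<And>k. k \<in> C \<Longrightarrow> (\<lambda>x. k (\<phi> x)) \<in> alg_gen D"
  shows "(\<lambda>x. p (\<phi> x)) \<in> alg_gen D"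
  using assms(1) by induction (auto intro: alg_gen.intros assms(2))

lemma alg_gen_mono: "p \<in> alg_gen C \<Longrightarrow> C \<subseteq> D \<Longrightarrow> p \<in> alg_gen D"
  using alg_gen_compose[of p C "\<lambda>x. x" D] by (auto intro: alg_gen.gen)

lemmas polynomials_intros = alg_gen_intros[where C = coords, folded polynomials_def]

lemma coords_polynomials: "k \<in> coords \<Longrightarrow> k \<in> polynomials"
  by (simp add: polynomials_def alg_gen.gen)

definition polynomial_map :: "('a::affine_space \<Rightarrow> 'b::affine_space) \<Rightarrow> bool" where
  "polynomial_map \<phi> \<longleftrightarrow> (\<forall>k\<in>coords. (\<lambda>x. k (\<phi> x)) \<in> polynomials)"

lemma polynomials_compose:
  assumes "p \<in> polynomials" and "polynomial_map \<phi>"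
  shows "(\<lambda>x. p (\<phi> x)) \<in> polynomials"
  using alg_gen_compose[of p coords \<phi> coords] assms by (simp add: polynomial_map_def polynomials_def)

lemma polynomial_map_compose:
  "polynomial_map \<phi> \<Longrightarrow> polynomial_map \<psi> \<Longrightarrow> polynomial_map (\<lambda>x. \<phi> (\<psi> x))"
  using polynomials_compose by (auto simp: polynomial_map_def)

lemma polynomial_map_id: "polynomial_map (\<lambda>x. x)"
  by (simp add: polynomial_map_def coords_polynomials)

lemma polynomial_map_const: "polynomial_map (\<lambda>_. c)"
  by (simp add: polynomial_map_def polynomials_intros)

lemma polynomial_map_fst: "polynomial_map fst"
  unfolding polynomial_map_def
  by (intro ballI coords_polynomials) (auto simp: coords_prod_def comp_def)

lemma polynomial_map_snd: "polynomial_map snd"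
  unfolding polynomial_map_def
  by (intro ballI coords_polynomials) (auto simp: coords_prod_def comp_def)

lemma polynomial_map_fst': "polynomial_map \<phi> \<Longrightarrow> polynomial_map (\<lambda>x. fst (\<phi> x))"
  by (rule polynomial_map_compose[OF polynomial_map_fst])

lemma polynomial_map_snd': "polynomial_map \<phi> \<Longrightarrow> polynomial_map (\<lambda>x. snd (\<phi> x))"
  by (rule polynomial_map_compose[OF polynomial_map_snd])

lemma polynomial_map_Pair:
  "polynomial_map \<phi> \<Longrightarrow> polynomial_map \<psi> \<Longrightarrow> polynomial_map (\<lambda>x. (\<phi> x, \<psi> x))"
  by (auto simp: polynomial_map_def coords_prod_def)

lemma polynomial_map_complex: "polynomial_map (\<phi> :: _ \<Rightarrow> complex) \<longleftrightarrow> \<phi> \<in> polynomials"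
  by (simp add: polynomial_map_def coords_complex_def)

lemma polynomial_map_vec:
  "polynomial_map \<phi> \<longleftrightarrow> (\<forall>i. polynomial_map (\<lambda>x. \<phi> x $ i))"
  by (auto simp: polynomial_map_def coords_vec_def)

lemma polynomial_map_vec_nth: "polynomial_map \<phi> \<Longrightarrow> polynomial_map (\<lambda>x. \<phi> x $ i)"
  by (simp add: polynomial_map_vec)

lemma polynomial_vec_nth:
  fixes \<phi> :: "'a::affine_space \<Rightarrow> complex ^ 'n"
  shows "polynomial_map \<phi> \<Longrightarrow> (\<lambda>x. \<phi> x $ i) \<in> polynomials"
  using polynomial_map_vec_nth polynomial_map_complex by blast

lemmas polynomial_map_intros = polynomial_map_id polynomial_map_const polynomial_map_fst'
  polynomial_map_snd' polynomial_map_Pair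

lemma affine_space_eqI:
  fixes x y :: "'a::affine_space"
  assumes "\<And>k. k \<in> coords \<Longrightarrow> k x = k y"
  shows "x = y"
  using ex1_coords[of "\<lambda>k. k x"] assms by metis

section \<open>Spaces with functions\<close>

text \<open>In contrast to \<open>variety\<close>, this property is visibly inherited by products and orbit spaces.\<close>

definition ringed :: "'a fspace \<Rightarrow> bool" where
  "ringed X \<longleftrightarrow> is_sheaf X \<and> (\<forall>U. openin (Top X) U \<longrightarrow>
     (\<forall>c. (\<lambda>_. c) \<in> Reg X U) \<and>
     (\<forall>f\<in>Reg X U. \<forall>g\<in>Reg X U. (\<lambda>x. f x + g x) \<in> Reg X U \<and> (\<lambda>x. f x * g x) \<in> Reg X U) \<and>
     (\<forall>f\<in>Reg X U. openin (Top X) {x\<in>U. f x \<noteq> 0} \<and>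
        (\<lambda>x. 1 / f x) \<in> Reg X {x\<in>U. f x \<noteq> 0}))"

context
  fixes X :: "'a fspace"
  assumes X: "ringed X"
begin

lemma ringed_Union: "(\<And>W. W \<in> \<W> \<Longrightarrow> openin (Top X) W) \<Longrightarrow> Reg X (\<Union>\<W>) = (\<Inter>W\<in>\<W>. Reg X W)"
  and ringed_cong: "openin (Top X) U \<Longrightarrow> f \<in> Reg X U \<Longrightarrow> (\<And>x. x \<in> U \<Longrightarrow> f x = g x) \<Longrightarrow> g \<in> Reg X U"
proof -
  from X have *: "\<forall>\<W>. (\<forall>W\<in>\<W>. openin (Top X) W) \<longrightarrow> Reg X (\<Union>\<W>) = (\<Inter>W\<in>\<W>. Reg X W)"
    and **: "\<forall>U f g. openin (Top X) U \<longrightarrow> (\<forall>x\<in>U. f x = g x) \<longrightarrow> f \<in> Reg X U \<longrightarrow> g \<in> Reg X U"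
    unfolding ringed_def is_sheaf_def by - (elim conjE, assumption)+
  show "(\<And>W. W \<in> \<W> \<Longrightarrow> openin (Top X) W) \<Longrightarrow> Reg X (\<Union>\<W>) = (\<Inter>W\<in>\<W>. Reg X W)"
    using *[rule_format, of \<W>] by simp
  show "openin (Top X) U \<Longrightarrow> f \<in> Reg X U \<Longrightarrow> (\<And>x. x \<in> U \<Longrightarrow> f x = g x) \<Longrightarrow> g \<in> Reg X U"
    using **[rule_format, of U f g] by simp
qed

text \<open>Restriction comes out of the gluing axiom: for V inside U the family {U, V} has union U,
  so \<open>Reg X U\<close> is the intersection of \<open>Reg X U\<close> and
  \<open>Reg X V\<close>.\<close>

lemma ringed_restrict:
  assumes "openin (Top X) U" "openin (Top X) V" "V \<subseteq> U" "f \<in> Reg X U"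
  shows "f \<in> Reg X V"
proof -
  have "Reg X (\<Union>{U, V}) = (\<Inter>W\<in>{U, V}. Reg X W)"
    by (rule ringed_Union) (use assms in auto)
  moreover have "\<Union>{U, V} = U" using assms(3) by auto
  ultimately show ?thesis using assms(4) by auto
qed

lemma ringed_local:
  assumes "\<And>x. x \<in> U \<Longrightarrow> \<exists>V. openin (Top X) V \<and> x \<in> V \<and> V \<subseteq> U \<and> f \<in> Reg X V"
  shows "f \<in> Reg X U"
proof -
  define \<W> where "\<W> = {V. openin (Top X) V \<and> V \<subseteq> U \<and> f \<in> Reg X V}"
  have "U = \<Union>\<W>" using assms unfolding \<W>_def by blast
  moreover have "Reg X (\<Union>\<W>) = (\<Inter>W\<in>\<W>. Reg X W)"
    by (rule ringed_Union) (simp add: \<W>_def)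
  ultimately show ?thesis unfolding \<W>_def by auto
qed

lemma ringed_const: "openin (Top X) U \<Longrightarrow> (\<lambda>_. c) \<in> Reg X U"
  and ringed_add: "openin (Top X) U \<Longrightarrow> f \<in> Reg X U \<Longrightarrow> g \<in> Reg X U \<Longrightarrow> (\<lambda>x. f x + g x) \<in> Reg X U"
  and ringed_mult: "openin (Top X) U \<Longrightarrow> f \<in> Reg X U \<Longrightarrow> g \<in> Reg X U \<Longrightarrow> (\<lambda>x. f x * g x) \<in> Reg X U"
  and ringed_open_nonzero: "openin (Top X) U \<Longrightarrow> f \<in> Reg X U \<Longrightarrow> openin (Top X) {x\<in>U. f x \<noteq> 0}"
  and ringed_inverse: "openin (Top X) U \<Longrightarrow> f \<in> Reg X U \<Longrightarrow> (\<lambda>x. 1 / f x) \<in> Reg X {x\<in>U. f x \<noteq> 0}"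
  using X unfolding ringed_def by blast+

lemma ringed_alg_gen:
  assumes "p \<in> alg_gen C" "openin (Top X) U" "\<And>k. k \<in> C \<Longrightarrow> (\<lambda>x. k (\<phi> x)) \<in> Reg X U"
  shows "(\<lambda>x. p (\<phi> x)) \<in> Reg X U"
  using assms(1) by induction (auto intro: ringed_const ringed_add ringed_mult assms(2,3))

lemma ringed_quotient:
  assumes U: "openin (Top X) U" and f: "f \<in> Reg X U" and g: "g \<in> Reg X U"
  shows "(\<lambda>x. f x / g x) \<in> Reg X {x\<in>U. g x \<noteq> 0}"
proof -
  have V: "openin (Top X) {x\<in>U. g x \<noteq> 0}" using U g by (rule ringed_open_nonzero)
  have "f \<in> Reg X {x\<in>U. g x \<noteq> 0}" by (rule ringed_restrict[OF U V _ f]) auto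
  from ringed_mult[OF V this ringed_inverse[OF U g]] show ?thesis by simp
qed

end

section \<open>Morphisms and isomorphisms of spaces with functions\<close>

lemma open_sub_points: "open_sub X (points X) = X"
  by (simp add: open_sub_def)

lemma morphism_points: "morphism X Y \<phi> \<Longrightarrow> x \<in> points X \<Longrightarrow> \<phi> x \<in> points Y"
  by (auto simp: morphism_def continuous_map_def)

lemma morphism_open:
  "morphism X Y \<phi> \<Longrightarrow> openin (Top Y) U \<Longrightarrow> openin (Top X) {x\<in>points X. \<phi> x \<in> U}"
  by (auto simp: morphism_def continuous_map_def)

lemma morphism_Reg:
  "morphism X Y \<phi> \<Longrightarrow> openin (Top Y) U \<Longrightarrow> f \<in> Reg Y U \<Longrightarrow>
     (\<lambda>x. f (\<phi> x)) \<in> Reg X {x \<in> points X. \<phi> x \<in> U}"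
  by (auto simp: morphism_def comp_def)

lemma morphism_compose:
  assumes "morphism X Y \<phi>" "morphism Y Z \<psi>"
  shows "morphism X Z (\<lambda>x. \<psi> (\<phi> x))"
  unfolding morphism_def
proof (intro conjI allI impI)
  show "continuous_map (Top X) (Top Z) (\<lambda>x. \<psi> (\<phi> x))"
    using assms continuous_map_compose[of "Top X" "Top Y" \<phi> "Top Z" \<psi>]
    by (simp add: morphism_def comp_def)
next
  fix U f assume U: "openin (Top Z) U" and f: "f \<in> Reg Z U"
  have "{x \<in> points X. \<phi> x \<in> {y \<in> points Y. \<psi> y \<in> U}} = {x \<in> points X. \<psi> (\<phi> x) \<in> U}"
    using morphism_points[OF assms(1)] by auto
  with morphism_Reg[OF assms(1) morphism_open[OF assms(2) U] morphism_Reg[OF assms(2) U f]]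
  show "f \<circ> (\<lambda>x. \<psi> (\<phi> x)) \<in> Reg X {x \<in> points X. \<psi> (\<phi> x) \<in> U}"
    by (simp add: comp_def)
qed

lemma isomorphismI:
  "morphism X Y \<phi> \<Longrightarrow> morphism Y X \<psi> \<Longrightarrow> (\<And>x. x \<in> points X \<Longrightarrow> \<psi> (\<phi> x) = x) \<Longrightarrow>
     (\<And>y. y \<in> points Y \<Longrightarrow> \<phi> (\<psi> y) = y) \<Longrightarrow> isomorphism X Y \<phi>"
  by (auto simp: isomorphism_def)

lemma isomorphism_compose:
  assumes "isomorphism X Y \<phi>" "isomorphism Y Z \<psi>"
  shows "isomorphism X Z (\<lambda>x. \<psi> (\<phi> x))"
proof -
  obtain \<phi>' where \<phi>': "morphism X Y \<phi>" "morphism Y X \<phi>'" "\<forall>x\<in>points X. \<phi>' (\<phi> x) = x"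
      "\<forall>y\<in>points Y. \<phi> (\<phi>' y) = y"
    using assms(1) by (auto simp: isomorphism_def)
  obtain \<psi>' where \<psi>': "morphism Y Z \<psi>" "morphism Z Y \<psi>'" "\<forall>x\<in>points Y. \<psi>' (\<psi> x) = x"
      "\<forall>y\<in>points Z. \<psi> (\<psi>' y) = y"
    using assms(2) by (auto simp: isomorphism_def)
  show ?thesis
    by (rule isomorphismI[OF morphism_compose[OF \<phi>'(1) \<psi>'(1)] morphism_compose[OF \<psi>'(2) \<phi>'(2)]])
       (use \<phi>' \<psi>' in \<open>simp_all add: morphism_points\<close>)
qed

subsection \<open>Spaces given by local fractions\<close>

text \<open>A common form of \<open>fun_space\<close> and \<open>prod_space\<close>: charts \<open>D\<close> with an algebra of functions on each.\<close>

definition local_space :: "('a set \<times> ('a \<Rightarrow> complex) set) set \<Rightarrow> 'a fspace" where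
  "local_space \<F> = \<lparr> Top = topology_generated_by {{p \<in> D. a p \<noteq> 0} | D a. \<exists>A. (D, A) \<in> \<F> \<and> a \<in> A},
     Reg = (\<lambda>W. {h. \<forall>p\<in>W. \<exists>D A. (D, A) \<in> \<F> \<and> p \<in> D \<and> (\<exists>a\<in>A. \<exists>b\<in>A. b p \<noteq> 0 \<and>
              (\<forall>q \<in> W \<inter> D. b q \<noteq> 0 \<longrightarrow> h q = a q / b q))}) \<rparr>"

text \<open>Closure is demanded only up to values on D: on a spectrum, for instance, evaluation at
  \<open>pullback (\<lambda>_. c)\<close> is a constant function only on genuine characters.\<close>

definition algebra_on :: "'a set \<Rightarrow> ('a \<Rightarrow> complex) set \<Rightarrow> bool" where
  "algebra_on D A \<longleftrightarrow> (\<forall>c. \<exists>h\<in>A. \<forall>x\<in>D. h x = c) \<and>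
     (\<forall>f\<in>A. \<forall>g\<in>A. (\<exists>h\<in>A. \<forall>x\<in>D. h x = f x + g x) \<and> (\<exists>h\<in>A. \<forall>x\<in>D. h x = f x * g x))"

lemma algebra_on_alg_gen: "algebra_on D (alg_gen C)"
  unfolding algebra_on_def
proof (intro conjI allI ballI)
  show "\<exists>h\<in>alg_gen C. \<forall>x\<in>D. h x = c" for c
    by (rule bexI[OF _ alg_gen.const[of c]]) simp
  fix f g assume f: "f \<in> alg_gen C" and g: "g \<in> alg_gen C"
  show "\<exists>h\<in>alg_gen C. \<forall>x\<in>D. h x = f x + g x"
    by (rule bexI[OF _ alg_gen.add[OF f g]]) simp
  show "\<exists>h\<in>alg_gen C. \<forall>x\<in>D. h x = f x * g x"
    by (rule bexI[OF _ alg_gen.mult[OF f g]]) simp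
qed

lemma algebra_onE_const:
  assumes "algebra_on D A"
  obtains h where "h \<in> A" "\<And>x. x \<in> D \<Longrightarrow> h x = c"
proof -
  have "\<exists>h\<in>A. \<forall>x\<in>D. h x = c" using assms by (simp add: algebra_on_def)
  then show ?thesis using that by blast
qed

lemma algebra_onE_add:
  assumes "algebra_on D A" "f \<in> A" "g \<in> A"
  obtains h where "h \<in> A" "\<And>x. x \<in> D \<Longrightarrow> h x = f x + g x"
proof -
  have "\<exists>h\<in>A. \<forall>x\<in>D. h x = f x + g x" using assms by (simp add: algebra_on_def)
  then show ?thesis using that by blast
qed

lemma algebra_onE_mult:
  assumes "algebra_on D A" "f \<in> A" "g \<in> A"
  obtains h where "h \<in> A" "\<And>x. x \<in> D \<Longrightarrow> h x = f x * g x"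
proof -
  have "\<exists>h\<in>A. \<forall>x\<in>D. h x = f x * g x" using assms by (simp add: algebra_on_def)
  then show ?thesis using that by blast
qed

text \<open>Directedness puts two local fractions on a common chart. For products this is the
  passage to a smaller rectangle, where the tensor algebra grows.\<close>

locale charts =
  fixes \<F> :: "('a set \<times> ('a \<Rightarrow> complex) set) set"
  assumes chart_algebra: "(D, A) \<in> \<F> \<Longrightarrow> algebra_on D A"
    and chart_directed: "(D, A) \<in> \<F> \<Longrightarrow> (D', A') \<in> \<F> \<Longrightarrow> \<exists>A''. (D \<inter> D', A'') \<in> \<F> \<and> A \<union> A' \<subseteq> A''"
begin

lemma chart_refine:
  assumes "(D, A) \<in> \<F>" "(D', A') \<in> \<F>"
  obtains A'' where "(D \<inter> D', A'') \<in> \<F>" "A \<subseteq> A''" "A' \<subseteq> A''" "algebra_on (D \<inter> D') A''"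
  using chart_directed[OF assms] chart_algebra by (metis Un_subset_iff)

definition basic :: "'a set \<Rightarrow> bool" where
  "basic W \<longleftrightarrow> (\<exists>D A a. (D, A) \<in> \<F> \<and> a \<in> A \<and> W = {p\<in>D. a p \<noteq> 0})"

lemma basicI: "(D, A) \<in> \<F> \<Longrightarrow> a \<in> A \<Longrightarrow> basic {p\<in>D. a p \<noteq> 0}"
  unfolding basic_def by blast

lemma basicE:
  assumes "basic W"
  obtains D A a where "(D, A) \<in> \<F>" "a \<in> A" "W = {p\<in>D. a p \<noteq> 0}"
  using assms unfolding basic_def by blast

lemma basic_Int: "basic V \<Longrightarrow> basic W \<Longrightarrow> basic (V \<inter> W)"
proof -
  assume "basic V" then obtain D A a where 1: "(D, A) \<in> \<F>" "a \<in> A" "V = {p\<in>D. a p \<noteq> 0}"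
    by (rule basicE)
  assume "basic W" then obtain D' A' a' where 2: "(D', A') \<in> \<F>" "a' \<in> A'" "W = {p\<in>D'. a' p \<noteq> 0}"
    by (rule basicE)
  from 1(1) 2(1) obtain A'' where A'': "(D \<inter> D', A'') \<in> \<F>" "A \<subseteq> A''" "A' \<subseteq> A''" "algebra_on (D \<inter> D') A''"
    by (rule chart_refine) blast
  have "a \<in> A''" "a' \<in> A''" using A'' 1(2) 2(2) by auto
  with A''(4) obtain h where h: "h \<in> A''" "\<And>x. x \<in> D \<inter> D' \<Longrightarrow> h x = a x * a' x"
    by (rule algebra_onE_mult) blast
  then have "V \<inter> W = {p \<in> D \<inter> D'. h p \<noteq> 0}" using 1 2 by auto
  then show ?thesis using basicI[OF A''(1) h(1)] by simp
qed

text \<open>Basic sets are stable under intersection, by multiplying their defining functions on a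
  common chart; so they form a base and not merely a subbase.\<close>

lemma openin_local_space:
  "openin (Top (local_space \<F>)) W \<longleftrightarrow> (\<forall>p\<in>W. \<exists>V. basic V \<and> p \<in> V \<and> V \<subseteq> W)"
proof
  assume "openin (Top (local_space \<F>)) W"
  then have "generate_topology_on {{p \<in> D. a p \<noteq> 0} | D a. \<exists>A. (D, A) \<in> \<F> \<and> a \<in> A} W"
    by (simp add: local_space_def openin_topology_generated_by)
  then show "\<forall>p\<in>W. \<exists>V. basic V \<and> p \<in> V \<and> V \<subseteq> W"
  proof induction
    case Empty then show ?case by simp
  next
    case (Int a b)
    show ?case
    proof
      fix p assume "p \<in> a \<inter> b"
      then obtain V V' where "basic V" "p \<in> V" "V \<subseteq> a" "basic V'" "p \<in> V'" "V' \<subseteq> b"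
        using Int.IH by blast
      then have "basic (V \<inter> V')" "p \<in> V \<inter> V'" "V \<inter> V' \<subseteq> a \<inter> b" using basic_Int[of V V'] by auto
      then show "\<exists>V. basic V \<and> p \<in> V \<and> V \<subseteq> a \<inter> b" by blast
    qed
  next
    case (UN K) then show ?case by (meson Union_iff Union_upper order_trans)
  next
    case (Basis s) then have "basic s" unfolding basic_def by blast
    then show ?case by blast
  qed
next
  assume *: "\<forall>p\<in>W. \<exists>V. basic V \<and> p \<in> V \<and> V \<subseteq> W"
  have "openin (Top (local_space \<F>)) V" if "basic V" for V
    using that unfolding local_space_def basic_def by (auto intro!: topology_generated_by_Basis)
  then have "\<forall>p\<in>W. \<exists>V. openin (Top (local_space \<F>)) V \<and> p \<in> V \<and> V \<subseteq> W" using * by meson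
  then show "openin (Top (local_space \<F>)) W" by (subst openin_subopen)
qed

lemma points_local_space: "points (local_space \<F>) = (\<Union>(D, A)\<in>\<F>. D)"
proof (intro equalityI subsetI)
  fix p assume "p \<in> points (local_space \<F>)"
  then show "p \<in> (\<Union>(D, A)\<in>\<F>. D)" by (auto simp: local_space_def)
next
  fix p assume "p \<in> (\<Union>(D, A)\<in>\<F>. D)"
  then obtain D A where DA: "(D, A) \<in> \<F>" "p \<in> D" by blast
  obtain h where h: "h \<in> A" "\<And>x. x \<in> D \<Longrightarrow> h x = 1"
    using chart_algebra[OF DA(1)] by (rule algebra_onE_const) blast
  have "{p \<in> D. h p \<noteq> 0} = D" using h(2) by auto
  then have "basic D" using basicI[OF DA(1) h(1)] by simp
  then have "openin (Top (local_space \<F>)) D" unfolding openin_local_space by blast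
  then show "p \<in> points (local_space \<F>)" using DA(2) openin_subset by blast
qed

lemma Reg_local_space: "h \<in> Reg (local_space \<F>) W \<longleftrightarrow>
   (\<forall>p\<in>W. \<exists>D A. (D, A) \<in> \<F> \<and> p \<in> D \<and> (\<exists>a\<in>A. \<exists>b\<in>A. b p \<noteq> 0 \<and>
              (\<forall>q \<in> W \<inter> D. b q \<noteq> 0 \<longrightarrow> h q = a q / b q)))"
  by (simp add: local_space_def)

text \<open>\<open>Reg\<close> asks for a fraction valid on a whole chart. A fraction a / b valid
  only on a basic set where e is nonzero is expanded to (a e) / (b e), whose denominator vanishes
  elsewhere.\<close>

lemma Reg_local_spaceI:
  assumes "\<And>p. p \<in> W \<Longrightarrow> \<exists>D A V. (D, A) \<in> \<F> \<and> p \<in> D \<and> basic V \<and> p \<in> V \<and> (\<exists>a\<in>A. \<exists>b\<in>A. b p \<noteq> 0 \<and>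
              (\<forall>q \<in> W \<inter> D \<inter> V. b q \<noteq> 0 \<longrightarrow> h q = a q / b q))"
  shows "h \<in> Reg (local_space \<F>) W"
  unfolding Reg_local_space
proof
  fix p assume "p \<in> W"
  from assms[OF this] obtain D A V a b where 1: "(D, A) \<in> \<F>" "p \<in> D" "basic V" "p \<in> V" "a \<in> A" "b \<in> A" "b p \<noteq> 0"
      and 18: "\<forall>q \<in> W \<inter> D \<inter> V. b q \<noteq> 0 \<longrightarrow> h q = a q / b q"
    by (elim exE conjE bexE)
  from 1(3) obtain D' A' e where 2: "(D', A') \<in> \<F>" "e \<in> A'" "V = {p\<in>D'. e p \<noteq> 0}" by (rule basicE)
  from 1(1) 2(1) obtain A'' where A'': "(D \<inter> D', A'') \<in> \<F>" "A \<subseteq> A''" "A' \<subseteq> A''" "algebra_on (D \<inter> D') A''"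
    by (rule chart_refine) blast
  have in3: "a \<in> A''" "b \<in> A''" "e \<in> A''" using A'' 1 2 by auto
  from A''(4) in3(1,3) obtain a' where a': "a' \<in> A''" "\<And>x. x \<in> D \<inter> D' \<Longrightarrow> a' x = a x * e x"
    by (rule algebra_onE_mult) blast
  from A''(4) in3(2,3) obtain b' where b': "b' \<in> A''" "\<And>x. x \<in> D \<inter> D' \<Longrightarrow> b' x = b x * e x"
    by (rule algebra_onE_mult) blast
  have "p \<in> D \<inter> D'" "b' p \<noteq> 0" using 1 2 b' by auto
  moreover have "\<forall>q \<in> W \<inter> (D \<inter> D'). b' q \<noteq> 0 \<longrightarrow> h q = a' q / b' q"
    using a'(2) b'(2) 18 2(3) by auto
  ultimately show "\<exists>D A. (D, A) \<in> \<F> \<and> p \<in> D \<and> (\<exists>a\<in>A. \<exists>b\<in>A. b p \<noteq> 0 \<and>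
              (\<forall>q \<in> W \<inter> D. b q \<noteq> 0 \<longrightarrow> h q = a q / b q))"
    using A''(1) a'(1) b'(1) by blast
qed

lemma Reg_local_spaceE:
  assumes "f \<in> Reg (local_space \<F>) U" "p \<in> U"
  obtains D A a b where "(D, A) \<in> \<F>" "p \<in> D" "algebra_on D A" "a \<in> A" "b \<in> A" "b p \<noteq> 0"
    "\<And>q. q \<in> U \<Longrightarrow> q \<in> D \<Longrightarrow> b q \<noteq> 0 \<Longrightarrow> f q = a q / b q"
proof -
  from assms obtain D A a b where 1: "(D, A) \<in> \<F>" "p \<in> D" "a \<in> A" "b \<in> A" "b p \<noteq> 0"
    "\<forall>q \<in> U \<inter> D. b q \<noteq> 0 \<longrightarrow> f q = a q / b q"
    unfolding Reg_local_space by blast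
  then show ?thesis by (intro that[OF 1(1,2) chart_algebra[OF 1(1)] 1(3-5)]) auto
qed

lemma Reg_local_spaceE2:
  assumes "f \<in> Reg (local_space \<F>) U" "g \<in> Reg (local_space \<F>) U" "p \<in> U"
  obtains D A a b c d where "(D, A) \<in> \<F>" "p \<in> D" "algebra_on D A" "a \<in> A" "b \<in> A" "b p \<noteq> 0"
    "c \<in> A" "d \<in> A" "d p \<noteq> 0"
    "\<And>q. q \<in> U \<Longrightarrow> q \<in> D \<Longrightarrow> b q \<noteq> 0 \<Longrightarrow> f q = a q / b q"
    "\<And>q. q \<in> U \<Longrightarrow> q \<in> D \<Longrightarrow> d q \<noteq> 0 \<Longrightarrow> g q = c q / d q"
proof -
  obtain D A a b where 1: "(D, A) \<in> \<F>" "p \<in> D" "algebra_on D A" "a \<in> A" "b \<in> A" "b p \<noteq> 0"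
    "\<And>q. q \<in> U \<Longrightarrow> q \<in> D \<Longrightarrow> b q \<noteq> 0 \<Longrightarrow> f q = a q / b q"
    using assms(1,3) by (rule Reg_local_spaceE) blast
  obtain D' A' c d where 2: "(D', A') \<in> \<F>" "p \<in> D'" "algebra_on D' A'" "c \<in> A'" "d \<in> A'" "d p \<noteq> 0"
    "\<And>q. q \<in> U \<Longrightarrow> q \<in> D' \<Longrightarrow> d q \<noteq> 0 \<Longrightarrow> g q = c q / d q"
    using assms(2,3) by (rule Reg_local_spaceE) blast
  from 1(1) 2(1) obtain A'' where A'': "(D \<inter> D', A'') \<in> \<F>" "A \<subseteq> A''" "A' \<subseteq> A''" "algebra_on (D \<inter> D') A''"
    by (rule chart_refine) blast
  show ?thesis
    by (rule that[of "D \<inter> D'" A'' a b c d]) (use 1 2 A'' in auto)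
qed

lemma ringed_local_space: "ringed (local_space \<F>)"
  unfolding ringed_def
proof (intro conjI allI impI ballI)
  show "is_sheaf (local_space \<F>)"
    unfolding is_sheaf_def
  proof (intro conjI allI impI)
    fix \<W> assume \<W>: "\<forall>W\<in>\<W>. openin (Top (local_space \<F>)) W"
    show "Reg (local_space \<F>) (\<Union>\<W>) = (\<Inter>W\<in>\<W>. Reg (local_space \<F>) W)"
    proof (intro equalityI subsetI INT_I)
      fix h W assume "h \<in> Reg (local_space \<F>) (\<Union>\<W>)" and W: "W \<in> \<W>"
      show "h \<in> Reg (local_space \<F>) W"
        unfolding Reg_local_space
      proof
        fix p assume "p \<in> W"
        with W have "p \<in> \<Union>\<W>" by blast
        with \<open>h \<in> Reg (local_space \<F>) (\<Union>\<W>)\<close> obtain D A a b where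
          1: "(D, A) \<in> \<F>" "p \<in> D" "algebra_on D A" "a \<in> A" "b \<in> A" "b p \<noteq> 0"
            "\<And>q. q \<in> \<Union>\<W> \<Longrightarrow> q \<in> D \<Longrightarrow> b q \<noteq> 0 \<Longrightarrow> h q = a q / b q"
          by (rule Reg_local_spaceE) blast
        have "\<forall>q \<in> W \<inter> D. b q \<noteq> 0 \<longrightarrow> h q = a q / b q" using 1(7) W by auto
        then show "\<exists>D A. (D, A) \<in> \<F> \<and> p \<in> D \<and> (\<exists>a\<in>A. \<exists>b\<in>A. b p \<noteq> 0 \<and>
              (\<forall>q \<in> W \<inter> D. b q \<noteq> 0 \<longrightarrow> h q = a q / b q))"
          using 1 by blast
      qed
    next
      fix h assume h: "h \<in> (\<Inter>W\<in>\<W>. Reg (local_space \<F>) W)"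
      show "h \<in> Reg (local_space \<F>) (\<Union>\<W>)"
      proof (rule Reg_local_spaceI)
        fix p assume "p \<in> \<Union>\<W>"
        then obtain W where W: "W \<in> \<W>" "p \<in> W" by blast
        then have "h \<in> Reg (local_space \<F>) W" using h by blast
        then obtain D A a b where 1: "(D, A) \<in> \<F>" "p \<in> D" "algebra_on D A" "a \<in> A" "b \<in> A" "b p \<noteq> 0"
          "\<And>q. q \<in> W \<Longrightarrow> q \<in> D \<Longrightarrow> b q \<noteq> 0 \<Longrightarrow> h q = a q / b q"
          using W(2) by (rule Reg_local_spaceE) blast
        obtain V where V: "basic V" "p \<in> V" "V \<subseteq> W"
          using \<W> W unfolding openin_local_space by blast
        show "\<exists>D A V. (D, A) \<in> \<F> \<and> p \<in> D \<and> basic V \<and> p \<in> V \<and> (\<exists>a\<in>A. \<exists>b\<in>A. b p \<noteq> 0 \<and>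
              (\<forall>q \<in> \<Union>\<W> \<inter> D \<inter> V. b q \<noteq> 0 \<longrightarrow> h q = a q / b q))"
          by (rule exI[of _ D], rule exI[of _ A], rule exI[of _ V]) (use 1 V in blast)
      qed
    qed
  next
    fix U and f g :: "'a \<Rightarrow> complex" assume "\<forall>x\<in>U. f x = g x" "f \<in> Reg (local_space \<F>) U"
    then show "g \<in> Reg (local_space \<F>) U" unfolding Reg_local_space by (metis IntD1)
  qed
next
  fix U c assume U: "openin (Top (local_space \<F>)) U"
  show "(\<lambda>_. c) \<in> Reg (local_space \<F>) U"
    unfolding Reg_local_space
  proof
    fix p assume "p \<in> U"
    then obtain D A where D: "(D, A) \<in> \<F>" "p \<in> D" using U unfolding openin_local_space basic_def by blast
    obtain h where "h \<in> A" "\<And>x. x \<in> D \<Longrightarrow> h x = c"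
      using chart_algebra[OF D(1)] by (rule algebra_onE_const) blast
    moreover obtain e where "e \<in> A" "\<And>x. x \<in> D \<Longrightarrow> e x = 1"
      using chart_algebra[OF D(1)] by (rule algebra_onE_const) blast
    ultimately show "\<exists>D A. (D, A) \<in> \<F> \<and> p \<in> D \<and> (\<exists>a\<in>A. \<exists>b\<in>A. b p \<noteq> 0 \<and>
              (\<forall>q \<in> U \<inter> D. b q \<noteq> 0 \<longrightarrow> c = a q / b q))"
      using D by (intro exI[of _ D] exI[of _ A] conjI bexI[of _ h] bexI[of _ e]) auto
  qed
next
  fix U f g assume f: "f \<in> Reg (local_space \<F>) U" and g: "g \<in> Reg (local_space \<F>) U"
  show "(\<lambda>x. f x + g x) \<in> Reg (local_space \<F>) U"
    unfolding Reg_local_space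
  proof
    fix p assume "p \<in> U"
    from f g this obtain D A a b c d where 1: "(D, A) \<in> \<F>" "p \<in> D" "algebra_on D A"
        "a \<in> A" "b \<in> A" "b p \<noteq> 0" "c \<in> A" "d \<in> A" "d p \<noteq> 0"
        "\<And>q. q \<in> U \<Longrightarrow> q \<in> D \<Longrightarrow> b q \<noteq> 0 \<Longrightarrow> f q = a q / b q"
        "\<And>q. q \<in> U \<Longrightarrow> q \<in> D \<Longrightarrow> d q \<noteq> 0 \<Longrightarrow> g q = c q / d q"
      by (rule Reg_local_spaceE2) blast
    obtain ad where ad: "ad \<in> A" "\<And>x. x \<in> D \<Longrightarrow> ad x = a x * d x"
      using 1(3,4,8) by (rule algebra_onE_mult) blast
    obtain cb where cb: "cb \<in> A" "\<And>x. x \<in> D \<Longrightarrow> cb x = c x * b x"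
      using 1(3,7,5) by (rule algebra_onE_mult) blast
    obtain bd where bd: "bd \<in> A" "\<And>x. x \<in> D \<Longrightarrow> bd x = b x * d x"
      using 1(3,5,8) by (rule algebra_onE_mult) blast
    obtain n where n: "n \<in> A" "\<And>x. x \<in> D \<Longrightarrow> n x = ad x + cb x"
      using 1(3) ad(1) cb(1) by (rule algebra_onE_add) blast
    show "\<exists>D A. (D, A) \<in> \<F> \<and> p \<in> D \<and> (\<exists>a\<in>A. \<exists>b\<in>A. b p \<noteq> 0 \<and>
              (\<forall>q \<in> U \<inter> D. b q \<noteq> 0 \<longrightarrow> f q + g q = a q / b q))"
      using 1 by (intro exI[of _ D] exI[of _ A] conjI bexI[OF _ n(1)] bexI[OF _ bd(1)])
        (auto simp: n bd ad cb add_frac_eq)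
  qed
  show "(\<lambda>x. f x * g x) \<in> Reg (local_space \<F>) U"
    unfolding Reg_local_space
  proof
    fix p assume "p \<in> U"
    from f g this obtain D A a b c d where 1: "(D, A) \<in> \<F>" "p \<in> D" "algebra_on D A"
        "a \<in> A" "b \<in> A" "b p \<noteq> 0" "c \<in> A" "d \<in> A" "d p \<noteq> 0"
        "\<And>q. q \<in> U \<Longrightarrow> q \<in> D \<Longrightarrow> b q \<noteq> 0 \<Longrightarrow> f q = a q / b q"
        "\<And>q. q \<in> U \<Longrightarrow> q \<in> D \<Longrightarrow> d q \<noteq> 0 \<Longrightarrow> g q = c q / d q"
      by (rule Reg_local_spaceE2) blast
    obtain ac where ac: "ac \<in> A" "\<And>x. x \<in> D \<Longrightarrow> ac x = a x * c x"
      using 1(3,4,7) by (rule algebra_onE_mult) blast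
    obtain bd where bd: "bd \<in> A" "\<And>x. x \<in> D \<Longrightarrow> bd x = b x * d x"
      using 1(3,5,8) by (rule algebra_onE_mult) blast
    show "\<exists>D A. (D, A) \<in> \<F> \<and> p \<in> D \<and> (\<exists>a\<in>A. \<exists>b\<in>A. b p \<noteq> 0 \<and>
              (\<forall>q \<in> U \<inter> D. b q \<noteq> 0 \<longrightarrow> f q * g q = a q / b q))"
      using 1 by (intro exI[of _ D] exI[of _ A] conjI bexI[OF _ ac(1)] bexI[OF _ bd(1)])
        (auto simp: bd ac)
  qed
next
  fix U f assume U: "openin (Top (local_space \<F>)) U" and f: "f \<in> Reg (local_space \<F>) U"
  show "openin (Top (local_space \<F>)) {x \<in> U. f x \<noteq> 0}"
    unfolding openin_local_space
  proof
    fix p assume p: "p \<in> {x \<in> U. f x \<noteq> 0}"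
    then have "p \<in> U" by auto
    with f obtain D A a b where 1: "(D, A) \<in> \<F>" "p \<in> D" "algebra_on D A" "a \<in> A" "b \<in> A" "b p \<noteq> 0"
        "\<And>q. q \<in> U \<Longrightarrow> q \<in> D \<Longrightarrow> b q \<noteq> 0 \<Longrightarrow> f q = a q / b q"
      by (rule Reg_local_spaceE) blast
    obtain V where V: "basic V" "p \<in> V" "V \<subseteq> U"
      using U \<open>p \<in> U\<close> unfolding openin_local_space by blast
    \<comment> \<open>The product a b in place of a: its nonvanishing also keeps b nonzero, which is
      where the fraction represents f.\<close>
    obtain ab where ab: "ab \<in> A" "\<And>x. x \<in> D \<Longrightarrow> ab x = a x * b x"
      using 1(3,4,5) by (rule algebra_onE_mult) blast
    have "basic (V \<inter> {x\<in>D. ab x \<noteq> 0})" using V(1) basicI[OF 1(1) ab(1)] by (rule basic_Int)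
    moreover have "p \<in> V \<inter> {x\<in>D. ab x \<noteq> 0}" using V 1 ab p by auto
    moreover have "V \<inter> {x\<in>D. ab x \<noteq> 0} \<subseteq> {x \<in> U. f x \<noteq> 0}" using V 1 ab by auto
    ultimately show "\<exists>V. basic V \<and> p \<in> V \<and> V \<subseteq> {x \<in> U. f x \<noteq> 0}" by blast
  qed
  show "(\<lambda>x. 1 / f x) \<in> Reg (local_space \<F>) {x \<in> U. f x \<noteq> 0}"
    unfolding Reg_local_space
  proof
    fix p assume p: "p \<in> {x \<in> U. f x \<noteq> 0}"
    then have "p \<in> U" by auto
    with f obtain D A a b where 1: "(D, A) \<in> \<F>" "p \<in> D" "algebra_on D A" "a \<in> A" "b \<in> A" "b p \<noteq> 0"
        "\<And>q. q \<in> U \<Longrightarrow> q \<in> D \<Longrightarrow> b q \<noteq> 0 \<Longrightarrow> f q = a q / b q"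
      by (rule Reg_local_spaceE) blast
    \<comment> \<open>1 / f = b / a is written as (b b) / (a b), so that a nonzero denominator again
      forces b to be nonzero.\<close>
    obtain ab where ab: "ab \<in> A" "\<And>x. x \<in> D \<Longrightarrow> ab x = a x * b x"
      using 1(3,4,5) by (rule algebra_onE_mult) blast
    obtain bb where bb: "bb \<in> A" "\<And>x. x \<in> D \<Longrightarrow> bb x = b x * b x"
      using 1(3,5,5) by (rule algebra_onE_mult) blast
    show "\<exists>D A. (D, A) \<in> \<F> \<and> p \<in> D \<and> (\<exists>a\<in>A. \<exists>b\<in>A. b p \<noteq> 0 \<and>
              (\<forall>q \<in> {x \<in> U. f x \<noteq> 0} \<inter> D. b q \<noteq> 0 \<longrightarrow> 1 / f q = a q / b q))"
      using 1 p by (intro exI[of _ D] exI[of _ A] conjI bexI[OF _ bb(1)] bexI[OF _ ab(1)])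
        (auto simp: bb ab)
  qed
qed

text \<open>A fraction of chart functions pulls back to a fraction of regular functions, and
  regularity is local; so data on the charts suffice.\<close>

lemma morphism_local_spaceI:
  assumes T: "ringed T"
    and pts: "\<And>t. t \<in> points T \<Longrightarrow> \<phi> t \<in> (\<Union>(D, A)\<in>\<F>. D)"
    and op: "\<And>D A. (D, A) \<in> \<F> \<Longrightarrow> openin (Top T) {t \<in> points T. \<phi> t \<in> D}"
    and reg: "\<And>D A a. (D, A) \<in> \<F> \<Longrightarrow> a \<in> A \<Longrightarrow> (\<lambda>t. a (\<phi> t)) \<in> Reg T {t \<in> points T. \<phi> t \<in> D}"
  shows "morphism T (local_space \<F>) \<phi>"
proof -
  have basic_open: "openin (Top T) {t \<in> points T. \<phi> t \<in> V}" if V: "basic V" for V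
  proof -
    from V obtain D A a where V: "(D, A) \<in> \<F>" "a \<in> A" "V = {p\<in>D. a p \<noteq> 0}" by (rule basicE)
    have "{t \<in> points T. \<phi> t \<in> V} = {t \<in> {t \<in> points T. \<phi> t \<in> D}. a (\<phi> t) \<noteq> 0}" using V by auto
    then show ?thesis using ringed_open_nonzero[OF T op[OF V(1)] reg[OF V(1,2)]] by simp
  qed
  have cont: "openin (Top T) {t \<in> points T. \<phi> t \<in> U}" if U: "openin (Top (local_space \<F>)) U" for U
  proof (subst openin_subopen, intro ballI)
    fix t assume "t \<in> {t \<in> points T. \<phi> t \<in> U}"
    then obtain V where V: "basic V" "\<phi> t \<in> V" "V \<subseteq> U" "t \<in> points T"
      using U unfolding openin_local_space by blast
    with basic_open[OF V(1)] show "\<exists>S. openin (Top T) S \<and> t \<in> S \<and> S \<subseteq> {t \<in> points T. \<phi> t \<in> U}"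
      by (intro exI[of _ "{t \<in> points T. \<phi> t \<in> V}"]) auto
  qed
  show ?thesis
    unfolding morphism_def
  proof (intro conjI allI impI)
    show "continuous_map (Top T) (Top (local_space \<F>)) \<phi>"
      unfolding continuous_map_def using cont pts points_local_space by auto
  next
    fix U f assume U: "openin (Top (local_space \<F>)) U" and f: "f \<in> Reg (local_space \<F>) U"
    show "f \<circ> \<phi> \<in> Reg T {t \<in> points T. \<phi> t \<in> U}"
    proof (rule ringed_local[OF T])
      fix t assume "t \<in> {t \<in> points T. \<phi> t \<in> U}"
      then have t: "t \<in> points T" "\<phi> t \<in> U" by auto
      from f t(2) obtain D A a b where 1: "(D, A) \<in> \<F>" "\<phi> t \<in> D" "algebra_on D A" "a \<in> A" "b \<in> A" "b (\<phi> t) \<noteq> 0"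
        "\<And>q. q \<in> U \<Longrightarrow> q \<in> D \<Longrightarrow> b q \<noteq> 0 \<Longrightarrow> f q = a q / b q"
        by (rule Reg_local_spaceE) blast
      define W where "W = {t \<in> {t \<in> points T. \<phi> t \<in> D}. b (\<phi> t) \<noteq> 0}"
      have W: "openin (Top T) W" unfolding W_def by (rule ringed_open_nonzero[OF T op[OF 1(1)] reg[OF 1(1,5)]])
      have frac: "(\<lambda>t. a (\<phi> t) / b (\<phi> t)) \<in> Reg T W"
        unfolding W_def by (rule ringed_quotient[OF T op[OF 1(1)] reg[OF 1(1,4)] reg[OF 1(1,5)]])
      let ?W = "W \<inter> {t \<in> points T. \<phi> t \<in> U}"
      have oW: "openin (Top T) ?W" using W cont[OF U] by (rule openin_Int)
      have "(\<lambda>t. a (\<phi> t) / b (\<phi> t)) \<in> Reg T ?W" by (rule ringed_restrict[OF T W oW _ frac]) auto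
      then have "f \<circ> \<phi> \<in> Reg T ?W"
        by (rule ringed_cong[OF T oW]) (auto simp: W_def 1(7))
      then show "\<exists>V. openin (Top T) V \<and> t \<in> V \<and> V \<subseteq> {t \<in> points T. \<phi> t \<in> U} \<and> f \<circ> \<phi> \<in> Reg T V"
        using oW t 1 by (intro exI[of _ ?W]) (auto simp: W_def)
    qed
  qed
qed

end

text \<open>Equality of the records would be too strong: \<open>Reg\<close> takes meaningless values
  on sets that are not open, and there \<open>fun_space\<close> and its presentation as a
  \<open>local_space\<close> can differ.\<close>

definition same_space :: "'a fspace \<Rightarrow> 'a fspace \<Rightarrow> bool" where
  "same_space X Y \<longleftrightarrow> Top X = Top Y \<and> (\<forall>U. openin (Top X) U \<longrightarrow> Reg X U = Reg Y U)"

lemma same_space_is_sheaf: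
  assumes "same_space X Y" "is_sheaf X"
  shows "is_sheaf Y"
  unfolding is_sheaf_def
proof (intro conjI allI impI)
  fix \<W> assume "\<forall>W\<in>\<W>. openin (Top Y) W"
  then have op: "\<forall>W\<in>\<W>. openin (Top X) W" using assms(1) by (simp add: same_space_def)
  then have "Reg X (\<Union>\<W>) = (\<Inter>W\<in>\<W>. Reg X W)" using assms(2) by (simp add: is_sheaf_def)
  moreover have "Reg X (\<Union>\<W>) = Reg Y (\<Union>\<W>)" using assms(1) op by (simp add: same_space_def openin_Union)
  moreover have "(\<Inter>W\<in>\<W>. Reg X W) = (\<Inter>W\<in>\<W>. Reg Y W)"
    using assms(1) op by (auto simp: same_space_def)
  ultimately show "Reg Y (\<Union>\<W>) = (\<Inter>W\<in>\<W>. Reg Y W)" by simp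
next
  fix U and f g :: "'a \<Rightarrow> complex"
  assume U: "openin (Top Y) U" and f: "\<forall>x\<in>U. f x = g x" "f \<in> Reg Y U"
  have U': "openin (Top X) U" "Reg Y U = Reg X U" using assms(1) U by (auto simp: same_space_def)
  have "\<forall>U f g. openin (Top X) U \<longrightarrow> (\<forall>x\<in>U. f x = g x) \<longrightarrow> f \<in> Reg X U \<longrightarrow> g \<in> Reg X U"
    using assms(2) unfolding is_sheaf_def by - (elim conjE, assumption)
  from this[rule_format, OF U'(1), of f g] show "g \<in> Reg Y U" using f U'(2) by simp
qed

lemma same_space_ringed:
  assumes "same_space X Y" "ringed X"
  shows "ringed Y"
  unfolding ringed_def
proof (intro conjI allI impI ballI)
  show "is_sheaf Y" using same_space_is_sheaf[OF assms(1)] assms(2) by (simp add: ringed_def)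
next
  fix U assume U: "openin (Top Y) U"
  then have U': "openin (Top X) U" and R: "Reg Y U = Reg X U" using assms(1) by (auto simp: same_space_def)
  show "(\<lambda>_. c) \<in> Reg Y U" for c using ringed_const[OF assms(2) U'] R by simp
  show "(\<lambda>x. f x + g x) \<in> Reg Y U" if "f \<in> Reg Y U" "g \<in> Reg Y U" for f g
    using that R ringed_add[OF assms(2) U'] by simp
  show "(\<lambda>x. f x * g x) \<in> Reg Y U" if "f \<in> Reg Y U" "g \<in> Reg Y U" for f g
    using that R ringed_mult[OF assms(2) U'] by simp
  fix f assume "f \<in> Reg Y U"
  then have f: "f \<in> Reg X U" using R by simp
  have V: "openin (Top X) {x \<in> U. f x \<noteq> 0}" by (rule ringed_open_nonzero[OF assms(2) U' f])
  then show "openin (Top Y) {x \<in> U. f x \<noteq> 0}" using assms(1) by (simp add: same_space_def)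
  show "(\<lambda>x. 1 / f x) \<in> Reg Y {x \<in> U. f x \<noteq> 0}"
    using ringed_inverse[OF assms(2) U' f] V assms(1) by (simp add: same_space_def)
qed

lemma same_space_morphism:
  assumes "same_space Y Y'" "morphism X Y \<phi>"
  shows "morphism X Y' \<phi>"
proof -
  have T: "Top Y' = Top Y" and R: "\<And>U. openin (Top Y) U \<Longrightarrow> Reg Y' U = Reg Y U"
    using assms(1) by (auto simp: same_space_def)
  show ?thesis using assms(2) unfolding morphism_def T using R by simp
qed

lemma same_space_morphism_dom:
  assumes "same_space X X'" "morphism X Y \<phi>"
  shows "morphism X' Y \<phi>"
proof -
  have T: "Top X' = Top X" and R: "\<And>U. openin (Top X) U \<Longrightarrow> Reg X' U = Reg X U"
    using assms(1) by (auto simp: same_space_def)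
  have "openin (Top X) {x \<in> points X. \<phi> x \<in> U}" if "openin (Top Y) U" for U
    using morphism_open[OF assms(2) that] .
  then show ?thesis using assms(2) R by (simp add: morphism_def T)
qed

lemma same_space_isomorphism:
  assumes "same_space X X'" "isomorphism X Y \<phi>"
  shows "isomorphism X' Y \<phi>"
proof -
  have "Top X' = Top X" using assms(1) by (simp add: same_space_def)
  then show ?thesis
    using assms same_space_morphism same_space_morphism_dom unfolding isomorphism_def by metis
qed

lemma same_spaceI:
  assumes X: "ringed X" and Y: "ringed Y" and pts: "points X = points Y"
    and 1: "morphism X Y (\<lambda>x. x)" and 2: "morphism Y X (\<lambda>x. x)"
  shows "same_space X Y"
proof -
  have pre: "{x \<in> points Z. x \<in> U} = U" if "openin (Top Z) U" for Z :: "'a fspace" and U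
    using openin_subset[OF that] by auto
  have op: "openin (Top X) U \<longleftrightarrow> openin (Top Y) U" for U
    using morphism_open[OF 1, of U] morphism_open[OF 2, of U] pre pts by metis
  have "Reg Y U \<subseteq> Reg X U" if "openin (Top Y) U" for U
    using morphism_Reg[OF 1 that] pre[OF that] pts by auto
  moreover have "Reg X U \<subseteq> Reg Y U" if "openin (Top X) U" for U
    using morphism_Reg[OF 2 that] pre[OF that] pts by auto
  ultimately show ?thesis
    using op unfolding same_space_def by (metis subset_antisym topology_eq)
qed

lemma same_space_orbit_space:
  assumes "same_space X Y"
  shows "same_space (orbit_space G act X) (orbit_space G act Y)"
proof -
  have T: "Top Y = Top X" and R: "\<And>U. openin (Top X) U \<Longrightarrow> Reg Y U = Reg X U"
    using assms by (auto simp: same_space_def)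
  have "Top (orbit_space G act X) = Top (orbit_space G act Y)"
    by (simp add: orbit_space_def T)
  moreover have "Reg (orbit_space G act X) U = Reg (orbit_space G act Y) U"
    if "openin (Top (orbit_space G act X)) U" for U
    using that R unfolding openin_orbit_space by (simp add: orbit_space_def T)
  ultimately show ?thesis unfolding same_space_def by blast
qed

subsection \<open>Zero loci, products and orbit spaces\<close>

lemma charts_fun_space: "algebra_on X A \<Longrightarrow> charts {(X, A)}"
  by unfold_locales auto

lemma points_fun_space:
  assumes "algebra_on X A"
  shows "points (fun_space X A) = X"
proof -
  interpret charts "{(X, A)}" by (rule charts_fun_space[OF assms])
  show ?thesis using points_local_space by (simp add: fun_space_def local_space_def)
qed

lemma same_space_fun_space:
  assumes "algebra_on X A"
  shows "same_space (local_space {(X, A)}) (fun_space X A)"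
proof -
  interpret charts "{(X, A)}" by (rule charts_fun_space[OF assms])
  have T: "Top (local_space {(X, A)}) = Top (fun_space X A)"
    by (simp add: fun_space_def local_space_def)
  moreover have "Reg (local_space {(X, A)}) U = Reg (fun_space X A) U"
    if "openin (Top (local_space {(X, A)})) U" for U
  proof -
    have "U \<subseteq> X" using openin_subset[OF that] points_local_space by simp
    then have "U \<inter> X = U" "\<And>p. p \<in> U \<Longrightarrow> p \<in> X" by auto
    then show ?thesis by (simp add: fun_space_def local_space_def)
  qed
  ultimately show ?thesis by (simp add: same_space_def)
qed

lemma ringed_fun_space: "algebra_on X A \<Longrightarrow> ringed (fun_space X A)"
  using same_space_ringed[OF same_space_fun_space] charts.ringed_local_space[OF charts_fun_space] by blast

lemma morphism_fun_spaceI: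
  assumes A: "algebra_on X A" and T: "ringed T"
    and pts: "\<And>t. t \<in> points T \<Longrightarrow> \<phi> t \<in> X"
    and reg: "\<And>a. a \<in> A \<Longrightarrow> (\<lambda>t. a (\<phi> t)) \<in> Reg T (points T)"
  shows "morphism T (fun_space X A) \<phi>"
proof (rule same_space_morphism[OF same_space_fun_space[OF A]])
  have *: "{t \<in> points T. \<phi> t \<in> X} = points T" using pts by auto
  show "morphism T (local_space {(X, A)}) \<phi>"
    by (rule charts.morphism_local_spaceI[OF charts_fun_space[OF A] T]) (use pts reg * in auto)
qed

lemma Reg_fun_spaceI: "algebra_on X A \<Longrightarrow> a \<in> A \<Longrightarrow> a \<in> Reg (fun_space X A) X"
proof -
  assume A: "algebra_on X A" and a: "a \<in> A"
  obtain e where e: "e \<in> A" "\<And>x. x \<in> X \<Longrightarrow> e x = 1" using A by (rule algebra_onE_const) blast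
  show ?thesis unfolding fun_space_def by (simp, intro ballI bexI[OF _ a] bexI[OF _ e(1)]) (simp add: e(2))
qed

lemma algebra_on_polynomials: "algebra_on Z polynomials"
  by (simp add: polynomials_def algebra_on_alg_gen)

lemma points_subvariety [simp]: "points (subvariety Z) = Z"
  by (simp add: subvariety_def points_fun_space algebra_on_polynomials)

lemma ringed_subvariety: "ringed (subvariety Z)"
  by (simp add: subvariety_def ringed_fun_space algebra_on_polynomials)

lemma Reg_subvarietyI: "p \<in> polynomials \<Longrightarrow> p \<in> Reg (subvariety Z) Z"
  by (simp add: subvariety_def Reg_fun_spaceI algebra_on_polynomials)

lemma morphism_subvarietyI:
  fixes \<phi> :: "'t \<Rightarrow> 'a::affine_space"
  assumes T: "ringed T" and pts: "\<And>t. t \<in> points T \<Longrightarrow> \<phi> t \<in> Z"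
    and reg: "\<And>k. k \<in> coords \<Longrightarrow> (\<lambda>t. k (\<phi> t)) \<in> Reg T (points T)"
  shows "morphism T (subvariety Z) \<phi>"
  unfolding subvariety_def
  by (rule morphism_fun_spaceI[OF algebra_on_polynomials T pts])
     (auto simp: polynomials_def intro: ringed_alg_gen[OF T] reg)

lemma morphism_polynomial_map:
  assumes "polynomial_map \<phi>" "\<And>x. x \<in> Z \<Longrightarrow> \<phi> x \<in> W"
  shows "morphism (subvariety Z) (subvariety W) \<phi>"
  by (rule morphism_subvarietyI[OF ringed_subvariety])
     (use assms in \<open>auto simp: polynomial_map_def intro: Reg_subvarietyI\<close>)

definition product_charts :: "'a fspace \<Rightarrow> 'b fspace \<Rightarrow> (('a \<times> 'b) set \<times> ('a \<times> 'b \<Rightarrow> complex) set) set" where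
  "product_charts X Y = {(U \<times> V, tensor_alg X Y U V) | U V. openin (Top X) U \<and> openin (Top Y) V}"

lemma prod_space_eq: "prod_space X Y = local_space (product_charts X Y)"
proof -
  have "{{p \<in> U \<times> V. a p \<noteq> 0} | U V a. openin (Top X) U \<and> openin (Top Y) V \<and> a \<in> tensor_alg X Y U V}
      = {{p \<in> D. a p \<noteq> 0} | D a. \<exists>A. (D, A) \<in> product_charts X Y \<and> a \<in> A}"
    unfolding product_charts_def by blast
  moreover have "(\<exists>U V. openin (Top X) U \<and> openin (Top Y) V \<and> p \<in> U \<times> V \<and>
                (\<exists>a\<in>tensor_alg X Y U V. \<exists>b\<in>tensor_alg X Y U V. b p \<noteq> 0 \<and>
                   (\<forall>q \<in> W \<inter> U \<times> V. b q \<noteq> 0 \<longrightarrow> h q = a q / b q)))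
      \<longleftrightarrow> (\<exists>D A. (D, A) \<in> product_charts X Y \<and> p \<in> D \<and> (\<exists>a\<in>A. \<exists>b\<in>A. b p \<noteq> 0 \<and>
              (\<forall>q \<in> W \<inter> D. b q \<noteq> 0 \<longrightarrow> h q = a q / b q)))" (is "?L \<longleftrightarrow> ?R") for W h p
  proof
    assume ?L
    then obtain U V where "openin (Top X) U" "openin (Top Y) V" and *: "p \<in> U \<times> V"
                "\<exists>a\<in>tensor_alg X Y U V. \<exists>b\<in>tensor_alg X Y U V. b p \<noteq> 0 \<and>
                   (\<forall>q \<in> W \<inter> U \<times> V. b q \<noteq> 0 \<longrightarrow> h q = a q / b q)" by (elim exE conjE)
    then have "(U \<times> V, tensor_alg X Y U V) \<in> product_charts X Y" unfolding product_charts_def by blast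
    with * show ?R by (intro exI conjI)
  next
    assume ?R
    then obtain D A where "(D, A) \<in> product_charts X Y" and *: "p \<in> D" "\<exists>a\<in>A. \<exists>b\<in>A. b p \<noteq> 0 \<and>
              (\<forall>q \<in> W \<inter> D. b q \<noteq> 0 \<longrightarrow> h q = a q / b q)" by (elim exE conjE)
    then obtain U V where UV: "openin (Top X) U" "openin (Top Y) V"
        and eq: "D = U \<times> V" "A = tensor_alg X Y U V" unfolding product_charts_def by blast
    show ?L using UV * unfolding eq by (intro exI conjI)
  qed
  ultimately show ?thesis unfolding prod_space_def local_space_def by simp
qed

lemma tensor_alg_mono:
  assumes X: "ringed X" and Y: "ringed Y"
    and op: "openin (Top X) U" "openin (Top Y) V" "openin (Top X) U'" "openin (Top Y) V'"
    and sub: "U' \<subseteq> U" "V' \<subseteq> V"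
  shows "tensor_alg X Y U V \<subseteq> tensor_alg X Y U' V'"
proof
  fix a assume "a \<in> tensor_alg X Y U V"
  moreover have "(\<lambda>f. f \<circ> fst) ` Reg X U \<union> (\<lambda>g. g \<circ> snd) ` Reg Y V
      \<subseteq> (\<lambda>f. f \<circ> fst) ` Reg X U' \<union> (\<lambda>g. g \<circ> snd) ` Reg Y V'"
    using ringed_restrict[OF X op(1,3) sub(1)] ringed_restrict[OF Y op(2,4) sub(2)] by blast
  ultimately show "a \<in> tensor_alg X Y U' V'"
    unfolding tensor_alg_def by (rule alg_gen_mono)
qed

lemma charts_product:
  assumes X: "ringed X" and Y: "ringed Y"
  shows "charts (product_charts X Y)"
proof
  fix D A assume "(D, A) \<in> product_charts X Y"
  then show "algebra_on D A" by (auto simp: product_charts_def tensor_alg_def algebra_on_alg_gen)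
  fix D' A' assume "(D', A') \<in> product_charts X Y"
  with \<open>(D, A) \<in> product_charts X Y\<close> obtain U V U' V' where
    op: "openin (Top X) U" "openin (Top Y) V" "openin (Top X) U'" "openin (Top Y) V'"
    and eq: "D = U \<times> V" "A = tensor_alg X Y U V" "D' = U' \<times> V'" "A' = tensor_alg X Y U' V'"
    unfolding product_charts_def by blast
  have "tensor_alg X Y U V \<subseteq> tensor_alg X Y (U \<inter> U') (V \<inter> V')"
    "tensor_alg X Y U' V' \<subseteq> tensor_alg X Y (U \<inter> U') (V \<inter> V')"
    using tensor_alg_mono[OF X Y op(1,2), of "U \<inter> U'" "V \<inter> V'"]
      tensor_alg_mono[OF X Y op(3,4), of "U \<inter> U'" "V \<inter> V'"] op by (auto simp: openin_Int)
  moreover have "(D \<inter> D', tensor_alg X Y (U \<inter> U') (V \<inter> V')) \<in> product_charts X Y"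
    using op unfolding product_charts_def eq Times_Int_Times by blast
  ultimately show "\<exists>A''. (D \<inter> D', A'') \<in> product_charts X Y \<and> A \<union> A' \<subseteq> A''"
    unfolding eq by blast
qed

lemma ringed_prod_space: "ringed X \<Longrightarrow> ringed Y \<Longrightarrow> ringed (prod_space X Y)"
  using charts.ringed_local_space[OF charts_product] by (simp add: prod_space_eq)

lemma points_prod_space:
  assumes "ringed X" "ringed Y"
  shows "points (prod_space X Y) = points X \<times> points Y"
proof -
  have "(points X \<times> points Y, tensor_alg X Y (points X) (points Y)) \<in> product_charts X Y"
    unfolding product_charts_def by blast
  moreover have "D \<subseteq> points X \<times> points Y" if DA: "(D, A) \<in> product_charts X Y" for D A
  proof -
    from DA obtain U V where "openin (Top X) U" "openin (Top Y) V" "D = U \<times> V"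
      unfolding product_charts_def by blast
    then show ?thesis using openin_subset[of "Top X" U] openin_subset[of "Top Y" V] by blast
  qed
  ultimately show ?thesis
    unfolding prod_space_eq charts.points_local_space[OF charts_product[OF assms]] by blast
qed

text \<open>The universal property of the product: a chart function is a polynomial in functions
  lifted from the factors, so its composite is regular once both components are morphisms.\<close>

lemma morphism_into_prod_space:
  assumes T: "ringed T" and X: "ringed X" and Y: "ringed Y"
    and \<phi>: "morphism T X \<phi>" and \<psi>: "morphism T Y \<psi>"
  shows "morphism T (prod_space X Y) (\<lambda>t. (\<phi> t, \<psi> t))"
proof -
  have pts: "(\<phi> t, \<psi> t) \<in> points X \<times> points Y" if "t \<in> points T" for t
    using that morphism_points \<phi> \<psi> by (metis mem_Sigma_iff)
  have op: "openin (Top T) {t \<in> points T. (\<phi> t, \<psi> t) \<in> U \<times> V}"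
    if "openin (Top X) U" "openin (Top Y) V" for U V
  proof -
    have "{t \<in> points T. (\<phi> t, \<psi> t) \<in> U \<times> V} = {t \<in> points T. \<phi> t \<in> U} \<inter> {t \<in> points T. \<psi> t \<in> V}" by auto
    then show ?thesis using openin_Int[OF morphism_open[OF \<phi> that(1)] morphism_open[OF \<psi> that(2)]] by simp
  qed
  show ?thesis
    unfolding prod_space_eq
  proof (rule charts.morphism_local_spaceI[OF charts_product[OF X Y] T])
    fix t assume "t \<in> points T"
    then show "(\<phi> t, \<psi> t) \<in> (\<Union>(D, A)\<in>product_charts X Y. D)"
      using pts points_prod_space[OF X Y]
      unfolding prod_space_eq charts.points_local_space[OF charts_product[OF X Y]] by blast
  next
    fix D A assume DA: "(D, A) \<in> product_charts X Y"
    then obtain U V where UV: "openin (Top X) U" "openin (Top Y) V" "D = U \<times> V" "A = tensor_alg X Y U V"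
      unfolding product_charts_def by blast
    show "openin (Top T) {t \<in> points T. (\<phi> t, \<psi> t) \<in> D}" using op UV by simp
    fix a assume "a \<in> A"
    then have a: "a \<in> alg_gen ((\<lambda>f. f \<circ> fst) ` Reg X U \<union> (\<lambda>g. g \<circ> snd) ` Reg Y V)"
      using UV by (simp add: tensor_alg_def)
    note W = op[OF UV(1,2)]
    have "(\<lambda>t. f (\<phi> t)) \<in> Reg T {t \<in> points T. (\<phi> t, \<psi> t) \<in> U \<times> V}" if "f \<in> Reg X U" for f
      by (rule ringed_restrict[OF T morphism_open[OF \<phi> UV(1)] W _ morphism_Reg[OF \<phi> UV(1) that]]) auto
    moreover have "(\<lambda>t. g (\<psi> t)) \<in> Reg T {t \<in> points T. (\<phi> t, \<psi> t) \<in> U \<times> V}" if "g \<in> Reg Y V" for g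
      by (rule ringed_restrict[OF T morphism_open[OF \<psi> UV(2)] W _ morphism_Reg[OF \<psi> UV(2) that]]) auto
    ultimately have "(\<lambda>t. a (\<phi> t, \<psi> t)) \<in> Reg T {t \<in> points T. (\<phi> t, \<psi> t) \<in> U \<times> V}"
      by (intro ringed_alg_gen[OF T a W]) auto
    then show "(\<lambda>t. a (\<phi> t, \<psi> t)) \<in> Reg T {t \<in> points T. (\<phi> t, \<psi> t) \<in> D}" using UV by simp
  qed
qed

lemma prod_space_projections:
  assumes X: "ringed X" and Y: "ringed Y"
  shows "f \<in> Reg X (points X) \<Longrightarrow> (\<lambda>p. f (fst p)) \<in> Reg (prod_space X Y) (points (prod_space X Y))"
    and "g \<in> Reg Y (points Y) \<Longrightarrow> (\<lambda>p. g (snd p)) \<in> Reg (prod_space X Y) (points (prod_space X Y))"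
proof -
  have chart: "(points X \<times> points Y, tensor_alg X Y (points X) (points Y)) \<in> product_charts X Y"
    unfolding product_charts_def by blast
  have *: "h \<in> Reg (prod_space X Y) (points (prod_space X Y))"
    if "h \<in> tensor_alg X Y (points X) (points Y)" for h
  proof -
    have "(\<lambda>_. 1) \<in> tensor_alg X Y (points X) (points Y)" by (simp add: tensor_alg_def alg_gen.const)
    then show ?thesis
      using that chart unfolding prod_space_eq charts.Reg_local_space[OF charts_product[OF X Y]]
        charts.points_local_space[OF charts_product[OF X Y]]
      using points_prod_space[OF X Y, unfolded prod_space_eq charts.points_local_space[OF charts_product[OF X Y]]]
      by (intro ballI exI[of _ "points X \<times> points Y"] exI[of _ "tensor_alg X Y (points X) (points Y)"] conjI
           bexI[of _ h] bexI[of _ "\<lambda>_. 1"]) auto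
  qed
  show "(\<lambda>p. f (fst p)) \<in> Reg (prod_space X Y) (points (prod_space X Y))" if "f \<in> Reg X (points X)"
    by (rule *) (use that in \<open>auto simp: tensor_alg_def comp_def intro!: alg_gen.gen\<close>)
  show "(\<lambda>p. g (snd p)) \<in> Reg (prod_space X Y) (points (prod_space X Y))" if "g \<in> Reg Y (points Y)"
    by (rule *) (use that in \<open>auto simp: tensor_alg_def comp_def intro!: alg_gen.gen\<close>)
qed

text \<open>A bridge between two descriptions: Mumford stability is defined through
  \<open>prod_space\<close>, whereas the slice argument runs on a closed subset of a single affine
  space. The identity is a morphism one way by the universal property, the other way by
  coordinates.\<close>

lemma same_space_prod_subvariety:
  "same_space (subvariety (Z \<times> W)) (prod_space (subvariety Z) (subvariety W))"
proof (rule same_spaceI)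
  note rs = ringed_subvariety ringed_subvariety
  show "ringed (subvariety (Z \<times> W))" by (rule ringed_subvariety)
  show "ringed (prod_space (subvariety Z) (subvariety W))" by (intro ringed_prod_space ringed_subvariety)
  show pts: "points (subvariety (Z \<times> W)) = points (prod_space (subvariety Z) (subvariety W))"
    by (simp add: points_prod_space ringed_subvariety)
  have "morphism (subvariety (Z \<times> W)) (prod_space (subvariety Z) (subvariety W)) (\<lambda>t. (fst t, snd t))"
    by (intro morphism_into_prod_space ringed_subvariety morphism_polynomial_map
          polynomial_map_fst polynomial_map_snd) auto
  then show "morphism (subvariety (Z \<times> W)) (prod_space (subvariety Z) (subvariety W)) (\<lambda>x. x)" by simp
  show "morphism (prod_space (subvariety Z) (subvariety W)) (subvariety (Z \<times> W)) (\<lambda>x. x)"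
  proof (rule morphism_subvarietyI)
    show "ringed (prod_space (subvariety Z) (subvariety W))" by (intro ringed_prod_space ringed_subvariety)
    show "t \<in> Z \<times> W" if "t \<in> points (prod_space (subvariety Z) (subvariety W))" for t
      using that pts by simp
    have f: "(\<lambda>p. f (fst p)) \<in> Reg (prod_space (subvariety Z) (subvariety W))
        (points (prod_space (subvariety Z) (subvariety W)))" if "f \<in> coords" for f
      by (rule prod_space_projections(1)[OF rs]) (simp add: that Reg_subvarietyI coords_polynomials)
    have g: "(\<lambda>p. g (snd p)) \<in> Reg (prod_space (subvariety Z) (subvariety W))
        (points (prod_space (subvariety Z) (subvariety W)))" if "g \<in> coords" for g
      by (rule prod_space_projections(2)[OF rs]) (simp add: that Reg_subvarietyI coords_polynomials)
    fix k :: "'a \<times> 'b \<Rightarrow> complex" assume "k \<in> coords"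
    then consider f where "f \<in> coords" "k = (\<lambda>p. f (fst p))" | g where "g \<in> coords" "k = (\<lambda>p. g (snd p))"
      by (auto simp: coords_prod_def comp_def)
    then show "k \<in> Reg (prod_space (subvariety Z) (subvariety W)) (points (prod_space (subvariety Z) (subvariety W)))"
      using f g by cases simp_all
  qed
qed

lemma points_orbit_space: "points (orbit_space G act X) = orb G act ` points X"
proof
  show "points (orbit_space G act X) \<subseteq> orb G act ` points X"
    using openin_topspace[of "Top (orbit_space G act X)"] unfolding openin_orbit_space by simp
  have "{x \<in> points X. orb G act x \<in> orb G act ` points X} = points X" by auto
  then have "openin (Top (orbit_space G act X)) (orb G act ` points X)"
    unfolding openin_orbit_space by simp
  then show "orb G act ` points X \<subseteq> points (orbit_space G act X)" by (rule openin_subset)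
qed

lemma Reg_orbit_space:
  "f \<in> Reg (orbit_space G act X) U \<longleftrightarrow> (\<lambda>x. f (orb G act x)) \<in> Reg X {x \<in> points X. orb G act x \<in> U}"
  by (simp add: orbit_space_def comp_def)

lemma morphism_orbit_space: "morphism X (orbit_space G act X) (orb G act)"
  unfolding morphism_def continuous_map_def
  by (auto simp: points_orbit_space openin_orbit_space Reg_orbit_space comp_def)

lemma ringed_orbit_space:
  fixes X :: "'a fspace"
  assumes X: "ringed X"
  shows "ringed (orbit_space G act X)"
  unfolding ringed_def
proof (intro conjI allI impI ballI)
  let ?Q = "orbit_space G act X" and ?pre = "\<lambda>U. {x \<in> points X. orb G act x \<in> U}"
  have op: "openin (Top X) (?pre U)" if "openin (Top ?Q) U" for U
    using that by (simp add: openin_orbit_space)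
  show "is_sheaf ?Q"
    unfolding is_sheaf_def
  proof (intro conjI allI impI)
    fix \<W> assume \<W>: "\<forall>W\<in>\<W>. openin (Top ?Q) W"
    have "?pre (\<Union>\<W>) = \<Union>(?pre ` \<W>)" by blast
    moreover have "Reg X (\<Union>(?pre ` \<W>)) = (\<Inter>W\<in>?pre ` \<W>. Reg X W)"
      by (rule ringed_Union[OF X]) (use \<W> op in blast)
    ultimately show "Reg ?Q (\<Union>\<W>) = (\<Inter>W\<in>\<W>. Reg ?Q W)"
      by (auto simp: Reg_orbit_space)
  next
    fix U and f g :: "'a set \<Rightarrow> complex"
    assume U: "openin (Top ?Q) U" and fg: "\<forall>x\<in>U. f x = g x" and f: "f \<in> Reg ?Q U"
    show "g \<in> Reg ?Q U"
      unfolding Reg_orbit_space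
      by (rule ringed_cong[OF X op[OF U] f[unfolded Reg_orbit_space]]) (use fg in auto)
  qed
  fix U assume U: "openin (Top ?Q) U"
  show "(\<lambda>_. c) \<in> Reg ?Q U" for c
    unfolding Reg_orbit_space by (rule ringed_const[OF X op[OF U]])
  show "(\<lambda>x. f x + g x) \<in> Reg ?Q U" if "f \<in> Reg ?Q U" "g \<in> Reg ?Q U" for f g
    using that unfolding Reg_orbit_space by (rule ringed_add[OF X op[OF U]])
  show "(\<lambda>x. f x * g x) \<in> Reg ?Q U" if "f \<in> Reg ?Q U" "g \<in> Reg ?Q U" for f g
    using that unfolding Reg_orbit_space by (rule ringed_mult[OF X op[OF U]])
  fix f assume f: "f \<in> Reg ?Q U"
  have eq: "{x \<in> ?pre U. f (orb G act x) \<noteq> 0} = ?pre {x \<in> U. f x \<noteq> 0}" by auto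
  show "openin (Top ?Q) {x \<in> U. f x \<noteq> 0}"
    using ringed_open_nonzero[OF X op[OF U] f[unfolded Reg_orbit_space]] U
    unfolding openin_orbit_space eq by auto
  show "(\<lambda>x. 1 / f x) \<in> Reg ?Q {x \<in> U. f x \<noteq> 0}"
    using ringed_inverse[OF X op[OF U] f[unfolded Reg_orbit_space]]
    unfolding Reg_orbit_space eq .
qed

text \<open>The orbit space carries exactly the open sets and functions that become open or regular
  after pullback to X, so a morphism that factors through the orbits descends.\<close>

lemma morphism_descend:
  assumes X: "ringed X" and \<phi>: "morphism X T \<phi>"
    and eq: "\<And>x. x \<in> points X \<Longrightarrow> \<psi> (orb G act x) = \<phi> x"
  shows "morphism (orbit_space G act X) T \<psi>"
proof -
  have pre: "{x \<in> points X. orb G act x \<in> {q \<in> points (orbit_space G act X). \<psi> q \<in> U}} =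
      {x \<in> points X. \<phi> x \<in> U}" for U
    using eq by (auto simp: points_orbit_space)
  show ?thesis
    unfolding morphism_def continuous_map_def
  proof (intro conjI allI impI)
    show "\<psi> \<in> points (orbit_space G act X) \<rightarrow> points T"
      using eq morphism_points[OF \<phi>] by (auto simp: points_orbit_space)
  next
    fix U assume U: "openin (Top T) U"
    show "openin (Top (orbit_space G act X)) {x \<in> points (orbit_space G act X). \<psi> x \<in> U}"
      unfolding openin_orbit_space pre using morphism_open[OF \<phi> U] by (auto simp: points_orbit_space)
    fix f assume f: "f \<in> Reg T U"
    show "f \<circ> \<psi> \<in> Reg (orbit_space G act X) {x \<in> points (orbit_space G act X). \<psi> x \<in> U}"
      unfolding Reg_orbit_space pre
      by (rule ringed_cong[OF X morphism_open[OF \<phi> U] morphism_Reg[OF \<phi> U f]]) (simp add: eq)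
  qed
qed

subsection \<open>Affine varieties\<close>

definition zariski_closed :: "'a::affine_space set \<Rightarrow> bool" where
  "zariski_closed Z \<longleftrightarrow> (\<exists>P\<subseteq>polynomials. Z = {x. \<forall>p\<in>P. p x = 0})"

lemma algebra_on_apoly: "algebra_on Z (apoly N)"
  by (simp add: apoly_def algebra_on_alg_gen)

text \<open>\<open>affine_variety\<close> and \<open>smooth_variety\<close> speak of
  \<open>aspace N\<close>, whose points are sequences padded with zeros. The maps \<iota> and
  \<kappa> pass between a type with coordinates and this model; \<kappa> accepts any sequence and
  ignores the entries from N on, hence the proviso in its second inverse law.\<close>

locale coord_enumeration =
  fixes N :: nat and \<iota> :: "'a::affine_space \<Rightarrow> nat \<Rightarrow> complex" and \<kappa> :: "(nat \<Rightarrow> complex) \<Rightarrow> 'a"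
  assumes \<kappa>_\<iota>: "\<kappa> (\<iota> x) = x"
    and \<iota>_aspace: "\<iota> x \<in> aspace N"
    and \<iota>_\<kappa>: "z \<in> aspace N \<Longrightarrow> \<iota> (\<kappa> z) = z"
    and polynomial_\<kappa>: "p \<in> polynomials \<Longrightarrow> (\<lambda>z. p (\<kappa> z)) \<in> apoly N"
    and \<iota>_polynomial: "i < N \<Longrightarrow> (\<lambda>x. \<iota> x i) \<in> polynomials"

lemma coord_enumeration_exists:
  obtains N and \<iota> :: "'a::affine_space \<Rightarrow> nat \<Rightarrow> complex" and \<kappa> where "coord_enumeration N \<iota> \<kappa>"
proof -
  define N where "N = card (coords :: ('a \<Rightarrow> complex) set)"
  obtain e :: "nat \<Rightarrow> 'a \<Rightarrow> complex" where e: "bij_betw e {..<N} coords"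
    using ex_bij_betw_nat_finite[OF finite_coords] unfolding N_def atLeast0LessThan by blast
  then have img: "e ` {..<N} = coords" and inj: "inj_on e {..<N}" by (auto simp: bij_betw_def)
  define \<iota> where "\<iota> x = (\<lambda>i. if i < N then e i x else 0)" for x
  define \<kappa> where "\<kappa> z = (THE x. \<forall>i<N. e i x = z i)" for z
  have ex1: "\<exists>!x. \<forall>i<N. e i x = z i" for z
  proof -
    have "(\<forall>k\<in>coords. k x = z (the_inv_into {..<N} e k)) \<longleftrightarrow> (\<forall>i<N. e i x = z i)" for x
      unfolding img[symmetric] by (auto simp: the_inv_into_f_f[OF inj])
    then show ?thesis using ex1_coords[of "\<lambda>k. z (the_inv_into {..<N} e k)"] by simp
  qed
  have \<kappa>: "e i (\<kappa> z) = z i" if "i < N" for i z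
    using theI'[OF ex1[of z]] that unfolding \<kappa>_def by blast
  have 1: "\<kappa> (\<iota> x) = x" for x
    unfolding \<kappa>_def by (rule the1_equality[OF ex1]) (simp add: \<iota>_def)
  have 2: "\<iota> x \<in> aspace N" for x by (simp add: \<iota>_def aspace_def)
  have 3: "\<iota> (\<kappa> z) = z" if "z \<in> aspace N" for z
    using that \<kappa> by (auto simp: \<iota>_def aspace_def fun_eq_iff)
  have 4: "(\<lambda>z. p (\<kappa> z)) \<in> apoly N" if "p \<in> polynomials" for p
    unfolding apoly_def
  proof (rule alg_gen_compose[OF that[unfolded polynomials_def]])
    fix k :: "'a \<Rightarrow> complex" assume "k \<in> coords"
    then obtain i where "i < N" "k = e i" using img by blast
    then show "(\<lambda>z. k (\<kappa> z)) \<in> alg_gen {\<lambda>x. x i | i. i < N}" using \<kappa> by (auto intro!: alg_gen.gen)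
  qed
  have 5: "(\<lambda>x. \<iota> x i) \<in> polynomials" if "i < N" for i
    using that img by (auto simp: \<iota>_def intro!: coords_polynomials)
  show ?thesis by (rule that[of N \<iota> \<kappa>], unfold_locales) (fact 1 2 3 4 5)+
qed

context coord_enumeration
begin

lemma apoly_\<iota>: "p \<in> apoly N \<Longrightarrow> (\<lambda>x. p (\<iota> x)) \<in> polynomials"
  unfolding polynomials_def apoly_def
  by (erule alg_gen_compose) (use \<iota>_polynomial in \<open>auto simp: polynomials_def\<close>)

lemma isomorphism_enumeration:
  assumes P: "P \<subseteq> polynomials"
  shows "isomorphism (subvariety {x. \<forall>p\<in>P. p x = 0})
    (fun_space (azeros N ((\<lambda>p z. p (\<kappa> z)) ` P)) (apoly N)) \<iota>"
proof (rule isomorphismI)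
  let ?S = "{x. \<forall>p\<in>P. p x = 0}" and ?Z = "azeros N ((\<lambda>p z. p (\<kappa> z)) ` P)"
  have \<iota>S: "\<iota> x \<in> ?Z" if "x \<in> ?S" for x using that by (simp add: azeros_def \<kappa>_\<iota> \<iota>_aspace)
  have \<kappa>S: "\<kappa> z \<in> ?S" if "z \<in> ?Z" for z using that by (simp add: azeros_def)
  show "morphism (subvariety ?S) (fun_space ?Z (apoly N)) \<iota>"
    by (rule morphism_fun_spaceI[OF algebra_on_apoly ringed_subvariety])
       (use \<iota>S apoly_\<iota> in \<open>auto intro: Reg_subvarietyI\<close>)
  show "morphism (fun_space ?Z (apoly N)) (subvariety ?S) \<kappa>"
    by (rule morphism_subvarietyI[OF ringed_fun_space[OF algebra_on_apoly]])
       (use \<kappa>S polynomial_\<kappa> in \<open>auto simp: points_fun_space[OF algebra_on_apoly]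
          intro!: Reg_fun_spaceI algebra_on_apoly coords_polynomials\<close>)
  show "\<kappa> (\<iota> x) = x" for x by (rule \<kappa>_\<iota>)
  show "\<iota> (\<kappa> z) = z" if "z \<in> points (fun_space ?Z (apoly N))" for z
    using that \<iota>_\<kappa> by (simp add: points_fun_space[OF algebra_on_apoly] azeros_def)
qed

end

lemma affine_variety_isomorphic:
  fixes Z :: "'a::affine_space set"
  assumes "ringed X" "zariski_closed Z" "isomorphism X (subvariety Z) \<phi>"
  shows "affine_variety X"
proof -
  obtain P where P: "P \<subseteq> polynomials" "Z = {x. \<forall>p\<in>P. p x = 0}"
    using assms(2) by (auto simp: zariski_closed_def)
  obtain N and \<iota> :: "'a \<Rightarrow> nat \<Rightarrow> complex" and \<kappa> where "coord_enumeration N \<iota> \<kappa>"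
    by (rule coord_enumeration_exists)
  then interpret coord_enumeration N \<iota> \<kappa> .
  have "isomorphism X (fun_space (azeros N ((\<lambda>p z. p (\<kappa> z)) ` P)) (apoly N)) (\<lambda>x. \<iota> (\<phi> x))"
    by (rule isomorphism_compose[OF assms(3)[unfolded P(2)] isomorphism_enumeration[OF P(1)]])
  moreover have "(\<lambda>p z. p (\<kappa> z)) ` P \<subseteq> apoly N" using P(1) polynomial_\<kappa> by auto
  then have "azariski_closed N (azeros N ((\<lambda>p z. p (\<kappa> z)) ` P))"
    unfolding azariski_closed_def by blast
  moreover have "is_sheaf X" using assms(1) by (simp add: ringed_def)
  ultimately show ?thesis unfolding affine_variety_def by blast
qed

text \<open>The cover is X itself; separatedness is the point. The embedding \<theta> into
  \<open>aspace N\<close> is injective, so two morphisms into X agree exactly where the finitely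
  many regular functions \<theta>(\<phi> t) i - \<theta>(\<psi> t) i vanish.\<close>

lemma affine_variety_imp_variety:
  assumes X: "affine_variety X"
  shows "variety X"
  unfolding variety_def
proof (intro conjI)
  show sh: "is_sheaf X" using X by (simp add: affine_variety_def)
  show "\<exists>\<U>. finite \<U> \<and> \<Union>\<U> = points X \<and> (\<forall>U\<in>\<U>. openin (Top X) U \<and> affine_variety (open_sub X U))"
    by (rule exI[of _ "{points X}"]) (simp add: open_sub_points X)
  show "separated X"
    unfolding separated_def
  proof (intro allI impI)
    fix M :: nat and T \<phi> \<psi>
    let ?T = "fun_space T (apoly M)"
    assume T: "azariski_closed M T" and \<phi>: "morphism ?T X \<phi>" and \<psi>: "morphism ?T X \<psi>"
    obtain N Z \<theta> \<theta>' where Z: "azariski_closed N Z" and \<theta>: "morphism X (fun_space Z (apoly N)) \<theta>"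
        and inv: "\<And>x. x \<in> points X \<Longrightarrow> \<theta>' (\<theta> x) = x"
      using X unfolding affine_variety_def isomorphism_def by blast
    note rT = ringed_fun_space[OF algebra_on_apoly, of T M] and pT = points_fun_space[OF algebra_on_apoly, of T M]
    have open_i: "openin (Top ?T) {t \<in> T. \<theta> (\<phi> t) i \<noteq> \<theta> (\<psi> t) i}" if "i < N" for i
    proof -
      have "(\<lambda>z. z i) \<in> Reg (fun_space Z (apoly N)) Z"
        by (rule Reg_fun_spaceI[OF algebra_on_apoly]) (use that in \<open>auto simp: apoly_def intro!: alg_gen.gen\<close>)
      moreover have "openin (Top (fun_space Z (apoly N))) Z"
        using openin_topspace[of "Top (fun_space Z (apoly N))"] by (simp add: points_fun_space[OF algebra_on_apoly])
      moreover have "{t \<in> points ?T. \<theta> (\<gamma> t) \<in> Z} = T" if "morphism ?T X \<gamma>" for \<gamma>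
        using morphism_points[OF morphism_compose[OF that \<theta>]] by (auto simp: pT points_fun_space[OF algebra_on_apoly])
      ultimately have R: "(\<lambda>t. \<theta> (\<gamma> t) i) \<in> Reg ?T T" if "morphism ?T X \<gamma>" for \<gamma>
        using morphism_Reg[OF morphism_compose[OF that \<theta>], of Z "\<lambda>z. z i"] that by simp
      have oT: "openin (Top ?T) T" using openin_topspace[of "Top ?T"] pT by simp
      have "(\<lambda>t. \<theta> (\<phi> t) i + (-1) * \<theta> (\<psi> t) i) \<in> Reg ?T T"
        by (intro ringed_add[OF rT] ringed_mult[OF rT] ringed_const[OF rT] R \<phi> \<psi> oT)
      from ringed_open_nonzero[OF rT oT this] show ?thesis by simp
    qed
    have mem: "\<theta> (\<gamma> t) \<in> aspace N" if "morphism ?T X \<gamma>" "t \<in> T" for t \<gamma>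
      using morphism_points[OF morphism_compose[OF that(1) \<theta>], of t] that(2) Z
      by (auto simp: pT points_fun_space[OF algebra_on_apoly] azariski_closed_def azeros_def)
    have "\<phi> t = \<psi> t" if t: "t \<in> T" and eq: "\<forall>i<N. \<theta> (\<phi> t) i = \<theta> (\<psi> t) i" for t
    proof -
      have "\<theta> (\<phi> t) = \<theta> (\<psi> t)"
        using mem[OF \<phi> t] mem[OF \<psi> t] eq by (auto simp: aspace_def fun_eq_iff) (metis not_le)
      then have "\<theta>' (\<theta> (\<phi> t)) = \<theta>' (\<theta> (\<psi> t))" by simp
      then show ?thesis using morphism_points[OF \<phi>, of t] morphism_points[OF \<psi>, of t] inv t pT by simp
    qed
    then have "T - {z \<in> T. \<phi> z = \<psi> z} = (\<Union>i<N. {t \<in> T. \<theta> (\<phi> t) i \<noteq> \<theta> (\<psi> t) i})" by auto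
    moreover have "openin (Top ?T) (\<Union>i<N. {t \<in> T. \<theta> (\<phi> t) i \<noteq> \<theta> (\<psi> t) i})"
      using open_i by (intro openin_Union) auto
    ultimately show "closedin (Top ?T) {z \<in> T. \<phi> z = \<psi> z}"
      by (simp add: closedin_def pT)
  qed
qed

lemma same_space_affine_variety:
  assumes "same_space X Y" "affine_variety X"
  shows "affine_variety Y"
  using assms same_space_is_sheaf[OF assms(1)] same_space_isomorphism[OF assms(1)]
  unfolding affine_variety_def by blast

lemma zariski_closed_Times:
  fixes Z :: "'a::affine_space set" and W :: "'b::affine_space set"
  assumes "zariski_closed Z" "zariski_closed W"
  shows "zariski_closed (Z \<times> W)"
proof -
  obtain P R where P: "P \<subseteq> polynomials" "Z = {x. \<forall>p\<in>P. p x = 0}"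
    and R: "R \<subseteq> polynomials" "W = {x. \<forall>p\<in>R. p x = 0}"
    using assms unfolding zariski_closed_def by blast
  let ?P = "(\<lambda>p (w :: 'a \<times> 'b). p (fst w)) ` P \<union> (\<lambda>p w. p (snd w)) ` R"
  have "?P \<subseteq> polynomials"
    using P(1) R(1) polynomials_compose[OF _ polynomial_map_fst] polynomials_compose[OF _ polynomial_map_snd]
    by blast
  moreover have "Z \<times> W = {w. \<forall>p\<in>?P. p w = 0}" unfolding P(2) R(2) by (auto simp: ball_Un)
  ultimately show ?thesis unfolding zariski_closed_def by blast
qed

lemma zariski_closed_zeros: "p \<in> polynomials \<Longrightarrow> zariski_closed {x. p x = c}"
  unfolding zariski_closed_def
  by (rule exI[of _ "{\<lambda>x. p x - c}"]) (simp add: polynomials_intros)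

section \<open>Actions of the additive group with a slice\<close>

locale ga_action =
  fixes act :: "complex \<Rightarrow> 'a::affine_space \<Rightarrow> 'a"
  assumes act_0: "act 0 x = x"
    and act_add: "act (t + u) x = act t (act u x)"
    and act_polynomial: "polynomial_map (\<lambda>p. act (fst p) (snd p))"
begin

abbreviation \<pi> :: "'a \<Rightarrow> 'a set" where
  "\<pi> \<equiv> orb UNIV act"

lemma act_minus: "act (- t) (act t x) = x"
  using act_add[of "- t" t x] act_0 by simp

lemma polynomial_map_act:
  "t \<in> polynomials \<Longrightarrow> polynomial_map \<phi> \<Longrightarrow> polynomial_map (\<lambda>x. act (t x) (\<phi> x))"
  using polynomial_map_compose[OF act_polynomial, of "\<lambda>x. (t x, \<phi> x)"]
  by (simp add: polynomial_map_Pair polynomial_map_complex)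

lemma orb_act: "\<pi> (act t x) = \<pi> x"
proof
  show "\<pi> (act t x) \<subseteq> \<pi> x" unfolding orb_def by (auto simp flip: act_add)
  have "act u x = act (u - t) (act t x)" for u by (simp flip: act_add)
  then show "\<pi> x \<subseteq> \<pi> (act t x)" unfolding orb_def by blast
qed

lemma orb_self: "x \<in> \<pi> x"
  unfolding orb_def by (rule image_eqI[of _ _ 0]) (simp_all add: act_0)

lemma orb_eq_iff: "\<pi> x = \<pi> y \<longleftrightarrow> y \<in> \<pi> x"
proof
  show "\<pi> x = \<pi> y \<Longrightarrow> y \<in> \<pi> x" using orb_self by simp
  show "y \<in> \<pi> x \<Longrightarrow> \<pi> x = \<pi> y" using orb_act by (auto simp: orb_def[of _ _ x])
qed

end

text \<open>A slice function \<open>s\<close> trivialises the action: every orbit meets the zero locus of \<open>s\<close> exactly once.\<close>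

locale ga_slice = ga_action act for act :: "complex \<Rightarrow> 'a::affine_space \<Rightarrow> 'a" +
  fixes Z :: "'a set" and s :: "'a \<Rightarrow> complex"
  assumes closed: "zariski_closed Z"
    and act_Z: "x \<in> Z \<Longrightarrow> act t x \<in> Z"
    and s_polynomial: "s \<in> polynomials"
    and s_act: "x \<in> Z \<Longrightarrow> s (act t x) = s x + t"
begin

definition slice :: "'a set" where
  "slice = {x \<in> Z. s x = 0}"

definition retract :: "'a \<Rightarrow> 'a" where
  "retract x = act (- s x) x"

abbreviation Q :: "'a set fspace" where
  "Q \<equiv> orbit_space UNIV act (subvariety Z)"

text \<open>The choice of a representative is harmless, since \<open>retract\<close> takes a single
  value on each orbit in Z.\<close>

definition section_map :: "'a set \<Rightarrow> 'a" where
  "section_map q = retract (SOME x. x \<in> Z \<and> \<pi> x = q)"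

lemma polynomial_map_retract: "polynomial_map retract"
  unfolding retract_def
  by (intro polynomial_map_act polynomial_map_id polynomials_intros s_polynomial)

lemma retract_slice: "x \<in> Z \<Longrightarrow> retract x \<in> slice"
  by (simp add: slice_def retract_def act_Z s_act)

lemma retract_act: "x \<in> Z \<Longrightarrow> retract (act t x) = retract x"
  by (simp add: retract_def s_act flip: act_add)

lemma act_retract: "act (s x) (retract x) = x"
  using act_minus[of "- s x" x] by (simp add: retract_def)

lemma retract_id: "x \<in> slice \<Longrightarrow> retract x = x"
  by (simp add: slice_def retract_def act_0)

lemma slice_subset: "x \<in> slice \<Longrightarrow> x \<in> Z"
  by (simp add: slice_def)

lemma orb_retract: "\<pi> (retract x) = \<pi> x"
  by (simp add: retract_def orb_act)

lemma orb_eq_iff_retract: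
  assumes "x \<in> Z"
  shows "\<pi> x = \<pi> y \<longleftrightarrow> retract x = retract y"
proof
  assume "\<pi> x = \<pi> y"
  then obtain t where "y = act t x" unfolding orb_eq_iff by (auto simp: orb_def)
  then show "retract x = retract y" using retract_act[OF assms] by simp
next
  assume "retract x = retract y"
  then show "\<pi> x = \<pi> y" using orb_retract by metis
qed

lemma section_map_orb: "x \<in> Z \<Longrightarrow> section_map (\<pi> x) = retract x"
  unfolding section_map_def
  using someI[of "\<lambda>y. y \<in> Z \<and> \<pi> y = \<pi> x" x] orb_eq_iff_retract by blast

section \<open>The orbit space as an affine geometric quotient and a trivial torsor\<close>

lemma points_Q: "points Q = \<pi> ` Z"
  by (simp add: points_orbit_space)

lemma ringed_Q: "ringed Q"
  by (intro ringed_orbit_space ringed_subvariety)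

lemma section_map_slice: "q \<in> points Q \<Longrightarrow> section_map q \<in> slice"
  by (auto simp: points_Q section_map_orb retract_slice)

lemma orb_section_map: "q \<in> points Q \<Longrightarrow> \<pi> (section_map q) = q"
  by (auto simp: points_Q section_map_orb orb_retract)

lemma morphism_section_map: "morphism Q (subvariety slice) section_map"
  by (rule morphism_descend[OF ringed_subvariety morphism_polynomial_map[OF polynomial_map_retract]])
     (simp_all add: retract_slice section_map_orb)

lemma morphism_orb_slice: "morphism (subvariety slice) Q \<pi>"
proof -
  have "morphism (subvariety slice) (subvariety Z) (\<lambda>x. x)"
    by (rule morphism_polynomial_map[OF polynomial_map_id slice_subset])
  from morphism_compose[OF this morphism_orbit_space] show ?thesis .
qed

text \<open>The retraction descends because it is constant on orbits; on the slice it is the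
  identity, so the orbit map restricted to the slice inverts it.\<close>

lemma isomorphism_section_map: "isomorphism Q (subvariety slice) section_map"
  by (rule isomorphismI[OF morphism_section_map morphism_orb_slice])
     (simp_all add: orb_section_map section_map_orb slice_subset retract_id)

lemma slice_closed: "zariski_closed slice"
proof -
  obtain P where P: "P \<subseteq> polynomials" "Z = {x. \<forall>p\<in>P. p x = 0}"
    using closed unfolding zariski_closed_def by blast
  have "slice = {x. \<forall>p\<in>insert s P. p x = 0}" unfolding slice_def by (subst P(2)) auto
  then show ?thesis using P(1) s_polynomial unfolding zariski_closed_def
    by (intro exI[of _ "insert s P"]) simp
qed

theorem affine_Q: "affine_variety Q"
  by (rule affine_variety_isomorphic[OF ringed_Q slice_closed isomorphism_section_map])

text \<open>That Q is a variety comes from its affineness; the other clauses hold by the way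
  \<open>orbit_space\<close> is built.\<close>

theorem geometric_quotient_Q: "geometric_quotient UNIV act (subvariety Z) Q \<pi>"
  unfolding geometric_quotient_def
proof (intro conjI ballI allI impI)
  show "variety Q" by (rule affine_variety_imp_variety[OF affine_Q])
  show "morphism (subvariety Z) Q \<pi>" by (rule morphism_orbit_space)
  show "\<pi> x = \<pi> y \<longleftrightarrow> y \<in> \<pi> x" for x y by (rule orb_eq_iff)
  show "quotient_map (Top (subvariety Z)) (Top Q) \<pi>"
    unfolding quotient_map_def by (simp add: points_Q openin_orbit_space)
  show "Reg Q U = {f. f \<circ> \<pi> \<in> Reg (subvariety Z) {x \<in> points (subvariety Z). \<pi> x \<in> U}}" for U
    by (auto simp: Reg_orbit_space comp_def)
qed

lemma A1_ringed: "ringed A1"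
  by (simp add: A1_def ringed_subvariety)

lemma points_A1: "points A1 = UNIV"
  by (simp add: A1_def)

theorem trivial_torsor_Q: "trivial_Ga_torsor act (subvariety Z) Q \<pi>"
  unfolding trivial_Ga_torsor_def trivial_Ga_torsor_over_def
proof (rule exI[of _ "\<lambda>x. (\<pi> x, s x)"], intro conjI ballI impI allI)
  let ?P = "prod_space Q A1"
  have "{x \<in> points (subvariety Z). \<pi> x \<in> points Q} = points (subvariety Z)" by (auto simp: points_Q)
  then have sub: "open_sub (subvariety Z) {x \<in> points (subvariety Z). \<pi> x \<in> points Q} = subvariety Z"
    by (simp only: open_sub_points)
  have P: "ringed ?P" by (intro ringed_prod_space ringed_Q A1_ringed)
  have pts: "points ?P = points Q \<times> UNIV"
    by (simp add: points_prod_space[OF ringed_Q A1_ringed] points_A1)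
  have "morphism (subvariety Z) A1 s"
    unfolding A1_def by (rule morphism_polynomial_map) (simp_all add: polynomial_map_complex s_polynomial)
  then have 1: "morphism (subvariety Z) ?P (\<lambda>x. (\<pi> x, s x))"
    by (intro morphism_into_prod_space ringed_Q A1_ringed ringed_subvariety morphism_orbit_space)
  \<comment> \<open>The inverse of (\<pi>, s): take the slice point of the orbit and move it by the
    prescribed time.\<close>
  have 2: "morphism ?P (subvariety Z) (\<lambda>p. act (snd p) (section_map (fst p)))"
  proof (rule morphism_subvarietyI[OF P])
    show "act (snd p) (section_map (fst p)) \<in> Z" if "p \<in> points ?P" for p
      using that act_Z[OF slice_subset[OF section_map_slice]] by (auto simp: pts)
    fix k :: "'a \<Rightarrow> complex" assume "k \<in> coords"
    then have k: "(\<lambda>p. k (act (fst p) (snd p))) \<in> alg_gen coords"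
      using act_polynomial by (simp add: polynomial_map_def polynomials_def)
    \<comment> \<open>A coordinate of the action map is a polynomial in the time and in a point of
      Z; the time is regular on \<open>A1\<close>, and the coordinates of the point are regular on Q
      through \<open>section_map\<close>.\<close>
    have "(\<lambda>p. l (snd p, section_map (fst p))) \<in> Reg ?P (points ?P)"
      if l: "l \<in> coords" for l :: "complex \<times> 'a \<Rightarrow> complex"
    proof -
      consider "l = fst" | f where "f \<in> coords" "l = (\<lambda>p. f (snd p))"
        using l by (auto simp: coords_prod_def coords_complex_def comp_def)
      then show ?thesis
      proof cases
        case 1
        have "(\<lambda>z. z) \<in> Reg A1 (points A1)"
          unfolding points_A1 unfolding A1_def
          by (rule Reg_subvarietyI) (auto intro!: coords_polynomials simp: coords_complex_def)
        from prod_space_projections(2)[OF ringed_Q A1_ringed this] show ?thesis using 1 by simp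
      next
        case 2
        have "{q \<in> points Q. section_map q \<in> slice} = points Q" using section_map_slice by auto
        moreover have "openin (Top (subvariety slice)) slice"
          using openin_topspace[of "Top (subvariety slice)"] by simp
        ultimately have "(\<lambda>q. f (section_map q)) \<in> Reg Q (points Q)"
          using morphism_Reg[OF morphism_section_map _ Reg_subvarietyI[OF coords_polynomials[OF 2(1)]]] by simp
        from prod_space_projections(1)[OF ringed_Q A1_ringed this] show ?thesis using 2 by simp
      qed
    qed
    from ringed_alg_gen[OF P k openin_topspace, of "\<lambda>p. (snd p, section_map (fst p))", OF this]
    show "(\<lambda>p. k (act (snd p) (section_map (fst p)))) \<in> Reg ?P (points ?P)" by simp
  qed
  show "isomorphism (open_sub (subvariety Z) {x \<in> points (subvariety Z). \<pi> x \<in> points Q})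
      (prod_space (open_sub Q (points Q)) A1) (\<lambda>x. (\<pi> x, s x))"
    unfolding sub open_sub_points
  proof (rule isomorphismI[OF 1 2])
    fix x assume "x \<in> points (subvariety Z)"
    then show "act (snd (\<pi> x, s x)) (section_map (fst (\<pi> x, s x))) = x"
      by (simp add: section_map_orb act_retract)
  next
    fix p assume "p \<in> points ?P"
    then obtain q t where p: "p = (q, t)" "q \<in> points Q" by (auto simp: pts)
    have "s (act t (section_map q)) = t"
      using section_map_slice[OF p(2)] by (simp add: slice_def s_act)
    then show "(\<pi> (act (snd p) (section_map (fst p))), s (act (snd p) (section_map (fst p)))) = p"
      using p by (simp add: orb_act orb_section_map)
  qed
next
  fix x t assume "x \<in> points (subvariety Z)"
  then show "(\<pi> (act t x), s (act t x)) = (\<pi> x, snd (\<pi> x, s x) + t)" by (simp add: orb_act s_act)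
qed simp

theorem locally_trivial_Q: "locally_trivial_Ga_quotient act (subvariety Z) Q \<pi>"
  unfolding locally_trivial_Ga_quotient_def
  using geometric_quotient_Q trivial_torsor_Q[unfolded trivial_Ga_torsor_def] openin_topspace by blast

subsection \<open>The ring of invariants\<close>

abbreviation A :: "('a \<Rightarrow> complex) set" where
  "A \<equiv> invariant_ring UNIV act Z"

definition pullback :: "('a \<Rightarrow> complex) \<Rightarrow> 'a \<Rightarrow> complex" where
  "pullback p = (\<lambda>x\<in>Z. p (retract x))"

lemma pullback_simp: "x \<in> Z \<Longrightarrow> pullback p x = p (retract x)"
  by (simp add: pullback_def)

text \<open>An invariant has the same value at x and at the point where the orbit of x meets the
  slice. Conversely, \<open>retract\<close> is polynomial and constant on orbits.\<close>

lemma invariant_ring_eq: "A = pullback ` polynomials"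
proof (intro equalityI subsetI)
  fix f assume f: "f \<in> A"
  then obtain p where p: "p \<in> polynomials" "f = restrict p Z"
    by (auto simp: invariant_ring_def coord_ring_def)
  have "p (retract x) = p x" if "x \<in> Z" for x
    using f that p(2) act_Z by (auto simp: invariant_ring_def retract_def)
  then have "f = pullback p" using p(2) by (auto simp: pullback_def)
  then show "f \<in> pullback ` polynomials" using p(1) by blast
next
  fix f assume "f \<in> pullback ` polynomials"
  then obtain p where "p \<in> polynomials" "f = pullback p" by blast
  then show "f \<in> A"
    using polynomials_compose[OF _ polynomial_map_retract]
    by (auto simp: invariant_ring_def coord_ring_def pullback_def act_Z retract_act)
qed

text \<open>\<open>pullback\<close> is a homomorphism from the polynomial ring onto A, so the images
  of the coordinates generate. Both inductions compare values on Z only, because the generated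
  algebra contains honest constants while elements of A are undefined off Z.\<close>

theorem finitely_generated_A: "finitely_generated_algebra Z A"
  unfolding finitely_generated_algebra_def
proof (intro exI[of _ "pullback ` coords"] conjI)
  show "pullback ` coords \<subseteq> A" unfolding invariant_ring_eq using coords_polynomials by blast
  show "finite (pullback ` (coords :: ('a \<Rightarrow> complex) set))" by (intro finite_imageI finite_coords)
  have fwd: "\<exists>g\<in>alg_gen (pullback ` coords). \<forall>x\<in>Z. g x = p (retract x)" if "p \<in> alg_gen coords" for p
    using that
  proof induction
    case (const c) then show ?case by (intro bexI[OF _ alg_gen.const[of c]]) simp
  next
    case (gen k)
    then have "pullback k \<in> alg_gen (pullback ` coords)" by (auto intro: alg_gen.gen)
    then show ?case by (rule bexI[rotated]) (simp add: pullback_def)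
  next
    case (add f g)
    then obtain f' g' where "f' \<in> alg_gen (pullback ` coords)" "\<forall>x\<in>Z. f' x = f (retract x)"
      "g' \<in> alg_gen (pullback ` coords)" "\<forall>x\<in>Z. g' x = g (retract x)" by blast
    then show ?case by (intro bexI[of _ "\<lambda>x. f' x + g' x"]) (auto intro: alg_gen.add)
  next
    case (mult f g)
    then obtain f' g' where "f' \<in> alg_gen (pullback ` coords)" "\<forall>x\<in>Z. f' x = f (retract x)"
      "g' \<in> alg_gen (pullback ` coords)" "\<forall>x\<in>Z. g' x = g (retract x)" by blast
    then show ?case by (intro bexI[of _ "\<lambda>x. f' x * g' x"]) (auto intro: alg_gen.mult)
  qed
  have bwd: "\<exists>p\<in>polynomials. \<forall>x\<in>Z. g x = p (retract x)" if "g \<in> alg_gen (pullback ` coords)" for g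
    using that
  proof induction
    case (const c) then show ?case by (intro bexI[of _ "\<lambda>_. c"]) (auto intro: polynomials_intros)
  next
    case (gen k) then show ?case by (auto simp: pullback_simp intro!: bexI coords_polynomials)
  next
    case (add f g)
    then obtain f' g' where "f' \<in> polynomials" "\<forall>x\<in>Z. f x = f' (retract x)"
      "g' \<in> polynomials" "\<forall>x\<in>Z. g x = g' (retract x)" by blast
    then show ?case by (intro bexI[of _ "\<lambda>x. f' x + g' x"]) (auto intro: polynomials_intros)
  next
    case (mult f g)
    then obtain f' g' where "f' \<in> polynomials" "\<forall>x\<in>Z. f x = f' (retract x)"
      "g' \<in> polynomials" "\<forall>x\<in>Z. g x = g' (retract x)" by blast
    then show ?case by (intro bexI[of _ "\<lambda>x. f' x * g' x"]) (auto intro: polynomials_intros)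
  qed
  have eq: "restrict g Z = pullback p" if "\<forall>x\<in>Z. g x = p (retract x)" for g p
    using that by (auto simp: pullback_def)
  show "A = (\<lambda>f. restrict f Z) ` alg_gen (pullback ` coords)"
    unfolding invariant_ring_eq
  proof (intro equalityI subsetI)
    fix f assume "f \<in> pullback ` polynomials"
    then obtain p where p: "p \<in> alg_gen coords" "f = pullback p" by (auto simp: polynomials_def)
    from fwd[OF p(1)] obtain g where g: "g \<in> alg_gen (pullback ` coords)" "\<forall>x\<in>Z. g x = p (retract x)"
      by blast
    show "f \<in> (\<lambda>f. restrict f Z) ` alg_gen (pullback ` coords)"
      unfolding p(2) eq[OF g(2), symmetric] using g(1) by (rule imageI)
  next
    fix f assume "f \<in> (\<lambda>f. restrict f Z) ` alg_gen (pullback ` coords)"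
    then obtain g where g: "g \<in> alg_gen (pullback ` coords)" "f = restrict g Z" by blast
    from bwd[OF g(1)] obtain p where p: "p \<in> polynomials" "\<forall>x\<in>Z. g x = p (retract x)" by blast
    show "f \<in> pullback ` polynomials" unfolding g(2) eq[OF p(2)] using p(1) by (rule imageI)
  qed
qed

section \<open>Characters of the ring of invariants as points of the slice\<close>

lemma pullback_const: "(\<lambda>x\<in>Z. c) = pullback (\<lambda>_. c)"
  and pullback_add: "(\<lambda>x\<in>Z. pullback p x + pullback q x) = pullback (\<lambda>x. p x + q x)"
  and pullback_mult: "(\<lambda>x\<in>Z. pullback p x * pullback q x) = pullback (\<lambda>x. p x * q x)"
  by (auto simp: pullback_def)

lemma alg_points_pullback:
  assumes "\<gamma> \<in> alg_points Z A"
  shows "\<gamma> (pullback (\<lambda>_. c)) = c"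
    and "p \<in> polynomials \<Longrightarrow> q \<in> polynomials \<Longrightarrow>
      \<gamma> (pullback (\<lambda>x. p x + q x)) = \<gamma> (pullback p) + \<gamma> (pullback q)"
    and "p \<in> polynomials \<Longrightarrow> q \<in> polynomials \<Longrightarrow>
      \<gamma> (pullback (\<lambda>x. p x * q x)) = \<gamma> (pullback p) * \<gamma> (pullback q)"
  using assms unfolding alg_points_def invariant_ring_eq
  by (simp_all flip: pullback_const pullback_add pullback_mult)

definition point_of :: "(('a \<Rightarrow> complex) \<Rightarrow> complex) \<Rightarrow> 'a" where
  "point_of \<gamma> = (THE x. \<forall>k\<in>coords. k x = \<gamma> (pullback k))"

lemma coords_point_of: "k \<in> coords \<Longrightarrow> k (point_of \<gamma>) = \<gamma> (pullback k)"
  using theI'[OF ex1_coords[of "\<lambda>k. \<gamma> (pullback k)"]] unfolding point_of_def by blast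

text \<open>\<gamma> composed with \<open>pullback\<close> is a character of the polynomial ring,
  and a character of that ring is evaluation at the point given by its values on the
  coordinates.\<close>

lemma polynomials_point_of:
  assumes \<gamma>: "\<gamma> \<in> alg_points Z A" and p: "p \<in> polynomials"
  shows "p (point_of \<gamma>) = \<gamma> (pullback p)"
  using p[unfolded polynomials_def]
proof induction
  case (const c) then show ?case by (simp add: alg_points_pullback[OF \<gamma>])
next
  case (gen k) then show ?case by (rule coords_point_of)
next
  case (add f g) then show ?case using alg_points_pullback(2)[OF \<gamma>] by (simp add: polynomials_def)
next
  case (mult f g) then show ?case using alg_points_pullback(3)[OF \<gamma>] by (simp add: polynomials_def)
qed

text \<open>An equation of the slice becomes zero after composition with \<open>retract\<close>; its
  pullback is the zero of A, which \<gamma> kills.\<close>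

lemma point_of_slice:
  assumes \<gamma>: "\<gamma> \<in> alg_points Z A"
  shows "point_of \<gamma> \<in> slice"
proof -
  obtain P where P: "P \<subseteq> polynomials" "slice = {x. \<forall>p\<in>P. p x = 0}"
    using slice_closed unfolding zariski_closed_def by blast
  have "p (point_of \<gamma>) = 0" if "p \<in> P" for p
  proof -
    have "p \<in> polynomials" using P(1) that by blast
    from polynomials_point_of[OF \<gamma> this] have "p (point_of \<gamma>) = \<gamma> (pullback p)" .
    also have "pullback p = pullback (\<lambda>_. 0)"
      using that P(2) retract_slice by (auto simp: pullback_def)
    finally show ?thesis by (simp add: alg_points_pullback[OF \<gamma>])
  qed
  then show ?thesis using P(2) by blast
qed

lemma spec_map_point_of:
  assumes \<gamma>: "\<gamma> \<in> alg_points Z A"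
  shows "spec_map A (point_of \<gamma>) = \<gamma>"
proof -
  have "f (point_of \<gamma>) = \<gamma> f" if f: "f \<in> A" for f
  proof -
    obtain p where p: "p \<in> polynomials" "f = pullback p" using f unfolding invariant_ring_eq by blast
    note S = point_of_slice[OF \<gamma>]
    have "f (point_of \<gamma>) = p (point_of \<gamma>)"
      using p(2) retract_id[OF S] slice_subset[OF S] by (simp add: pullback_simp)
    then show ?thesis using polynomials_point_of[OF \<gamma> p(1)] p(2) by simp
  qed
  moreover have "\<gamma> \<in> extensional A" using \<gamma> by (simp add: alg_points_def)
  ultimately show ?thesis unfolding spec_map_def by (auto simp: extensional_def)
qed

lemma spec_map_alg_points:
  assumes x: "x \<in> Z"
  shows "spec_map A x \<in> alg_points Z A"
proof -
  have "pullback (\<lambda>_. c) \<in> A" for c unfolding invariant_ring_eq using polynomials_intros(1) by blast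
  moreover have "pullback (\<lambda>x. p x + q x) \<in> A" "pullback (\<lambda>x. p x * q x) \<in> A"
    if "p \<in> polynomials" "q \<in> polynomials" for p q
    unfolding invariant_ring_eq using that polynomials_intros(2,3) by blast+
  ultimately have "(\<lambda>x\<in>Z. c) \<in> A" "f \<in> A \<Longrightarrow> g \<in> A \<Longrightarrow> (\<lambda>x\<in>Z. f x + g x) \<in> A"
    "f \<in> A \<Longrightarrow> g \<in> A \<Longrightarrow> (\<lambda>x\<in>Z. f x * g x) \<in> A" for c f g
    unfolding pullback_const by (auto simp: invariant_ring_eq pullback_add pullback_mult)
  then show ?thesis using x by (simp add: alg_points_def spec_map_def)
qed

text \<open>The inverse sends a character to the orbit of its \<open>point_of\<close>: every
  character is evaluation at a slice point, and a slice point is recovered from the values of its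
  coordinates.\<close>

theorem spec_map_surj: "spec_map A ` Z = points (Spec Z A)"
  and isomorphism_Spec: "\<exists>\<theta>. isomorphism Q (Spec Z A) \<theta> \<and> (\<forall>y\<in>Z. \<theta> (\<pi> y) = spec_map A y)"
proof -
  have alg: "algebra_on (alg_points Z A) ((\<lambda>f \<gamma>. \<gamma> f) ` A)"
    unfolding algebra_on_def
  proof (intro conjI allI ballI)
    fix c :: complex
    have "(\<lambda>x\<in>Z. c) \<in> A" unfolding pullback_const invariant_ring_eq using polynomials_intros(1) by blast
    then show "\<exists>h\<in>(\<lambda>f \<gamma>. \<gamma> f) ` A. \<forall>x\<in>alg_points Z A. h x = c"
      unfolding pullback_const by (intro bexI[OF _ imageI]) (auto simp: alg_points_pullback)
  next
    fix f' g' :: "(('a \<Rightarrow> complex) \<Rightarrow> complex) \<Rightarrow> complex"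
    assume "f' \<in> (\<lambda>f \<gamma>. \<gamma> f) ` A" "g' \<in> (\<lambda>f \<gamma>. \<gamma> f) ` A"
    then obtain p q where pq: "p \<in> polynomials" "q \<in> polynomials"
      and eq: "f' = (\<lambda>\<gamma>. \<gamma> (pullback p))" "g' = (\<lambda>\<gamma>. \<gamma> (pullback q))"
      unfolding invariant_ring_eq by blast
    have mem: "pullback (\<lambda>x. p x + q x) \<in> A" "pullback (\<lambda>x. p x * q x) \<in> A"
      unfolding invariant_ring_eq using pq polynomials_intros(2,3) by blast+
    show "\<exists>h\<in>(\<lambda>f \<gamma>. \<gamma> f) ` A. \<forall>x\<in>alg_points Z A. h x = f' x + g' x"
      unfolding eq
      by (intro bexI[of _ "\<lambda>\<gamma>. \<gamma> (pullback (\<lambda>x. p x + q x))"] ballI imageI mem) (simp add: alg_points_pullback pq)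
    show "\<exists>h\<in>(\<lambda>f \<gamma>. \<gamma> f) ` A. \<forall>x\<in>alg_points Z A. h x = f' x * g' x"
      unfolding eq
      by (intro bexI[of _ "\<lambda>\<gamma>. \<gamma> (pullback (\<lambda>x. p x * q x))"] ballI imageI mem) (simp add: alg_points_pullback pq)
  qed
  have pts: "points (Spec Z A) = alg_points Z A" unfolding Spec_def by (rule points_fun_space[OF alg])
  show "spec_map A ` Z = points (Spec Z A)"
    unfolding pts
  proof (intro equalityI subsetI)
    fix \<gamma> assume \<gamma>: "\<gamma> \<in> alg_points Z A"
    show "\<gamma> \<in> spec_map A ` Z"
      by (rule image_eqI[of _ _ "point_of \<gamma>"])
         (simp_all add: spec_map_point_of[OF \<gamma>] slice_subset[OF point_of_slice[OF \<gamma>]])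
  qed (auto simp: spec_map_alg_points)
  have inv: "spec_map A (retract x) = spec_map A x" if "x \<in> Z" for x
  proof -
    have "f (retract x) = f x" if "f \<in> A" for f
      using that \<open>x \<in> Z\<close> unfolding retract_def invariant_ring_def by auto
    then show ?thesis unfolding spec_map_def by (auto simp: restrict_def)
  qed
  have "morphism (subvariety Z) (Spec Z A) (spec_map A)"
    unfolding Spec_def
  proof (rule morphism_fun_spaceI[OF alg ringed_subvariety])
    show "spec_map A x \<in> alg_points Z A" if "x \<in> points (subvariety Z)" for x
      using that by (simp add: spec_map_alg_points)
    fix a :: "(('a \<Rightarrow> complex) \<Rightarrow> complex) \<Rightarrow> complex"
    assume "a \<in> (\<lambda>f \<gamma>. \<gamma> f) ` A"
    then obtain f p where a: "f \<in> A" "a = (\<lambda>\<gamma>. \<gamma> f)" "p \<in> polynomials" "f = restrict p Z"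
      by (auto simp: invariant_ring_def coord_ring_def)
    have "openin (Top (subvariety Z)) Z" using openin_topspace[of "Top (subvariety Z)"] by simp
    from ringed_cong[OF ringed_subvariety this Reg_subvarietyI[OF a(3)], of "\<lambda>x. a (spec_map A x)"]
    show "(\<lambda>x. a (spec_map A x)) \<in> Reg (subvariety Z) (points (subvariety Z))"
      using a by (simp add: spec_map_def)
  qed
  then have 1: "morphism Q (Spec Z A) (\<lambda>q. spec_map A (section_map q))"
    by (rule morphism_descend[OF ringed_subvariety]) (simp add: section_map_orb inv)
  have "morphism (Spec Z A) (subvariety slice) point_of"
  proof (rule morphism_subvarietyI)
    show rS: "ringed (Spec Z A)" unfolding Spec_def by (rule ringed_fun_space[OF alg])
    show "point_of \<gamma> \<in> slice" if "\<gamma> \<in> points (Spec Z A)" for \<gamma>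
      using that pts point_of_slice by simp
    fix k :: "'a \<Rightarrow> complex" assume k: "k \<in> coords"
    then have "pullback k \<in> A" unfolding invariant_ring_eq using coords_polynomials by blast
    then have "(\<lambda>\<gamma>. \<gamma> (pullback k)) \<in> Reg (Spec Z A) (points (Spec Z A))"
      unfolding pts unfolding Spec_def by (intro Reg_fun_spaceI[OF alg]) blast
    then show "(\<lambda>\<gamma>. k (point_of \<gamma>)) \<in> Reg (Spec Z A) (points (Spec Z A))"
      using coords_point_of[OF k] by simp
  qed
  from morphism_compose[OF this morphism_orb_slice]
  have 2: "morphism (Spec Z A) Q (\<lambda>\<gamma>. \<pi> (point_of \<gamma>))" .
  have "isomorphism Q (Spec Z A) (\<lambda>q. spec_map A (section_map q))"
  proof (rule isomorphismI[OF 1 2])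
    fix q assume "q \<in> points Q"
    then obtain x where x: "x \<in> Z" "q = \<pi> x" by (auto simp: points_Q)
    let ?y = "point_of (spec_map A (retract x))"
    have S: "retract x \<in> slice" using x by (simp add: retract_slice)
    have "k ?y = k (retract x)" if "k \<in> coords" for k
    proof -
      have "pullback k \<in> A" unfolding invariant_ring_eq using coords_polynomials that by blast
      then show ?thesis
        using coords_point_of[OF that] by (simp add: spec_map_def pullback_simp slice_subset[OF S] retract_id[OF S])
    qed
    then have "?y = retract x" by (rule affine_space_eqI)
    then show "\<pi> (point_of (spec_map A (section_map q))) = q"
      using x by (simp add: section_map_orb orb_retract)
  next
    fix \<gamma> assume "\<gamma> \<in> points (Spec Z A)"
    then have \<gamma>: "\<gamma> \<in> alg_points Z A" using pts by simp
    note S = point_of_slice[OF \<gamma>]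
    show "spec_map A (section_map (\<pi> (point_of \<gamma>))) = \<gamma>"
      using section_map_orb[OF slice_subset[OF S]] retract_id[OF S] spec_map_point_of[OF \<gamma>] by simp
  qed
  then show "\<exists>\<theta>. isomorphism Q (Spec Z A) \<theta> \<and> (\<forall>y\<in>Z. \<theta> (\<pi> y) = spec_map A y)"
    by (rule exI[of _ "\<lambda>q. spec_map A (section_map q)", OF conjI]) (simp add: section_map_orb inv)
qed

end

section \<open>Derivatives of polynomials\<close>

text \<open>The family d acts as the gradient of p at x with respect to the generators. It is chosen
  before the curve, so the same numbers serve coordinate lines and arbitrary test curves.\<close>

lemma alg_gen_chain_rule:
  assumes "finite I" "p \<in> alg_gen (c ` I)"
  shows "\<exists>d. \<forall>\<gamma> \<gamma>'. \<gamma> (0::complex) = x \<longrightarrow>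
      (\<forall>i\<in>I. ((\<lambda>t. c i (\<gamma> t)) has_field_derivative \<gamma>' i) (at 0)) \<longrightarrow>
      ((\<lambda>t. p (\<gamma> t)) has_field_derivative (\<Sum>i\<in>I. d i * \<gamma>' i)) (at 0)"
  using assms(2)
proof induction
  case (const k) then show ?case by (intro exI[of _ "\<lambda>_. 0"]) simp
next
  case (gen k)
  then obtain j where "j \<in> I" "k = c j" by blast
  then show ?case
    using assms(1) by (intro exI[of _ "\<lambda>i. if i = j then 1 else 0"]) (simp add: if_distrib[of "\<lambda>z. z * _"] cong: if_cong)
next
  case (add f g)
  then obtain d e where
    d: "\<And>\<gamma> \<gamma>'. \<gamma> 0 = x \<Longrightarrow> (\<forall>i\<in>I. ((\<lambda>t. c i (\<gamma> t)) has_field_derivative \<gamma>' i) (at 0)) \<Longrightarrow>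
      ((\<lambda>t. f (\<gamma> t)) has_field_derivative (\<Sum>i\<in>I. d i * \<gamma>' i)) (at 0)" and
    e: "\<And>\<gamma> \<gamma>'. \<gamma> 0 = x \<Longrightarrow> (\<forall>i\<in>I. ((\<lambda>t. c i (\<gamma> t)) has_field_derivative \<gamma>' i) (at 0)) \<Longrightarrow>
      ((\<lambda>t. g (\<gamma> t)) has_field_derivative (\<Sum>i\<in>I. e i * \<gamma>' i)) (at 0)"
    by blast
  have eq: "(\<Sum>i\<in>I. d i * \<gamma>' i) + (\<Sum>i\<in>I. e i * \<gamma>' i) = (\<Sum>i\<in>I. (d i + e i) * \<gamma>' i)" for \<gamma>'
    by (simp add: sum.distrib distrib_right)
  show ?case
  proof (intro exI allI impI)
    fix \<gamma> \<gamma>' assume \<gamma>: "\<gamma> 0 = x" "\<forall>i\<in>I. ((\<lambda>t. c i (\<gamma> t)) has_field_derivative \<gamma>' i) (at 0)"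
    show "((\<lambda>t. f (\<gamma> t) + g (\<gamma> t)) has_field_derivative (\<Sum>i\<in>I. (d i + e i) * \<gamma>' i)) (at 0)"
      using DERIV_add[OF d[OF \<gamma>] e[OF \<gamma>]] unfolding eq .
  qed
next
  case (mult f g)
  then obtain d e where
    d: "\<And>\<gamma> \<gamma>'. \<gamma> 0 = x \<Longrightarrow> (\<forall>i\<in>I. ((\<lambda>t. c i (\<gamma> t)) has_field_derivative \<gamma>' i) (at 0)) \<Longrightarrow>
      ((\<lambda>t. f (\<gamma> t)) has_field_derivative (\<Sum>i\<in>I. d i * \<gamma>' i)) (at 0)" and
    e: "\<And>\<gamma> \<gamma>'. \<gamma> 0 = x \<Longrightarrow> (\<forall>i\<in>I. ((\<lambda>t. c i (\<gamma> t)) has_field_derivative \<gamma>' i) (at 0)) \<Longrightarrow>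
      ((\<lambda>t. g (\<gamma> t)) has_field_derivative (\<Sum>i\<in>I. e i * \<gamma>' i)) (at 0)"
    by blast
  have eq: "(\<Sum>i\<in>I. d i * \<gamma>' i) * g x + (\<Sum>i\<in>I. e i * \<gamma>' i) * f x
      = (\<Sum>i\<in>I. (d i * g x + e i * f x) * \<gamma>' i)" for \<gamma>'
    by (simp add: sum.distrib sum_distrib_right sum_distrib_left algebra_simps)
  show ?case
  proof (intro exI allI impI)
    fix \<gamma> \<gamma>' assume \<gamma>: "\<gamma> 0 = x" "\<forall>i\<in>I. ((\<lambda>t. c i (\<gamma> t)) has_field_derivative \<gamma>' i) (at 0)"
    show "((\<lambda>t. f (\<gamma> t) * g (\<gamma> t)) has_field_derivative (\<Sum>i\<in>I. (d i * g x + e i * f x) * \<gamma>' i)) (at 0)"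
      using DERIV_mult[OF d[OF \<gamma>] e[OF \<gamma>]] unfolding \<gamma>(1) eq .
  qed
qed

lemma polynomials_complex_derivative:
  fixes p :: "complex \<Rightarrow> complex"
  assumes "p \<in> polynomials"
  shows "\<exists>d. (p has_field_derivative d) (at x)"
proof -
  have "p \<in> alg_gen ((\<lambda>_ z. z) ` {()})"
    using assms by (simp add: polynomials_def coords_complex_def)
  from alg_gen_chain_rule[OF _ this, of x] have
    "\<exists>d. \<forall>\<gamma> \<gamma>'. \<gamma> 0 = x \<longrightarrow> ((\<lambda>t. \<gamma> t) has_field_derivative \<gamma>' ()) (at 0) \<longrightarrow>
      ((\<lambda>t. p (\<gamma> t)) has_field_derivative d () * \<gamma>' ()) (at 0)" by simp
  then obtain d where "\<And>\<gamma> \<gamma>'. \<gamma> 0 = x \<Longrightarrow> ((\<lambda>t. \<gamma> t) has_field_derivative \<gamma>' ()) (at 0) \<Longrightarrow>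
      ((\<lambda>t. p (\<gamma> t)) has_field_derivative d () * \<gamma>' ()) (at 0)" by blast
  \<comment> \<open>The chain rule is based at parameter 0, hence the shifted line through
    x.\<close>
  from this[of "\<lambda>t. t + x" "\<lambda>_. 1"]
  have "((\<lambda>t. p (t + x)) has_field_derivative d ()) (at 0)"
    by (simp add: DERIV_shift[of "\<lambda>t. t" 1 0 x, simplified])
  then have "(p has_field_derivative d ()) (at x)" using DERIV_shift[of p "d ()" 0 x] by simp
  then show ?thesis ..
qed

text \<open>The curves are test vectors: along \<gamma> i only the equation p i moves to first
  order, with speed e i. The Jacobian matrix applied to these velocities is an invertible diagonal
  matrix, so its rows are independent.\<close>

lemma (in coord_enumeration) jacobian_full_rankI:
  assumes p: "\<And>i. i < r \<Longrightarrow> p i \<in> polynomials"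
    and \<gamma>: "\<And>i. i < r \<Longrightarrow> polynomial_map (\<gamma> i)" "\<And>i. i < r \<Longrightarrow> \<gamma> i (0::complex) = x"
    and der: "\<And>i j. i < r \<Longrightarrow> j < r \<Longrightarrow>
        ((\<lambda>t. p j (\<gamma> i t)) has_field_derivative (if j = i then e i else 0)) (at 0)"
    and e: "\<And>i. i < r \<Longrightarrow> e i \<noteq> 0"
  shows "jacobian_full_rank N r (\<lambda>i z. p i (\<kappa> z)) (\<iota> x)"
  unfolding jacobian_full_rank_def
proof (intro allI impI)
  fix c i
  let ?z = "\<iota> x"
  assume c: "\<forall>j<N. (\<Sum>i<r. c i * deriv (\<lambda>t. p i (\<kappa> (?z(j := t)))) (?z j)) = 0" and i: "i < r"
  have coords_N: "{\<lambda>z. z i |i. i < N} = (\<lambda>i z. z i) ` {..<N}" for N :: nat by auto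
  define chain where "chain j d \<longleftrightarrow> (\<forall>\<gamma> \<gamma>'. \<gamma> 0 = ?z \<longrightarrow>
      (\<forall>k\<in>{..<N}. ((\<lambda>t. \<gamma> t k) has_field_derivative \<gamma>' k) (at 0)) \<longrightarrow>
      ((\<lambda>t. p j (\<kappa> (\<gamma> t))) has_field_derivative (\<Sum>k<N. d k * \<gamma>' k)) (at 0))" for j d
  have "\<exists>d. chain j d" if "j < r" for j
    using alg_gen_chain_rule[of "{..<N}" "\<lambda>z. p j (\<kappa> z)" "\<lambda>i z. z i" ?z]
      polynomial_\<kappa>[OF p[OF that]] unfolding chain_def by (simp add: apoly_def coords_N)
  then obtain d where d': "\<And>j. j < r \<Longrightarrow> chain j (d j)" by metis
  have d: "((\<lambda>t. p j (\<kappa> (\<gamma> t))) has_field_derivative (\<Sum>k<N. d j k * \<gamma>' k)) (at 0)"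
    if "j < r" "\<gamma> 0 = ?z" "\<And>k. k < N \<Longrightarrow> ((\<lambda>t. \<gamma> t k) has_field_derivative \<gamma>' k) (at 0)" for j \<gamma> \<gamma>'
    using d'[OF that(1)] that(2,3) unfolding chain_def by simp
  \<comment> \<open>The coordinate line in direction k shows that the chain rule coefficient d j k
    is the partial derivative in the definition of the Jacobian.\<close>
  have partial: "deriv (\<lambda>t. p j (\<kappa> (?z(k := t)))) (?z k) = d j k" if j: "j < r" and k: "k < N" for j k
  proof -
    have "((\<lambda>t. p j (\<kappa> (?z(k := t + ?z k)))) has_field_derivative
        (\<Sum>l<N. d j l * (if l = k then 1 else 0))) (at 0)"
      by (rule d[OF j]) (auto intro!: derivative_eq_intros)
    then have "((\<lambda>t. p j (\<kappa> (?z(k := t)))) has_field_derivative d j k) (at (?z k))"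
      using k DERIV_shift[of "\<lambda>t. p j (\<kappa> (?z(k := t)))" "d j k" 0 "?z k"]
      by (simp add: if_distrib[of "\<lambda>z. _ * z"] cong: if_cong)
    then show ?thesis by (rule DERIV_imp_deriv)
  qed
  have "\<forall>k. \<exists>D. k < N \<longrightarrow> ((\<lambda>t. \<iota> (\<gamma> i t) k) has_field_derivative D) (at 0)"
    using polynomials_complex_derivative[OF polynomials_compose[OF \<iota>_polynomial \<gamma>(1)[OF i]]] by blast
  then obtain \<gamma>' where \<gamma>': "\<And>k. k < N \<Longrightarrow> ((\<lambda>t. \<iota> (\<gamma> i t) k) has_field_derivative \<gamma>' k) (at 0)"
    by metis
  have eq: "(\<Sum>k<N. d j k * \<gamma>' k) = (if j = i then e i else 0)" if j: "j < r" for j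
    using d[OF j, of "\<lambda>t. \<iota> (\<gamma> i t)" \<gamma>'] \<gamma>' \<gamma>(2)[OF i] der[OF i j]
    by (intro DERIV_unique[of "\<lambda>t. p j (\<gamma> i t)"]) (simp_all add: \<kappa>_\<iota>)
  \<comment> \<open>Pairing the assumed relation between the rows with the velocity of curve i
    leaves only c i * e i.\<close>
  have "(\<Sum>j<r. c j * (if j = i then e i else 0)) = (\<Sum>j<r. \<Sum>k<N. c j * (d j k * \<gamma>' k))"
    by (simp add: sum_distrib_left flip: eq)
  also have "\<dots> = (\<Sum>k<N. (\<Sum>j<r. c j * d j k) * \<gamma>' k)"
    by (subst sum.swap) (simp add: sum_distrib_right mult.assoc)
  also have "\<dots> = 0"
    using c partial by (intro sum.neutral ballI) simp
  finally show "c i = 0" using e[OF i] i by (simp add: if_distrib[of "\<lambda>z. _ * z"] cong: if_cong)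
qed

section \<open>Two by two matrices\<close>

definition mat2 :: "complex \<Rightarrow> complex \<Rightarrow> complex \<Rightarrow> complex \<Rightarrow> complex^2^2" where
  "mat2 a b c d = vector [vector [a, b], vector [c, d]]"

lemma mat2_nth [simp]:
  "mat2 a b c d $ 1 $ 1 = a" "mat2 a b c d $ 1 $ 2 = b"
  "mat2 a b c d $ 2 $ 1 = c" "mat2 a b c d $ 2 $ 2 = d"
  by (simp_all add: mat2_def)

lemma mat2_eq_iff:
  "(A :: complex^2^2) = B \<longleftrightarrow> A $ 1 $ 1 = B $ 1 $ 1 \<and> A $ 1 $ 2 = B $ 1 $ 2 \<and> A $ 2 $ 1 = B $ 2 $ 1 \<and> A $ 2 $ 2 = B $ 2 $ 2"
  by (auto simp: vec_eq_iff forall_2)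

lemma vec2_eq_iff: "(v :: complex^2) = w \<longleftrightarrow> v $ 1 = w $ 1 \<and> v $ 2 = w $ 2"
  by (auto simp: vec_eq_iff forall_2)

lemma mat2_mult_nth: "((A :: complex^2^2) ** B) $ i $ j = A $ i $ 1 * B $ 1 $ j + A $ i $ 2 * B $ 2 $ j"
  by (simp add: matrix_matrix_mult_def sum_2)

lemma mat2_vec_nth: "((A :: complex^2^2) *v v) $ i = A $ i $ 1 * v $ 1 + A $ i $ 2 * v $ 2"
  by (simp add: matrix_vector_mult_def sum_2)

lemma mat2_one_nth:
  "(mat 1 :: complex^2^2) $ 1 $ 1 = 1" "(mat 1 :: complex^2^2) $ 1 $ 2 = 0"
  "(mat 1 :: complex^2^2) $ 2 $ 1 = 0" "(mat 1 :: complex^2^2) $ 2 $ 2 = 1"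
  by (simp_all add: mat_def)

lemma SL2_iff: "g \<in> SL2 \<longleftrightarrow> g $ 1 $ 1 * g $ 2 $ 2 - g $ 1 $ 2 * g $ 2 $ 1 = 1"
  by (simp add: SL2_def det_2)

lemma one_SL2: "mat 1 \<in> SL2"
  by (simp add: SL2_def)

lemma mult_SL2: "g \<in> SL2 \<Longrightarrow> h \<in> SL2 \<Longrightarrow> g ** h \<in> SL2"
  by (simp add: SL2_def det_mul)

lemma unip_eq: "unip t = mat2 1 t 0 1"
  by (simp add: unip_def mat2_def)

lemma unip_SL2: "unip t \<in> SL2"
  by (simp add: SL2_iff unip_eq)

lemma unip_add: "unip (t + u) = unip t ** unip u"
  by (simp add: mat2_eq_iff unip_eq mat2_mult_nth)

lemma unip_0: "unip 0 = mat 1"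
  by (simp add: mat2_eq_iff unip_eq mat2_one_nth)

text \<open>The adjugate: it is the inverse on \<open>SL2\<close> and, unlike
  \<open>matrix_inv\<close>, polynomial in the entries everywhere.\<close>

definition adj2 :: "complex^2^2 \<Rightarrow> complex^2^2" where
  "adj2 g = mat2 (g $ 2 $ 2) (- g $ 1 $ 2) (- g $ 2 $ 1) (g $ 1 $ 1)"

lemma adj2_SL2: "g \<in> SL2 \<Longrightarrow> adj2 g \<in> SL2"
  by (simp add: SL2_iff adj2_def mult.commute)

lemma adj2_left: "g \<in> SL2 \<Longrightarrow> adj2 g ** g = mat 1"
  and adj2_right: "g \<in> SL2 \<Longrightarrow> g ** adj2 g = mat 1"
  by (auto simp: SL2_iff adj2_def mat2_eq_iff mat2_mult_nth mat2_one_nth mult.commute)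

text \<open>
  The matrix \<open>v v\<^sup>T J\<close>, where \<open>J\<close> has rows \<open>(0, 1)\<close>, \<open>(-1, 0)\<close> and \<open>g\<^sup>T J g = J\<close> for \<open>g\<close> in \<open>SL2\<close>. It is
  nilpotent, conjugate to \<open>E\<close> for \<open>v \<noteq> 0\<close>, and such matrices span the Lie algebra.
\<close>

definition nilp :: "complex^2 \<Rightarrow> complex^2^2" where
  "nilp v = mat2 (- (v $ 1 * v $ 2)) (v $ 1 * v $ 1) (- (v $ 2 * v $ 2)) (v $ 1 * v $ 2)"

text \<open>Conjugation by g, written without inverses: (g v) (g v)^T J g = g v v^T (g^T J g) = g v
  v^T J. In coordinates each entry picks up the factor det g, which is then replaced by 1.\<close>

lemma nilp_conj:
  assumes "g \<in> SL2"
  shows "nilp (g *v v) ** g = g ** nilp v"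
proof -
  define a b c d x y where defs: "a = g $ 1 $ 1" "b = g $ 1 $ 2" "c = g $ 2 $ 1" "d = g $ 2 $ 2"
    "x = v $ 1" "y = v $ 2"
  have det: "a * d - b * c = 1" using assms by (simp add: SL2_iff defs)
  have 1: "- ((a * x + b * y) * (c * x + d * y)) * a + (a * x + b * y) * (a * x + b * y) * c
      = (a * d - b * c) * (a * (- (x * y)) + b * (- (y * y)))" by (simp add: algebra_simps)
  have 2: "- ((a * x + b * y) * (c * x + d * y)) * b + (a * x + b * y) * (a * x + b * y) * d
      = (a * d - b * c) * (a * (x * x) + b * (x * y))" by (simp add: algebra_simps)
  have 3: "- ((c * x + d * y) * (c * x + d * y)) * a + (a * x + b * y) * (c * x + d * y) * c
      = (a * d - b * c) * (c * (- (x * y)) + d * (- (y * y)))" by (simp add: algebra_simps)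
  have 4: "- ((c * x + d * y) * (c * x + d * y)) * b + (a * x + b * y) * (c * x + d * y) * d
      = (a * d - b * c) * (c * (x * x) + d * (x * y))" by (simp add: algebra_simps)
  show ?thesis
    using 1 2 3 4 unfolding det
    by (simp add: mat2_eq_iff mat2_mult_nth mat2_vec_nth nilp_def flip: defs)
qed

definition line :: "complex^2^2 \<Rightarrow> complex \<Rightarrow> complex^2^2" where
  "line X t = mat2 (1 + t * X $ 1 $ 1) (t * X $ 1 $ 2) (t * X $ 2 $ 1) (1 + t * X $ 2 $ 2)"

text \<open>det (I + t X) = 1 + t tr X + t^2 det X, and \<open>nilp v\<close> has trace and
  determinant zero.\<close>

lemma line_nilp_SL2: "line (nilp v) t \<in> SL2"
  by (simp add: SL2_iff line_def nilp_def algebra_simps)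

lemma line_mult:
  assumes "X ** g = g ** Y"
  shows "line X t ** g = g ** line Y t"
proof -
  have 1: "(line X t ** g) $ i $ j = g $ i $ j + t * (X ** g) $ i $ j" for i j
    using exhaust_2[of i] by (auto simp: mat2_mult_nth line_def algebra_simps)
  have 2: "(g ** line Y t) $ i $ j = g $ i $ j + t * (g ** Y) $ i $ j" for i j
    using exhaust_2[of j] by (auto simp: mat2_mult_nth line_def algebra_simps)
  show ?thesis by (simp add: vec_eq_iff 1 2 assms)
qed

lemma line_nilp_e1: "line (nilp (vector [1, 0])) t = unip t"
  by (simp add: mat2_eq_iff line_def nilp_def unip_eq)

section \<open>Polynomial dependence of matrix expressions, and derivatives along lines\<close>

lemma polynomial_map_mat:
  "polynomial_map (M :: _ \<Rightarrow> complex^'n^'m) \<longleftrightarrow> (\<forall>i j. (\<lambda>x. M x $ i $ j) \<in> polynomials)"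
  by (simp add: polynomial_map_vec[of M] polynomial_map_vec[of "\<lambda>x. M x $ _"] polynomial_map_complex)

lemma polynomial_map_cvec:
  "polynomial_map (v :: _ \<Rightarrow> complex^'n) \<longleftrightarrow> (\<forall>i. (\<lambda>x. v x $ i) \<in> polynomials)"
  by (simp add: polynomial_map_vec[of v] polynomial_map_complex)

lemma polynomial_map_matrix_vector:
  fixes M :: "'a::affine_space \<Rightarrow> complex^'n^'m"
  assumes "polynomial_map M" "polynomial_map v"
  shows "polynomial_map (\<lambda>x. M x *v v x)"
  using assms unfolding polynomial_map_mat polynomial_map_cvec matrix_vector_mult_def
  by (auto intro!: polynomials_intros)

lemma polynomial_map_vector_matrix:
  fixes M :: "'a::affine_space \<Rightarrow> complex^'n^'m"
  assumes "polynomial_map M" "polynomial_map v"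
  shows "polynomial_map (\<lambda>x. v x v* M x)"
  using assms unfolding polynomial_map_mat polynomial_map_cvec vector_matrix_mult_def
  by (auto intro!: polynomials_intros)

lemma polynomial_map_mat2:
  "polynomial_map (\<lambda>x. mat2 (a x) (b x) (c x) (d x)) \<longleftrightarrow>
     a \<in> polynomials \<and> b \<in> polynomials \<and> c \<in> polynomials \<and> d \<in> polynomials"
  by (auto simp: polynomial_map_mat forall_2)

lemma polynomial_map_adj2: "polynomial_map M \<Longrightarrow> polynomial_map (\<lambda>x. adj2 (M x))"
  unfolding adj2_def polynomial_map_mat2 unfolding polynomial_map_mat by (simp add: polynomials_intros)

lemma polynomial_mat_nth:
  "polynomial_map (M :: 'a::affine_space \<Rightarrow> complex^'n^'m) \<Longrightarrow> (\<lambda>x. M x $ i $ j) \<in> polynomials"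
  by (simp add: polynomial_map_mat)

lemma zariski_closed_SL2: "zariski_closed SL2"
proof -
  have "zariski_closed {g :: complex^2^2. g $ 1 $ 1 * g $ 2 $ 2 - g $ 1 $ 2 * g $ 2 $ 1 = 1}"
    by (intro zariski_closed_zeros polynomials_intros polynomial_mat_nth polynomial_map_id)
  then show ?thesis by (simp flip: SL2_iff)
qed

lemma polynomial_map_matrix_mult:
  fixes M :: "'a::affine_space \<Rightarrow> complex^'n^'m" and L :: "'a \<Rightarrow> complex^'k^'n"
  assumes "polynomial_map M" "polynomial_map L"
  shows "polynomial_map (\<lambda>x. M x ** L x)"
  using assms unfolding polynomial_map_mat matrix_matrix_mult_def
  by (auto intro!: polynomials_intros)

text \<open>The coefficients d do not depend on X, which is the linearity of the derivative at the
  identity; p is a polynomial on all matrices, so the lines may leave \<open>SL2\<close>.\<close>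

lemma polynomials_line_derivative:
  assumes "p \<in> polynomials"
  shows "\<exists>d. \<forall>X. ((\<lambda>t. p (line X t)) has_field_derivative (\<Sum>i\<in>UNIV. \<Sum>j\<in>UNIV. d i j * X $ i $ j)) (at 0)"
proof -
  have coords: "coords = (\<lambda>ij g :: complex^2^2. g $ fst ij $ snd ij) ` UNIV"
    by (auto simp: coords_vec_def coords_complex_def image_iff) blast+
  have "p \<in> alg_gen ((\<lambda>ij g :: complex^2^2. g $ fst ij $ snd ij) ` UNIV)"
    using assms unfolding polynomials_def coords .
  from alg_gen_chain_rule[OF finite this, of "mat 1"] obtain d where
    d: "\<And>\<gamma> \<gamma>'. \<gamma> 0 = mat 1 \<Longrightarrow> (\<forall>i\<in>UNIV. ((\<lambda>t. \<gamma> t $ fst i $ snd i) has_field_derivative \<gamma>' i) (at 0)) \<Longrightarrow>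
      ((\<lambda>t. p (\<gamma> t)) has_field_derivative (\<Sum>i\<in>UNIV. d i * \<gamma>' i)) (at 0)" by blast
  have "((\<lambda>t. p (line X t)) has_field_derivative (\<Sum>ij\<in>UNIV. d ij * X $ fst ij $ snd ij)) (at 0)" for X
  proof (rule d)
    show "line X 0 = mat 1" by (simp add: mat2_eq_iff line_def mat2_one_nth)
    have "((\<lambda>t. line X t $ i $ j) has_field_derivative X $ i $ j) (at 0)" for i j
      using exhaust_2[of i] exhaust_2[of j] by (auto simp: line_def intro!: derivative_eq_intros)
    then show "\<forall>ij\<in>UNIV. ((\<lambda>t. line X t $ fst ij $ snd ij) has_field_derivative X $ fst ij $ snd ij) (at 0)"
      by simp
  qed
  moreover have "(\<Sum>ij\<in>UNIV. d ij * X $ fst ij $ snd ij) = (\<Sum>i\<in>UNIV. \<Sum>j\<in>UNIV. d (i, j) * X $ i $ j)"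
    for X :: "complex^2^2"
    by (simp add: sum.cartesian_product case_prod_beta)
  ultimately show ?thesis by (intro exI[of _ "\<lambda>i j. d (i, j)"]) simp
qed

section \<open>Mumford stability\<close>

context ga_slice
begin

text \<open>The diagonal action moves the first factor as before, so the old slice function, read on
  that factor, still grows by t.\<close>

lemma ga_slice_induced: "ga_slice (diag_act act) (Z \<times> SL2) (\<lambda>w. s (fst w))"
proof
  show "diag_act act 0 x = x" for x
    by (cases x) (simp add: diag_act_def act_0 unip_0)
  show "diag_act act (t + u) x = diag_act act t (diag_act act u x)" for t u x
  proof (cases x)
    case (Pair y g)
    \<comment> \<open>On the right factor, acting by u and then by t multiplies by
      \<open>unip (- u)\<close> first; commutativity of the additive group reconciles the
      order.\<close>
    have "unip (- (t + u)) = unip (- u) ** unip (- t)" unfolding unip_add[symmetric] by (simp add: add.commute)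
    then show ?thesis using Pair by (simp add: diag_act_def act_add matrix_mul_assoc)
  qed
  have u: "polynomial_map (\<lambda>p :: complex \<times> ('a \<times> (complex^2^2)). unip (- fst p))"
    unfolding unip_eq polynomial_map_mat2
    by (intro conjI polynomials_intros polynomial_map_complex[THEN iffD1] polynomial_map_fst)
  have "polynomial_map (\<lambda>p :: complex \<times> ('a \<times> (complex^2^2)). (act (fst p) (fst (snd p)), snd (snd p) ** unip (- fst p)))"
    by (intro polynomial_map_Pair polynomial_map_act polynomial_map_matrix_mult u
        polynomial_map_fst' polynomial_map_snd' polynomial_map_complex[THEN iffD1] polynomial_map_id)
  then show "polynomial_map (\<lambda>p. diag_act act (fst p) (snd p))"
    by (simp add: diag_act_def case_prod_beta)
  show "zariski_closed (Z \<times> SL2)" by (intro zariski_closed_Times closed zariski_closed_SL2)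
  show "diag_act act t x \<in> Z \<times> SL2" if "x \<in> Z \<times> SL2" for t x
    using that by (auto simp: diag_act_def act_Z mult_SL2 unip_SL2)
  show "(\<lambda>w. s (fst w)) \<in> polynomials" by (rule polynomials_compose[OF s_polynomial polynomial_map_fst])
  show "s (fst (diag_act act t x)) = s (fst x) + t" if "x \<in> Z \<times> SL2" for t x
    using that by (auto simp: diag_act_def s_act)
qed

text \<open>The induced space is affine, so the constant section 1 makes every point semistable. The
  \<open>SL2\<close>-orbit of [p, I] consists of the classes [x, g] with x in the orbit of p, a
  closed condition in terms of \<open>retract\<close>; the slice function forces the stabiliser to
  be trivial.\<close>

theorem mumford_stable_eq: "mumford_stable_locus act (subvariety Z) = Z"
proof -
  interpret I: ga_slice "diag_act act" "Z \<times> SL2" "\<lambda>w. s (fst w)" by (rule ga_slice_induced)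
  let ?E = "induced_space act (subvariety Z)"
  have same: "same_space I.Q ?E"
    unfolding induced_space_def by (rule same_space_orbit_space[OF same_space_prod_subvariety])
  have ptsE: "points ?E = I.\<pi> ` (Z \<times> SL2)"
    using same I.points_Q by (simp add: same_space_def)
  have "affine_variety ?E" by (rule same_space_affine_variety[OF same I.affine_Q])
  then have aff: "affine_variety (open_sub ?E {y \<in> points ?E. (1::complex) \<noteq> 0})"
    by (simp add: open_sub_points)
  have "ringed ?E" by (rule same_space_ringed[OF same I.ringed_Q])
  then have "(\<lambda>_. 1) \<in> Reg ?E (points ?E)" by (rule ringed_const) simp
  then have semi: "O_semistable SL2 induced_act ?E = points ?E"
    unfolding O_semistable_def using aff by (auto intro!: bexI[of _ "\<lambda>_. 1"])
  have act_orb: "induced_act h (I.\<pi> (x, g)) = I.\<pi> (x, h ** g)" for h x g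
    by (auto simp: induced_act_def orb_def diag_act_def image_image matrix_mul_assoc)
  have "I.\<pi> (p, mat 1) \<in> O_stable SL2 induced_act ?E" if p: "p \<in> Z" for p
  proof -
    let ?L = "I.\<pi> (p, mat 1)"
    have orbL: "orb SL2 induced_act ?L = (\<lambda>h. I.\<pi> (p, h)) ` SL2"
      by (simp add: orb_def[of SL2] act_orb)
    have mem: "I.\<pi> (x, g) \<in> orb SL2 induced_act ?L \<longleftrightarrow> retract x = retract p"
      if "x \<in> Z" "g \<in> SL2" for x g
    proof
      assume "I.\<pi> (x, g) \<in> orb SL2 induced_act ?L"
      then obtain h where "I.\<pi> (p, h) = I.\<pi> (x, g)" unfolding orbL by auto
      then have "(x, g) \<in> I.\<pi> (p, h)" by (simp add: I.orb_eq_iff)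
      then have "\<exists>t. x = act t p" by (auto simp: orb_def diag_act_def)
      then show "retract x = retract p" using retract_act[OF p] by auto
    next
      assume "retract x = retract p"
      then have "x \<in> \<pi> p" using orb_eq_iff_retract[OF p] by (simp flip: orb_eq_iff)
      then obtain t where t: "x = act t p" by (auto simp: orb_def)
      have "g ** unip t ** unip (- t) = g"
        by (simp add: unip_0 flip: matrix_mul_assoc unip_add)
      \<comment> \<open>The time moves into the group component: [t p, g] = [p, g u(t)].\<close>
      then have "(x, g) = diag_act act t (p, g ** unip t)" by (simp add: diag_act_def t)
      then have "I.\<pi> (x, g) = I.\<pi> (p, g ** unip t)" by (simp add: I.orb_act)
      then show "I.\<pi> (x, g) \<in> orb SL2 induced_act ?L"
        unfolding orbL using mult_SL2[OF that(2) unip_SL2] by blast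
    qed
    have "closedin (Top I.Q) (orb SL2 induced_act ?L)"
      unfolding closedin_def
    proof
      show "orb SL2 induced_act ?L \<subseteq> points I.Q" unfolding orbL I.points_Q using p by auto
      let ?T = "subvariety (Z \<times> SL2)"
      \<comment> \<open>Pulled back to \<open>Z \<times> SL2\<close>, the complement of the orbit is
        where some coordinate of \<open>retract\<close> differs from its value at p.\<close>
      have "{w \<in> points ?T. I.\<pi> w \<in> points I.Q - orb SL2 induced_act ?L} =
          (\<Union>k\<in>coords. {w \<in> Z \<times> SL2. k (retract (fst w)) - k (retract p) \<noteq> 0})"
      proof (intro set_eqI)
        fix w :: "'a \<times> (complex^2^2)"
        have "retract (fst w) \<noteq> retract p \<longleftrightarrow> (\<exists>k\<in>coords. k (retract (fst w)) - k (retract p) \<noteq> 0)"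
          using affine_space_eqI[of "retract (fst w)" "retract p"] by auto
        then show "w \<in> {w \<in> points ?T. I.\<pi> w \<in> points I.Q - orb SL2 induced_act ?L} \<longleftrightarrow>
            w \<in> (\<Union>k\<in>coords. {w \<in> Z \<times> SL2. k (retract (fst w)) - k (retract p) \<noteq> 0})"
          using mem[of "fst w" "snd w"] by (auto simp: I.points_Q)
      qed
      moreover have "openin (Top ?T) {w \<in> Z \<times> SL2. k (retract (fst w)) - k (retract p) \<noteq> 0}"
        if "k \<in> coords" for k
      proof (rule ringed_open_nonzero[OF ringed_subvariety])
        show "openin (Top ?T) (Z \<times> SL2)" using openin_topspace[of "Top ?T"] by simp
        show "(\<lambda>w. k (retract (fst w)) - k (retract p)) \<in> Reg ?T (Z \<times> SL2)"
          by (intro Reg_subvarietyI polynomials_intros polynomials_compose[OF coords_polynomials[OF that]]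
              polynomial_map_compose[OF polynomial_map_retract] polynomial_map_fst)
      qed
      ultimately show "openin (Top I.Q) (points I.Q - orb SL2 induced_act ?L)"
        unfolding openin_orbit_space by (auto simp: I.points_Q)
    qed
    then have "closedin (subtopology (Top ?E) (points ?E)) (orb SL2 induced_act ?L)"
      using same by (simp add: same_space_def)
    moreover have "{g \<in> SL2. induced_act g ?L = ?L} \<subseteq> {mat 1}"
    proof
      fix g assume "g \<in> {g \<in> SL2. induced_act g ?L = ?L}"
      then have "(p, g) \<in> I.\<pi> (p, mat 1)" by (simp add: act_orb flip: I.orb_eq_iff)
      then obtain t where t: "p = act t p" "g = unip (- t)" by (auto simp: orb_def diag_act_def)
      then have "t = 0" using s_act[OF p, of t] by simp
      then show "g \<in> {mat 1}" using t(2) by (simp add: unip_0)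
    qed
    moreover have "?L \<in> points ?E" unfolding ptsE using p one_SL2 by auto
    ultimately show ?thesis
      unfolding O_stable_def stable_point_def semi using finite_subset by blast
  qed
  then show ?thesis unfolding mumford_stable_locus_def by auto
qed

end

section \<open>The moment map of the special linear group\<close>

lemma dot_vector_matrix:
  fixes \<alpha> :: "complex^'n" and A :: "complex^'m^'n"
  shows "(\<Sum>i\<in>UNIV. (\<alpha> v* A) $ i * y $ i) = (\<Sum>i\<in>UNIV. \<alpha> $ i * (A *v y) $ i)"
proof -
  have "(\<Sum>i\<in>UNIV. (\<alpha> v* A) $ i * y $ i) = (\<Sum>i\<in>UNIV. \<Sum>j\<in>UNIV. \<alpha> $ j * A $ j $ i * y $ i)"
    by (simp add: vector_matrix_mult_def sum_distrib_right)
  also have "\<dots> = (\<Sum>j\<in>UNIV. \<Sum>i\<in>UNIV. \<alpha> $ j * A $ j $ i * y $ i)" by (rule sum.swap)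
  finally show ?thesis by (simp add: matrix_vector_mult_def sum_distrib_left mult_ac)
qed

lemma matrix_inv_eq:
  fixes A :: "complex^'n^'n"
  assumes "A ** B = mat 1" "B ** A = mat 1"
  shows "matrix_inv A = B"
proof -
  have "\<exists>A'. A ** A' = mat 1 \<and> A' ** A = mat 1" using assms by blast
  then have "A ** matrix_inv A = mat 1 \<and> matrix_inv A ** A = mat 1"
    unfolding matrix_inv_def by (rule someI_ex)
  then have "matrix_inv A = matrix_inv A ** (A ** B)" "matrix_inv A ** A = mat 1"
    using assms by (simp_all add: matrix_mul_rid)
  then show ?thesis by (metis matrix_mul_assoc matrix_mul_lid)
qed

locale sl2_rep =
  fixes \<rho> :: "complex^2^2 \<Rightarrow> complex^'n^'n"
  assumes rep: "SL2_representation \<rho>"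
begin

lemma rho_one: "\<rho> (mat 1) = mat 1"
  and rho_mult: "g \<in> SL2 \<Longrightarrow> h \<in> SL2 \<Longrightarrow> \<rho> (g ** h) = \<rho> g ** \<rho> h"
  using rep by (auto simp: SL2_representation_def)

text \<open>
  Nothing is assumed about \<open>\<rho>\<close> outside \<open>SL2\<close>; the polynomial extension allows differentiating along
  lines that leave \<open>SL2\<close>, so that the derivative at the identity is linear.
\<close>

definition ext :: "complex^2^2 \<Rightarrow> complex^'n^'n" where
  "ext g = (\<chi> i j. (SOME p. p \<in> polynomials \<and> (\<forall>g\<in>SL2. \<rho> g $ i $ j = p g)) g)"

lemma ext_spec: "(\<lambda>g. ext g $ i $ j) \<in> polynomials \<and> (\<forall>g\<in>SL2. \<rho> g $ i $ j = ext g $ i $ j)"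
proof -
  have "\<exists>p. p \<in> polynomials \<and> (\<forall>g\<in>SL2. \<rho> g $ i $ j = p g)"
    using rep unfolding SL2_representation_def by blast
  then show ?thesis unfolding ext_def vec_lambda_beta by (rule someI_ex)
qed

lemma polynomial_map_ext: "polynomial_map \<phi> \<Longrightarrow> polynomial_map (\<lambda>x. ext (\<phi> x))"
  unfolding polynomial_map_mat[of "\<lambda>x. ext (\<phi> x)"]
  using polynomials_compose[of "\<lambda>g. ext g $ _ $ _" \<phi>] ext_spec by blast

lemma ext_eq: "g \<in> SL2 \<Longrightarrow> ext g = \<rho> g"
  using ext_spec by (simp add: vec_eq_iff)

definition drho :: "complex^2^2 \<Rightarrow> complex^'n^'n" where
  "drho X = (\<chi> i j. deriv (\<lambda>t. ext (line X t) $ i $ j) 0)"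

lemma drho_linear:
  "\<exists>d. \<forall>X. ((\<lambda>t. ext (line X t) $ i $ j) has_field_derivative drho X $ i $ j) (at 0) \<and>
      drho X $ i $ j = (\<Sum>k\<in>UNIV. \<Sum>l\<in>UNIV. d k l * X $ k $ l)"
proof -
  have "(\<lambda>g. ext g $ i $ j) \<in> polynomials" using ext_spec by blast
  from polynomials_line_derivative[OF this] obtain d where
    d: "\<And>X. ((\<lambda>t. ext (line X t) $ i $ j) has_field_derivative (\<Sum>k\<in>UNIV. \<Sum>l\<in>UNIV. d k l * X $ k $ l)) (at 0)"
    by blast
  have "drho X $ i $ j = (\<Sum>k\<in>UNIV. \<Sum>l\<in>UNIV. d k l * X $ k $ l)" for X
    using DERIV_imp_deriv[OF d] by (simp add: drho_def)
  then show ?thesis using d by (intro exI[of _ d]) simp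
qed

lemma drho_derivative: "((\<lambda>t. ext (line X t) $ i $ j) has_field_derivative drho X $ i $ j) (at 0)"
  using drho_linear by blast

text \<open>Differentiate the identity \<rho>(l') \<rho>(g) = \<rho>(g) \<rho>(l) at t = 0, for the
  lines l and l' in the directions \<open>nilp v\<close> and \<open>nilp (g *v v)\<close>. Both
  lines lie in \<open>SL2\<close>, where \<open>ext\<close> is \<rho> and hence
  multiplicative.\<close>

lemma drho_conj:
  assumes g: "g \<in> SL2"
  shows "drho (nilp (g *v v)) ** \<rho> g = \<rho> g ** drho (nilp v)"
proof -
  have eq: "ext (line (nilp (g *v v)) t) ** \<rho> g = \<rho> g ** ext (line (nilp v) t)" for t
    unfolding ext_eq[OF line_nilp_SL2] rho_mult[OF line_nilp_SL2 g, symmetric]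
      rho_mult[OF g line_nilp_SL2, symmetric] line_mult[OF nilp_conj[OF g]] ..
  have "(drho (nilp (g *v v)) ** \<rho> g) $ i $ j = (\<rho> g ** drho (nilp v)) $ i $ j" for i j
  proof -
    have "((\<lambda>t. (ext (line (nilp (g *v v)) t) ** \<rho> g) $ i $ j) has_field_derivative
        (drho (nilp (g *v v)) ** \<rho> g) $ i $ j) (at 0)"
      unfolding matrix_matrix_mult_def by (auto intro!: DERIV_sum DERIV_cmult_right drho_derivative)
    moreover have "((\<lambda>t. (\<rho> g ** ext (line (nilp v) t)) $ i $ j) has_field_derivative
        (\<rho> g ** drho (nilp v)) $ i $ j) (at 0)"
      unfolding matrix_matrix_mult_def by (auto intro!: DERIV_sum DERIV_cmult drho_derivative)
    ultimately show ?thesis unfolding eq by (rule DERIV_unique)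
  qed
  then show ?thesis by (simp add: vec_eq_iff)
qed

text \<open>The component along X of the moment map of the full group \<open>SL2\<close>.\<close>

definition pair :: "complex^2^2 \<Rightarrow> (complex^'n) \<times> (complex^'n) \<Rightarrow> complex" where
  "pair X y = (\<Sum>i\<in>UNIV. snd y $ i * (drho X *v fst y) $ i)"

text \<open>The components on \<open>E\<close>, \<open>h\<close> and \<open>-F\<close> for the standard basis \<open>E, h, F\<close> of the Lie algebra.\<close>

abbreviation mu :: "(complex^'n) \<times> (complex^'n) \<Rightarrow> complex" where
  "mu \<equiv> pair (nilp (vector [1, 0]))"
abbreviation eta :: "(complex^'n) \<times> (complex^'n) \<Rightarrow> complex" where
  "eta \<equiv> pair (mat2 1 0 0 (- 1))"
abbreviation nu :: "(complex^'n) \<times> (complex^'n) \<Rightarrow> complex" where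
  "nu \<equiv> pair (nilp (vector [0, 1]))"

lemma pair_polynomial: "pair X \<in> polynomials"
proof -
  have "polynomial_map (\<lambda>y :: (complex^'n) \<times> (complex^'n). drho X *v fst y)"
    by (intro polynomial_map_matrix_vector polynomial_map_intros)
  moreover have "polynomial_map (\<lambda>y :: (complex^'n) \<times> (complex^'n). snd y)"
    by (intro polynomial_map_intros)
  ultimately show ?thesis
    unfolding pair_def polynomial_map_cvec by (intro polynomials_intros) auto
qed

text \<open>For v = (a, b) one has nilp v = a^2 E - a b h - b^2 F, and \<open>drho\<close> is
  linear.\<close>

lemma pair_nilp:
  "pair (nilp v) y = mu y * (v $ 1)\<^sup>2 - eta y * v $ 1 * v $ 2 + nu y * (v $ 2)\<^sup>2"
proof -
  have "drho (nilp v) $ i $ j = drho (nilp (vector [1, 0])) $ i $ j * (v $ 1)\<^sup>2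
      - drho (mat2 1 0 0 (- 1)) $ i $ j * v $ 1 * v $ 2 + drho (nilp (vector [0, 1])) $ i $ j * (v $ 2)\<^sup>2" for i j
  proof -
    obtain d where "\<And>X. drho X $ i $ j = (\<Sum>k\<in>UNIV. \<Sum>l\<in>UNIV. d k l * X $ k $ l)"
      using drho_linear by blast
    then show ?thesis by (simp add: sum_2 nilp_def power2_eq_square algebra_simps)
  qed
  then show ?thesis
    unfolding pair_def
    by (simp add: matrix_vector_mult_def sum_distrib_left sum_distrib_right left_diff_distrib
        right_diff_distrib distrib_left distrib_right sum.distrib sum_subtractf mult_ac)
qed

lemma mu_eq: "moment_map \<rho> = mu"
proof -
  have "drho_E \<rho> = drho (nilp (vector [1, 0]))"
    by (simp add: drho_E_def drho_def line_nilp_e1 ext_eq unip_SL2)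
  then show ?thesis by (auto simp: moment_map_def pair_def fun_eq_iff)
qed

text \<open>A stand-in for \<open>cotangent_lift (\<rho> g)\<close> that agrees with it on
  \<open>SL2\<close> and is polynomial in g, since \<open>ext\<close> and \<open>adj2\<close>
  are.\<close>

definition cot :: "complex^2^2 \<Rightarrow> (complex^'n) \<times> (complex^'n) \<Rightarrow> (complex^'n) \<times> (complex^'n)" where
  "cot g y = (ext g *v fst y, snd y v* ext (adj2 g))"

lemma rho_adj2:
  assumes "g \<in> SL2"
  shows "\<rho> g ** \<rho> (adj2 g) = mat 1" "\<rho> (adj2 g) ** \<rho> g = mat 1"
  using rho_mult[OF assms adj2_SL2[OF assms]] rho_mult[OF adj2_SL2[OF assms] assms] assms
  by (simp_all add: adj2_left adj2_right rho_one)

lemma cotangent_lift_eq: "g \<in> SL2 \<Longrightarrow> cotangent_lift (\<rho> g) = cot g"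
  using matrix_inv_eq[OF rho_adj2[of g]]
  by (auto simp: cotangent_lift_def cot_def ext_eq adj2_SL2 fun_eq_iff)

lemma adj2_mult: "adj2 (g ** h) = adj2 h ** adj2 g"
  by (simp add: mat2_eq_iff mat2_mult_nth adj2_def algebra_simps)

lemma cot_mult:
  assumes "g \<in> SL2" "h \<in> SL2"
  shows "cot (g ** h) y = cot g (cot h y)"
  using assms unfolding cot_def
  by (simp add: ext_eq mult_SL2 adj2_SL2 rho_mult adj2_mult matrix_vector_mul_assoc vector_matrix_mul_assoc)

lemma cot_one: "cot (mat 1) y = y"
proof -
  have "adj2 (mat 1) = mat 1" by (simp add: adj2_def mat2_eq_iff mat2_one_nth)
  then show ?thesis by (simp add: cot_def ext_eq one_SL2 rho_one vector_matrix_mul_rid)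
qed

lemma cot_adj2: "g \<in> SL2 \<Longrightarrow> cot (adj2 g) (cot g y) = y" "g \<in> SL2 \<Longrightarrow> cot g (cot (adj2 g) y) = y"
  by (simp_all flip: cot_mult add: adj2_SL2 adj2_left adj2_right cot_one)

lemma polynomial_map_cot:
  "polynomial_map \<phi> \<Longrightarrow> polynomial_map \<psi> \<Longrightarrow> polynomial_map (\<lambda>x. cot (\<phi> x) (\<psi> x))"
  unfolding cot_def
  by (intro polynomial_map_Pair polynomial_map_matrix_vector polynomial_map_vector_matrix
      polynomial_map_ext polynomial_map_adj2 polynomial_map_fst' polynomial_map_snd')

text \<open>Moving y by g conjugates the operator in the pairing by \<rho> g, and
  \<open>drho_conj\<close> undoes this. For the form q_y of the overview it says that q at g y and g
  v equals q at y and v.\<close>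

lemma pair_cot:
  assumes g: "g \<in> SL2"
  shows "pair (nilp (g *v v)) (cot g y) = pair (nilp v) y"
proof -
  have "pair (nilp (g *v v)) (cot g y) =
      (\<Sum>i\<in>UNIV. snd y $ i * (\<rho> (adj2 g) *v (drho (nilp (g *v v)) *v (\<rho> g *v fst y))) $ i)"
    using g by (simp add: pair_def cot_def ext_eq adj2_SL2 dot_vector_matrix)
  also have "\<rho> (adj2 g) *v (drho (nilp (g *v v)) *v (\<rho> g *v fst y))
      = (\<rho> (adj2 g) ** (\<rho> g ** drho (nilp v))) *v fst y"
    unfolding drho_conj[OF g, symmetric] by (simp add: matrix_vector_mul_assoc matrix_mul_assoc)
  also have "\<rho> (adj2 g) ** (\<rho> g ** drho (nilp v)) = drho (nilp v)"
    by (simp add: matrix_mul_assoc rho_adj2[OF g] matrix_mul_lid)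
  finally show ?thesis by (simp add: pair_def)
qed

lemma mu_unip: "mu (cot (unip t) y) = mu y"
proof -
  have "unip t *v vector [1, 0] = vector [1, 0]"
    by (simp add: vec2_eq_iff mat2_vec_nth unip_eq)
  then show ?thesis using pair_cot[OF unip_SL2, of t "vector [1, 0]" y] by simp
qed

text \<open>Invariance of the quadratic form at (0, 1) and (1, 1), which u(t) sends to (t, 1) and (1
  + t, 1), determines the new mixed coefficient.\<close>

lemma eta_unip: "eta (cot (unip t) y) = eta y + 2 * t * mu y"
proof -
  define m e e' n n' where defs: "m = mu y" "e = eta y" "e' = eta (cot (unip t) y)" "n = nu y"
    "n' = nu (cot (unip t) y)"
  have 1: "m * t\<^sup>2 - e' * t + n' = n"
    using pair_cot[OF unip_SL2, of t "vector [0, 1]" y]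
    unfolding pair_nilp[of "unip t *v vector [0, 1]"] mu_unip
    by (simp add: mat2_vec_nth unip_eq defs)
  have 2: "m * (1 + t)\<^sup>2 - e' * (1 + t) + n' = m - e + n"
    using pair_cot[OF unip_SL2, of t "vector [1, 1]" y]
    unfolding pair_nilp[of "unip t *v vector [1, 1]"] pair_nilp[of "vector [1, 1]"] mu_unip
    by (simp add: mat2_vec_nth unip_eq defs)
  \<comment> \<open>Subtracting cancels the unknown n': m (1 + 2 t) - e' = m - e.\<close>
  have "e' = e + 2 * t * m"
    using arg_cong2[OF 1 2, of "\<lambda>a b. b - a"] by (simp add: power2_eq_square algebra_simps)
  then show ?thesis by (simp add: defs)
qed

end

section \<open>Homogeneous polynomials and projective space\<close>

lemma homogeneous_cscale: "F \<in> homogeneous m \<Longrightarrow> F (cscale c w) = c ^ m * F w"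
  by (simp only: homogeneous_def mem_Collect_eq)

lemma homogenize:
  fixes p :: "'a::affine_space \<Rightarrow> complex"
  assumes "p \<in> polynomials"
  shows "\<exists>m. \<exists>F\<in>homogeneous m. \<forall>w. F (1::complex, w) = p w"
  using assms[unfolded polynomials_def]
proof induction
  case (const c)
  show ?case
    by (intro exI[of _ 0] bexI[of _ "\<lambda>_. c"]) (auto simp: homogeneous_def intro: polynomials_intros)
next
  case (gen k)
  have "(\<lambda>q :: complex \<times> 'a. k (snd q)) \<in> polynomials"
    by (intro polynomials_compose[OF coords_polynomials[OF gen]] polynomial_map_snd)
  then show ?case
    by (intro exI[of _ 1] bexI[of _ "\<lambda>q. k (snd q)"])
       (auto simp: homogeneous_def cscale_prod_def coords_cscale[OF gen])
next
  case (add f g)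
  then obtain k l F G where F: "F \<in> homogeneous k" "\<And>w. F (1::complex, w) = f w"
    and G: "G \<in> homogeneous l" "\<And>w. G (1::complex, w) = g w" by blast
  have "fst \<in> (polynomials :: (complex \<times> 'a \<Rightarrow> complex) set)"
    using polynomial_map_fst polynomial_map_complex by blast
  \<comment> \<open>Crossed powers of the extra coordinate bring both summands to degree k + l and
    are invisible where that coordinate is 1.\<close>
  then have "(\<lambda>q. fst q ^ l * F q + fst q ^ k * G q) \<in> polynomials"
    using F(1) G(1) by (intro polynomials_intros) (simp_all add: homogeneous_def)
  then have "(\<lambda>q. fst q ^ l * F q + fst q ^ k * G q) \<in> homogeneous (k + l)"
    using F(1) G(1) by (auto simp: homogeneous_def cscale_prod_def cscale_complex_def power_add
        power_mult_distrib distrib_left mult_ac)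
  then show ?case
    by (intro exI[of _ "k + l"] bexI[of _ "\<lambda>q. fst q ^ l * F q + fst q ^ k * G q"]) (auto simp: F(2) G(2))
next
  case (mult f g)
  then obtain k l F G where F: "F \<in> homogeneous k" "\<And>w. F (1::complex, w) = f w"
    and G: "G \<in> homogeneous l" "\<And>w. G (1::complex, w) = g w" by blast
  have "(\<lambda>q. F q * G q) \<in> homogeneous (k + l)"
    using F(1) G(1) by (auto simp: homogeneous_def power_add mult_ac intro: polynomials_intros)
  then show ?case by (intro exI[of _ "k + l"] bexI[of _ "\<lambda>q. F q * G q"]) (auto simp: F(2) G(2))
qed

lemma cscale_1: "cscale 1 x = x"
  by (rule affine_space_eqI) (simp add: coords_cscale)

lemma cscale_cscale: "cscale a (cscale b x) = cscale (a * b) x"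
  by (rule affine_space_eqI) (simp add: coords_cscale mult.assoc)

lemma proj_pt_image: "proj_pt w = (\<lambda>c. cscale c w) ` {c. c \<noteq> 0}"
  by (auto simp: proj_pt_def)

lemma proj_pt_cscale: "c \<noteq> 0 \<Longrightarrow> proj_pt (cscale c w) = proj_pt w"
proof (intro equalityI subsetI)
  assume c: "c \<noteq> 0"
  fix x
  assume "x \<in> proj_pt (cscale c w)"
  then show "x \<in> proj_pt w" using c unfolding proj_pt_def by (auto simp: cscale_cscale)
next
  assume c: "c \<noteq> 0"
  fix x assume "x \<in> proj_pt w"
  then obtain b where b: "b \<noteq> 0" "x = cscale b w" by (auto simp: proj_pt_def)
  then have "x = cscale (b / c) (cscale c w)" using c by (simp add: cscale_cscale)
  then show "x \<in> proj_pt (cscale c w)" using b c unfolding proj_pt_def by (auto intro!: exI[of _ "b / c"])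
qed

lemma proj_pt_eqD:
  assumes "proj_pt w = proj_pt w'"
  obtains c where "c \<noteq> 0" "w' = cscale c w"
proof -
  have "w' \<in> proj_pt w'" unfolding proj_pt_def using cscale_1[of w'] by (auto intro!: exI[of _ 1])
  then show ?thesis using that assms unfolding proj_pt_def by blast
qed

lemma cscale_complex_vec: "cscale c (x :: complex^'k) = (\<chi> i. c * x $ i)"
  by (simp add: cscale_vec_def cscale_complex_def)

lemma matrix_vector_cscale: "M *v cscale c x = cscale c (M *v x)" for M :: "complex^'k^'m"
  by (simp add: cscale_complex_vec vec_eq_iff matrix_vector_mult_def sum_distrib_left mult_ac)

lemma vector_matrix_cscale: "cscale c x v* M = cscale c (x v* M)" for M :: "complex^'k^'m"
  by (simp add: cscale_complex_vec vec_eq_iff vector_matrix_mult_def sum_distrib_left mult_ac)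

lemma nonzero_1: "nonzero (1::complex, w :: 'a::affine_space)"
proof -
  have "(fst :: complex \<times> 'a \<Rightarrow> complex) \<in> coords"
    by (simp add: coords_prod_def coords_complex_def comp_def)
  then show ?thesis unfolding nonzero_def by (intro bexI[of _ fst]) auto
qed

lemma fst_homogeneous: "fst \<in> homogeneous 1"
  using polynomial_map_fst polynomial_map_complex
  by (auto simp: homogeneous_def cscale_prod_def cscale_complex_def)

section \<open>Level sets of the moment map\<close>

text \<open>Carries polynomial identities obtained after division by w over to w = 0.\<close>

lemma isCont_punctured_eq:
  fixes f g :: "complex \<Rightarrow> complex"
  assumes "isCont f 0" "isCont g 0" "\<And>w. w \<noteq> 0 \<Longrightarrow> f w = g w"
  shows "f w = g w"
proof (cases "w = 0")
  case True
  have "f \<midarrow>0\<rightarrow> f 0" "g \<midarrow>0\<rightarrow> g 0" using assms by (auto simp: isCont_def)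
  moreover have "g \<midarrow>0\<rightarrow> f 0 \<longleftrightarrow> f \<midarrow>0\<rightarrow> f 0" by (rule LIM_equal) (simp add: assms(3))
  ultimately show ?thesis using LIM_unique True by blast
qed (rule assms(3))

text \<open>With k large enough, w^k clears the denominators created by u / w, and the result is a
  polynomial that makes sense at w = 0 too.\<close>

lemma polynomials_homogenize_fst:
  fixes P :: "complex \<times> 'a::affine_space \<Rightarrow> complex"
  assumes "P \<in> polynomials"
  shows "\<exists>k. \<exists>G\<in>polynomials. \<forall>u w x. w \<noteq> 0 \<longrightarrow> G (u, w, x) = w ^ k * P (u / w, x)"
  using assms[unfolded polynomials_def]
proof induction
  case (const c)
  show ?case by (intro exI[of _ 0] bexI[of _ "\<lambda>_. c"]) (auto intro: polynomials_intros)
next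
  case (gen k)
  then consider "k = fst" | l where "l \<in> coords" "k = (\<lambda>p. l (snd p))"
    by (auto simp: coords_prod_def coords_complex_def comp_def)
  then show ?case
  proof cases
    case 1
    have "fst \<in> (polynomials :: (complex \<times> complex \<times> 'a \<Rightarrow> complex) set)"
      using polynomial_map_fst polynomial_map_complex by blast
    then show ?thesis using 1 by (intro exI[of _ 1] bexI[of _ fst]) auto
  next
    case 2
    have "(\<lambda>q :: complex \<times> complex \<times> 'a. l (snd (snd q))) \<in> polynomials"
      by (intro polynomials_compose[OF coords_polynomials[OF 2(1)]] polynomial_map_snd' polynomial_map_snd)
    then show ?thesis using 2(2)
      by (intro exI[of _ 0] bexI[of _ "\<lambda>q. l (snd (snd q))"]) auto
  qed
next
  case (add f g)
  then obtain k l F G where F: "F \<in> polynomials" "\<And>u w x. w \<noteq> 0 \<Longrightarrow> F (u, w, x) = w ^ k * f (u / w, x)"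
    and G: "G \<in> polynomials" "\<And>u w x. w \<noteq> 0 \<Longrightarrow> G (u, w, x) = w ^ l * g (u / w, x)" by blast
  have "(\<lambda>q :: complex \<times> complex \<times> 'a. fst (snd q)) \<in> polynomials"
    using polynomial_map_fst'[OF polynomial_map_snd] polynomial_map_complex by blast
  then have "(\<lambda>q. fst (snd q) ^ l * F q + fst (snd q) ^ k * G q) \<in> polynomials"
    by (intro polynomials_intros F(1) G(1))
  then show ?case
    by (intro exI[of _ "k + l"] bexI[of _ "\<lambda>q. fst (snd q) ^ l * F q + fst (snd q) ^ k * G q"])
       (auto simp: F(2) G(2) power_add algebra_simps)
next
  case (mult f g)
  then obtain k l F G where F: "F \<in> polynomials" "\<And>u w x. w \<noteq> 0 \<Longrightarrow> F (u, w, x) = w ^ k * f (u / w, x)"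
    and G: "G \<in> polynomials" "\<And>u w x. w \<noteq> 0 \<Longrightarrow> G (u, w, x) = w ^ l * g (u / w, x)" by blast
  have "(\<lambda>q. F q * G q) \<in> polynomials" by (intro polynomials_intros F(1) G(1))
  then show ?case
    by (intro exI[of _ "k + l"] bexI[of _ "\<lambda>q. F q * G q"]) (auto simp: F(2) G(2) power_add)
qed

locale moment_level = sl2_rep \<rho> for \<rho> :: "complex^2^2 \<Rightarrow> complex^'n^'n" +
  fixes \<xi> :: complex
  assumes xi: "\<xi> \<noteq> 0"
begin

abbreviation H :: "((complex^'n) \<times> (complex^'n)) set" where
  "H \<equiv> level_set \<rho> \<xi>"

definition act :: "complex \<Rightarrow> (complex^'n) \<times> (complex^'n) \<Rightarrow> (complex^'n) \<times> (complex^'n)" where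
  "act t = cot (unip t)"

definition slice_fun :: "(complex^'n) \<times> (complex^'n) \<Rightarrow> complex" where
  "slice_fun y = eta y / (2 * \<xi>)"

lemma H_iff: "y \<in> H \<longleftrightarrow> mu y = \<xi>"
  by (simp add: level_set_def mu_eq)

lemma polynomial_map_unip: "t \<in> polynomials \<Longrightarrow> polynomial_map (\<lambda>x. unip (t x))"
  unfolding unip_eq polynomial_map_mat2 by (simp add: polynomials_intros)

sublocale ga_slice act H slice_fun
proof
  show "act 0 x = x" for x by (simp add: act_def unip_0 cot_one)
  show "act (t + u) x = act t (act u x)" for t u x by (simp add: act_def unip_add cot_mult unip_SL2)
  show "polynomial_map (\<lambda>p. act (fst p) (snd p))"
    unfolding act_def
    by (intro polynomial_map_cot polynomial_map_unip polynomial_map_snd polynomial_map_complex[THEN iffD1]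
        polynomial_map_fst)
  show "zariski_closed H"
    unfolding level_set_def mu_eq by (intro zariski_closed_zeros pair_polynomial)
  show "act t x \<in> H" if "x \<in> H" for t x using that by (simp add: H_iff act_def mu_unip)
  show "slice_fun \<in> polynomials"
    unfolding slice_fun_def by (intro polynomials_intros pair_polynomial)
  show "slice_fun (act t x) = slice_fun x + t" if "x \<in> H" for t x
    using that xi by (simp add: H_iff act_def slice_fun_def eta_unip field_simps)
qed

subsection \<open>Extension of invariants\<close>

text \<open>
  For an invariant \<open>f\<close> on the level set, \<open>f\<close> evaluated at the point of the orbit of \<open>y\<close> with parameter
  \<open>-\<eta>(y) / (2 \<mu>(y))\<close> is an invariant rational function whose denominator is a power of the invariant \<open>\<mu>\<close>.
\<close>

theorem invariant_extension:
  assumes f: "f \<in> invariant_ring UNIV act H"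
  shows "\<exists>F\<in>invariant_ring UNIV act UNIV. f = restrict F H"
proof -
  obtain p where p: "p \<in> polynomials" "f = pullback p"
    using f unfolding invariant_ring_eq by blast
  have "(\<lambda>q. p (act (fst q) (snd q))) \<in> polynomials"
    by (rule polynomials_compose[OF p(1) act_polynomial])
  from polynomials_homogenize_fst[OF this] obtain k G where G1: "G \<in> polynomials"
    "\<forall>u w x. w \<noteq> 0 \<longrightarrow> G (u, w, x) = w ^ k * p (act (fst (u / w, x)) (snd (u / w, x)))" by blast
  then have G: "G \<in> polynomials" "\<And>u w x. w \<noteq> 0 \<Longrightarrow> G (u, w, x) = w ^ k * p (act (u / w) x)"
    using G1(2)[rule_format] by (auto simp only: fst_conv snd_conv)
  have poly_w: "polynomial_map (\<lambda>w :: complex. (u w, w, x))" if "u \<in> polynomials"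
    for u :: "complex \<Rightarrow> complex" and x :: "(complex^'n) \<times> (complex^'n)"
    by (intro polynomial_map_Pair polynomial_map_id polynomial_map_const polynomial_map_complex[THEN iffD2] that)
  have cont: "isCont q w" if "q \<in> polynomials" for q :: "complex \<Rightarrow> complex" and w
    using polynomials_complex_derivative[OF that] DERIV_isCont by blast
  \<comment> \<open>Acting by t adds t to the time u / w, hence t w to u. Continuity extends this to
    w = 0, the value needed where mu vanishes.\<close>
  have shift: "G (u, w, act t x) = G (u + t * w, w, x)" for u w t x
  proof (rule isCont_punctured_eq[of "\<lambda>w. G (u, w, act t x)" "\<lambda>w. G (u + t * w, w, x)"])
    have id: "(\<lambda>w. w) \<in> polynomials" using polynomial_map_id polynomial_map_complex by blast
    show "isCont (\<lambda>w. G (u, w, act t x)) 0"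
      by (intro cont polynomials_compose[OF G(1)] poly_w polynomials_intros)
    show "isCont (\<lambda>w. G (u + t * w, w, x)) 0"
      by (intro cont polynomials_compose[OF G(1)] poly_w polynomials_intros id)
    fix w :: complex assume w: "w \<noteq> 0"
    then have "(u + t * w) / w = u / w + t" by (simp add: field_simps)
    then show "G (u, w, act t x) = G (u + t * w, w, x)" using w by (simp add: G(2) act_add)
  qed
  \<comment> \<open>u = - eta / 2 and w = mu make u / w the time that brings y to eta = 0; under t,
    the change - t mu of u cancels the t w of \<open>shift\<close>. On the level set w^k is the
    constant \<xi>^k, which is divided out.\<close>
  define F where "F y = G (- eta y / 2, mu y, y) / \<xi> ^ k" for y
  have "F \<in> polynomials"
    unfolding F_def
    by (intro polynomials_intros polynomials_compose[OF G(1)] polynomial_map_Pair polynomial_map_id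
        polynomial_map_complex[THEN iffD2] pair_polynomial)
  then have "restrict F UNIV \<in> coord_ring UNIV" unfolding coord_ring_def by (rule imageI)
  then have "F \<in> coord_ring UNIV" by (simp add: restrict_def)
  moreover have "F (act t y) = F y" for t y
    by (simp add: F_def shift) (simp add: act_def mu_unip eta_unip field_simps)
  ultimately have "F \<in> invariant_ring UNIV act UNIV" by (simp add: invariant_ring_def)
  moreover have "F y = p (retract y)" if "y \<in> H" for y
    using that xi by (simp add: F_def H_iff G(2) retract_def slice_fun_def)
  then have "f = restrict F H" unfolding p(2) pullback_def by auto
  ultimately show ?thesis by blast
qed

subsection \<open>Smoothness\<close>

text \<open>Q is the slice, with equations mu - \<xi> and the slice function. Two curves through a
  slice point decouple them: scaling the column vector by 1 + t moves mu with speed \<xi> and keeps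
  eta = 0; the orbit keeps mu and moves the slice function with speed 1.\<close>

theorem smooth_Q: "smooth_variety Q"
  unfolding smooth_variety_def
proof (intro conjI ballI)
  show "variety Q" by (rule affine_variety_imp_variety[OF affine_Q])
  fix q assume q: "q \<in> points Q"
  let ?x = "section_map q"
  obtain N and \<iota> :: "(complex^'n) \<times> (complex^'n) \<Rightarrow> nat \<Rightarrow> complex" and \<kappa> where "coord_enumeration N \<iota> \<kappa>"
    by (rule coord_enumeration_exists)
  then interpret coord_enumeration N \<iota> \<kappa> .
  define p where "p i = (if i = 0 then (\<lambda>y. mu y - \<xi>) else slice_fun)" for i :: nat
  have p: "p i \<in> polynomials" for i
    by (auto simp: p_def intro!: polynomials_intros pair_polynomial s_polynomial)
  have slice: "slice = {x. \<forall>f\<in>p ` {..<2}. f x = 0}"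
    by (auto simp: slice_def H_iff p_def lessThan_Suc numeral_2_eq_2)
  define p' where "p' i z = p i (\<kappa> z)" for i z
  have img: "(\<lambda>f z. f (\<kappa> z)) ` (p ` {..<2}) = p' ` {..<2}"
    unfolding image_image p'_def ..
  let ?Y = "fun_space (azeros N (p' ` {..<2})) (apoly N)"
  have "p ` {..<2} \<subseteq> polynomials" using p by blast
  from isomorphism_enumeration[OF this, folded slice]
  have iso: "isomorphism Q ?Y (\<lambda>q. \<iota> (section_map q))"
    unfolding img by (rule isomorphism_compose[OF isomorphism_section_map])
  have x: "mu ?x = \<xi>" "slice_fun ?x = 0" "?x \<in> H"
    using section_map_slice[OF q] by (auto simp: slice_def H_iff)
  define \<gamma> where "\<gamma> i t = (if i = 0 then ((\<chi> j. (1 + t) * fst ?x $ j), snd ?x) else act t ?x)" for i :: nat and t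
  have scale: "pair X ((\<chi> j. (1 + t) * fst ?x $ j), snd ?x) = (1 + t) * pair X ?x" for X t
    by (simp add: pair_def matrix_vector_mult_def sum_distrib_left mult_ac)
  have "jacobian_full_rank N 2 (\<lambda>i z. p i (\<kappa> z)) (\<iota> ?x)"
  proof (rule jacobian_full_rankI[of 2 p \<gamma> ?x "\<lambda>i. if i = 0 then \<xi> else 1"])
    show "p i \<in> polynomials" for i by (rule p)
    have id: "(\<lambda>w. w) \<in> (polynomials :: (complex \<Rightarrow> complex) set)"
      using polynomial_map_id polynomial_map_complex by blast
    have "polynomial_map (\<lambda>t :: complex. \<chi> j. (1 + t) * fst ?x $ j)"
      unfolding polynomial_map_cvec by (auto intro!: polynomials_intros id)
    then show "polynomial_map (\<gamma> i)" for i
      unfolding \<gamma>_def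
      by (cases "i = 0") (simp_all add: polynomial_map_Pair polynomial_map_const polynomial_map_act id)
    show "\<gamma> i 0 = ?x" for i by (simp add: \<gamma>_def act_0)
    show "(if i = 0 then \<xi> else 1) \<noteq> 0" for i :: nat using xi by simp
    fix i j :: nat assume "i < 2" "j < 2"
    then have "i = 0 \<or> i = 1" "j = 0 \<or> j = 1" by auto
    moreover have "((\<lambda>t. (1 + t) * \<xi> - \<xi>) has_field_derivative \<xi>) (at 0)"
      by (auto intro!: derivative_eq_intros)
    moreover have "slice_fun ((\<chi> j. (1 + t) * fst ?x $ j), snd ?x) = 0" for t
      using x(2) scale xi by (simp add: slice_fun_def)
    moreover have "mu (act t ?x) = \<xi>" "slice_fun (act t ?x) = t" for t
      using x s_act[OF x(3), of t] act_Z[OF x(3), of t] by (simp_all add: H_iff)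
    ultimately show "((\<lambda>t. p j (\<gamma> i t)) has_field_derivative (if j = i then if i = 0 then \<xi> else 1 else 0)) (at 0)"
      by (auto simp: p_def \<gamma>_def scale x(1))
  qed
  then have "jacobian_full_rank N 2 p' (\<iota> ?x)" unfolding p'_def .
  moreover have "\<forall>i<2. p' i \<in> apoly N" unfolding p'_def using polynomial_\<kappa>[OF p] by blast
  moreover have "isomorphism (open_sub Q (points Q)) (open_sub ?Y (points ?Y)) (\<lambda>q. \<iota> (section_map q))"
    using iso by (simp add: open_sub_points)
  ultimately show "\<exists>U N r p W \<phi>. openin (Top Q) U \<and> q \<in> U \<and> (\<forall>i<r. p i \<in> apoly N) \<and>
        openin (Top (fun_space (azeros N (p ` {..<r})) (apoly N))) W \<and>
        isomorphism (open_sub Q U) (open_sub (fun_space (azeros N (p ` {..<r})) (apoly N)) W) \<phi> \<and>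
        jacobian_full_rank N r p (\<phi> q)"
    using q openin_topspace by blast
qed

subsection \<open>Complete stability\<close>

text \<open>
  On \<open>{(y, v). q\<^sub>y(v) = \<xi>}\<close>, where \<open>q\<^sub>y(v) = pair (nilp v) y\<close>, the matrix \<open>frame y v\<close> has determinant one,
  first column \<open>v\<close>, and its columns are orthogonal for the quadratic form \<open>q\<^sub>y\<close>; it depends equivariantly
  on \<open>(y, v)\<close>, so that \<open>normal_form\<close> is invariant.
\<close>

definition frame :: "(complex^'n) \<times> (complex^'n) \<Rightarrow> complex^2 \<Rightarrow> complex^2^2" where
  "frame y v = mat2 (v $ 1) ((eta y * v $ 1 / 2 - nu y * v $ 2) / \<xi>)
                    (v $ 2) ((mu y * v $ 1 - eta y * v $ 2 / 2) / \<xi>)"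

definition normal_form :: "((complex^'n) \<times> (complex^'n)) \<times> (complex^2) \<Rightarrow> (complex^'n) \<times> (complex^'n)" where
  "normal_form w = cot (adj2 (frame (fst w) (snd w))) (fst w)"

abbreviation e1 :: "complex^2" where
  "e1 \<equiv> vector [1, 0]"

text \<open>The determinant of the frame is the value of the quadratic form at v divided by
  \<xi>.\<close>

lemma frame_SL2:
  assumes "pair (nilp v) y = \<xi>"
  shows "frame y v \<in> SL2"
proof -
  have "v $ 1 * ((m * v $ 1 - e * v $ 2 / 2) / \<xi>) - (e * v $ 1 / 2 - n * v $ 2) / \<xi> * v $ 2
      = (m * (v $ 1)\<^sup>2 - e * v $ 1 * v $ 2 + n * (v $ 2)\<^sup>2) / \<xi>" for m e n
    by (simp add: diff_divide_distrib add_divide_distrib power2_eq_square algebra_simps)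
  then show ?thesis
    using xi assms unfolding SL2_iff frame_def mat2_nth by (simp flip: pair_nilp)
qed

lemma frame_e1: "frame y v *v e1 = v"
  by (simp add: vec2_eq_iff mat2_vec_nth frame_def)

text \<open>When the form takes the value \<xi> at v, the second column is the only vector
  orthogonal to v that completes v to determinant one, and g preserves both conditions. The proof
  checks the resulting formula in coordinates for all v.\<close>

lemma frame_equivariant:
  assumes g: "g \<in> SL2"
  shows "frame (cot g y) (g *v v) = g ** frame y v"
proof -
  define m e n m' e' n' where q: "m = mu y" "e = eta y" "n = nu y"
    "m' = mu (cot g y)" "e' = eta (cot g y)" "n' = nu (cot g y)"
  define a b c d where gd: "a = g $ 1 $ 1" "b = g $ 1 $ 2" "c = g $ 2 $ 1" "d = g $ 2 $ 2"
  define x z where v: "x = v $ 1" "z = v $ 2"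
  have det: "a * d - b * c = 1" using g by (simp add: SL2_iff gd)
  have form: "m' * (a * x + b * z)\<^sup>2 - e' * (a * x + b * z) * (c * x + d * z) + n' * (c * x + d * z)\<^sup>2
      = m * x\<^sup>2 - e * x * z + n * z\<^sup>2" for x z
    using pair_cot[OF g, of "vector [x, z]" y]
    unfolding pair_nilp[of "g *v vector [x, z]"] pair_nilp[of "vector [x, z]"]
    by (simp add: mat2_vec_nth flip: q gd)
  \<comment> \<open>The coefficients of the form at y in terms of those at g y, from its values at
    (1, 0), (0, 1) and (1, 1).\<close>
  have m: "m = m' * a * a - e' * a * c + n' * c * c"
    using form[of 1 0] by (simp add: power2_eq_square algebra_simps)
  have n: "n = m' * b * b - e' * b * d + n' * d * d"
    using form[of 0 1] by (simp add: power2_eq_square algebra_simps)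
  have e: "e = e' * (a * d + b * c) - 2 * m' * a * b - 2 * n' * c * d"
    using form[of 1 1] unfolding m n by (simp add: power2_eq_square algebra_simps)
  have 1: "e' * (a * x + b * z) / 2 - n' * (c * x + d * z) =
      a * (e * x / 2 - n * z) + b * (m * x - e * z / 2)"
  proof -
    \<comment> \<open>Substituting these coefficients produces the factor det g, which is 1.\<close>
    have "a * (e * x / 2 - n * z) + b * (m * x - e * z / 2)
        = (a * d - b * c) * (e' * (a * x + b * z) / 2 - n' * (c * x + d * z))"
      unfolding m n e by (simp add: field_simps)
    then show ?thesis using det by simp
  qed
  have 2: "m' * (a * x + b * z) - e' * (c * x + d * z) / 2 =
      c * (e * x / 2 - n * z) + d * (m * x - e * z / 2)"
  proof -
    have "c * (e * x / 2 - n * z) + d * (m * x - e * z / 2)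
        = (a * d - b * c) * (m' * (a * x + b * z) - e' * (c * x + d * z) / 2)"
      unfolding m n e by (simp add: field_simps)
    then show ?thesis using det by simp
  qed
  have "(e' * (a * x + b * z) / 2 - n' * (c * x + d * z)) / \<xi> =
      a * ((e * x / 2 - n * z) / \<xi>) + b * ((m * x - e * z / 2) / \<xi>)"
    "(m' * (a * x + b * z) - e' * (c * x + d * z) / 2) / \<xi> =
      c * ((e * x / 2 - n * z) / \<xi>) + d * ((m * x - e * z / 2) / \<xi>)"
    unfolding 1 2 by (simp_all add: add_divide_distrib)
  then show ?thesis
    by (simp add: mat2_eq_iff mat2_mult_nth mat2_vec_nth frame_def flip: q gd v)
qed

lemma polynomial_map_normal_form: "polynomial_map normal_form"
proof -
  have "polynomial_map (\<lambda>w :: ((complex^'n) \<times> (complex^'n)) \<times> (complex^2). frame (fst w) (snd w))"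
    unfolding frame_def polynomial_map_mat2
    by (intro conjI polynomials_intros polynomials_compose[OF pair_polynomial] polynomial_vec_nth
        polynomial_map_fst polynomial_map_snd)
  then show ?thesis
    unfolding normal_form_def by (intro polynomial_map_cot polynomial_map_adj2 polynomial_map_fst)
qed

lemma pair_nilp_polynomial: "(\<lambda>w :: ((complex^'n) \<times> (complex^'n)) \<times> (complex^2). pair (nilp (snd w)) (fst w)) \<in> polynomials"
proof -
  have "(\<lambda>w :: ((complex^'n) \<times> (complex^'n)) \<times> (complex^2). mu (fst w) * (snd w $ 1)\<^sup>2
      - eta (fst w) * snd w $ 1 * snd w $ 2 + nu (fst w) * (snd w $ 2)\<^sup>2) \<in> polynomials"
    by (intro polynomials_intros polynomials_compose[OF pair_polynomial] polynomial_vec_nth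
        polynomial_map_fst polynomial_map_snd)
  then show ?thesis unfolding pair_nilp[symmetric] .
qed

text \<open>The orbit is cut out by two conditions: the form takes the value \<xi>, and the normal
  form is that of (y, e1). Whichever fails at w yields the polynomial.\<close>

lemma orbit_separation:
  assumes y: "y \<in> H" and notin: "w \<notin> (\<lambda>g. (cot g y, g *v e1)) ` SL2"
  shows "\<exists>p\<in>polynomials. p w \<noteq> 0 \<and> (\<forall>g\<in>SL2. p (cot g y, g *v e1) = 0)"
proof -
  have form: "pair (nilp (g *v e1)) (cot g y) = \<xi>" if "g \<in> SL2" for g
    using pair_cot[OF that, of e1 y] y by (simp add: H_iff)
  have F0: "frame y e1 \<in> SL2" using y by (intro frame_SL2) (simp add: H_iff)
  have nf: "normal_form (cot g y, g *v e1) = normal_form (y, e1)" if g: "g \<in> SL2" for g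
    unfolding normal_form_def fst_conv snd_conv frame_equivariant[OF g] adj2_mult
    by (simp add: cot_mult adj2_SL2 F0 g cot_adj2)
  show ?thesis
  proof (cases "pair (nilp (snd w)) (fst w) = \<xi>")
    case False
    show ?thesis
      by (rule bexI[of _ "\<lambda>w. pair (nilp (snd w)) (fst w) - \<xi>"])
         (use False form in \<open>auto intro: polynomials_intros pair_nilp_polynomial\<close>)
  next
    case True
    have F: "frame (fst w) (snd w) \<in> SL2" by (rule frame_SL2[OF True])
    have "normal_form w \<noteq> normal_form (y, e1)"
    proof
      assume eq: "normal_form w = normal_form (y, e1)"
      \<comment> \<open>The frames relate w and (y, e1) to the same normal form, so their quotient
        carries (y, e1) to w.\<close>
      let ?g = "frame (fst w) (snd w) ** adj2 (frame y e1)"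
      have "cot ?g y = cot (frame (fst w) (snd w)) (normal_form (y, e1))"
        by (simp add: cot_mult[OF F adj2_SL2[OF F0]] normal_form_def)
      also have "\<dots> = fst w" unfolding eq[symmetric] by (simp add: normal_form_def cot_adj2[OF F])
      finally have 1: "cot ?g y = fst w" .
      have "adj2 (frame y e1) *v (frame y e1 *v e1) = e1"
        by (simp add: matrix_vector_mul_assoc adj2_left[OF F0])
      then have "adj2 (frame y e1) *v e1 = e1" unfolding frame_e1 .
      then have 2: "?g *v e1 = snd w" by (simp add: frame_e1 flip: matrix_vector_mul_assoc)
      have "w = (cot ?g y, ?g *v e1)" unfolding 1 2 by simp
      then show False using notin mult_SL2[OF F adj2_SL2[OF F0]] by blast
    qed
    then obtain k where k: "k \<in> coords" "k (normal_form w) \<noteq> k (normal_form (y, e1))"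
      using affine_space_eqI by blast
    have "(\<lambda>w. k (normal_form w) - k (normal_form (y, e1))) \<in> polynomials"
      by (intro polynomials_intros polynomials_compose[OF coords_polynomials[OF k(1)]] polynomial_map_normal_form)
    then show ?thesis
      by (rule bexI[rotated]) (use k(2) nf in auto)
  qed
qed

section \<open>The action on homogeneous coordinates, and complete stability\<close>

definition big_act :: "complex^2^2 \<Rightarrow> complex \<times> ((complex^'n) \<times> (complex^'n)) \<times> (complex^2) \<Rightarrow>
    complex \<times> ((complex^'n) \<times> (complex^'n)) \<times> (complex^2)" where
  "big_act g = (\<lambda>(z, y, v). (z, cotangent_lift (\<rho> g) y, g *v v))"

lemma big_act_eq: "g \<in> SL2 \<Longrightarrow> big_act g (z, y, v) = (z, cot g y, g *v v)"
  by (simp add: big_act_def cotangent_lift_eq)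

lemma big_act_cscale:
  assumes "g \<in> SL2"
  shows "big_act g (cscale c w) = cscale c (big_act g w)"
proof -
  show ?thesis
    using assms by (cases w) (simp add: big_act_eq cscale_prod_def cot_def matrix_vector_cscale vector_matrix_cscale)
qed

lemma big_act_proj_pt:
  assumes "g \<in> SL2"
  shows "big_act g ` proj_pt w = proj_pt (big_act g w)"
  by (simp add: proj_pt_image image_image big_act_cscale[OF assms])

text \<open>A semistable point off the orbit is separated from it by a form vanishing on the orbit:
  one made from its own invariant section F if F and c z^m differ there, otherwise the
  homogenisation of a polynomial given by \<open>orbit_separation\<close>.\<close>

theorem completely_stable:
  assumes y: "y \<in> H"
  shows "y \<in> completely_stable_locus (\<lambda>g. cotangent_lift (\<rho> g))"
proof -
  let ?L = "proj_pt (1::complex, y, e1)"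
  let ?O = "orb SL2 (\<lambda>g. image (big_act g)) ?L"
  let ?SS = "proj_semistable SL2 big_act"
  have O: "?O = (\<lambda>g. proj_pt (1, cot g y, g *v e1)) ` SL2"
    unfolding orb_def by (intro image_cong) (simp_all add: big_act_proj_pt big_act_eq)
  have semistable: "proj_pt (1, w) \<in> ?SS" for w
    unfolding proj_semistable_def mem_Collect_eq
    by (rule exI[of _ "(1, w)"], intro conjI exI[of _ 1] bexI[OF _ fst_homogeneous])
       (auto simp: nonzero_1 big_act_eq)
  then have OSS: "?O \<subseteq> ?SS" unfolding O by blast
  have basic: "openin proj_topology (proj_pt ` {w. nonzero w \<and> F w \<noteq> 0})" if "F \<in> homogeneous m"
    for F :: "complex \<times> ((complex^'n) \<times> (complex^'n)) \<times> (complex^2) \<Rightarrow> complex" and m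
    unfolding proj_topology_def using that by (intro topology_generated_by_Basis) blast
  have avoid: "proj_pt ` {w. nonzero w \<and> F w \<noteq> 0} \<inter> ?O = {}"
    if F: "F \<in> homogeneous m" and van: "\<And>g. g \<in> SL2 \<Longrightarrow> F (1, cot g y, g *v e1) = 0"
    for F :: "complex \<times> ((complex^'n) \<times> (complex^'n)) \<times> (complex^2) \<Rightarrow> complex" and m
  proof (rule ccontr)
    assume "proj_pt ` {w. nonzero w \<and> F w \<noteq> 0} \<inter> ?O \<noteq> {}"
    then obtain w g where w: "F w \<noteq> 0" "g \<in> SL2" "proj_pt w = proj_pt (1, cot g y, g *v e1)"
      unfolding O by blast
    from w(3)[symmetric] obtain c where "w = cscale c (1, cot g y, g *v e1)" by (rule proj_pt_eqD)
    then show False using homogeneous_cscale[OF F] w(1) van[OF w(2)] by simp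
  qed
  have separate: "\<exists>F m. F \<in> homogeneous m \<and> L \<in> proj_pt ` {w. nonzero w \<and> F w \<noteq> 0} \<and>
      (\<forall>g\<in>SL2. F (1, cot g y, g *v e1) = 0)" if L: "L \<in> ?SS - ?O" for L
  proof -
    obtain w m F where w: "L = proj_pt w" "nonzero w" "m > 0" "F \<in> homogeneous m"
      "\<And>g v. g \<in> SL2 \<Longrightarrow> F (big_act g v) = F v" "F w \<noteq> 0"
      using L unfolding proj_semistable_def by blast
    \<comment> \<open>F is invariant and z = 1 on these representatives of the orbit, so F - c z^m
      vanishes on it.\<close>
    define c where "c = F (1, y, e1)"
    have Fc: "F (1, cot g y, g *v e1) = c" if "g \<in> SL2" for g
      using w(5)[OF that, of "(1, y, e1)"] by (simp add: big_act_eq[OF that] c_def)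
    \<comment> \<open>\<open>F = c z\<^sup>m\<close> on the closure of the orbit, so there \<open>z \<noteq> 0\<close> wherever \<open>F \<noteq> 0\<close>.\<close>
    show ?thesis
    proof (cases "F w = c * fst w ^ m")
      case False
      have "(\<lambda>w. F w - c * fst w ^ m) \<in> homogeneous m"
        using w(4) fst_homogeneous
        by (auto simp: homogeneous_def power_mult_distrib algebra_simps intro!: polynomials_intros)
      then show ?thesis
        by (rule exI[of _ "\<lambda>w. F w - c * fst w ^ m", OF exI[of _ m, OF conjI]])
           (use w(1,2) False Fc in auto)
    next
      case True
      \<comment> \<open>Here m > 0 matters: z = 0 would give F w = c * 0^m = 0.\<close>
      then have z: "fst w \<noteq> 0" using w(3,6) by (auto simp: power_0_left)
      define w' where "w' = snd (cscale (1 / fst w) w)"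
      have "cscale (1 / fst w) w = (1, w')"
        using z by (simp add: w'_def cscale_prod_def cscale_complex_def)
      then have Lw: "L = proj_pt (1, w')" using proj_pt_cscale[of "1 / fst w" w] z w(1) by simp
      have "w' \<notin> (\<lambda>g. (cot g y, g *v e1)) ` SL2"
        using L unfolding Lw O by auto
      from orbit_separation[OF y this] obtain p where
        p: "p \<in> polynomials" "p w' \<noteq> 0" "\<And>g. g \<in> SL2 \<Longrightarrow> p (cot g y, g *v e1) = 0" by blast
      from homogenize[OF p(1)] obtain k G where G: "G \<in> homogeneous k" "\<And>w. G (1::complex, w) = p w" by blast
      have "L \<in> proj_pt ` {w. nonzero w \<and> G w \<noteq> 0}"
        unfolding Lw by (intro imageI CollectI conjI nonzero_1) (simp only: G(2) p(2) not_False_eq_True)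
      moreover have "\<forall>g\<in>SL2. G (1, cot g y, g *v e1) = 0" by (intro ballI) (simp only: G(2) p(3))
      ultimately show ?thesis using G(1) by blast
    qed
  qed
  have SSpts: "?SS \<subseteq> topspace proj_topology"
  proof
    fix L assume "L \<in> ?SS"
    then obtain w m F where "L = proj_pt w" "nonzero w" "F \<in> homogeneous m" "F w \<noteq> 0"
      unfolding proj_semistable_def by blast
    then have "L \<in> proj_pt ` {w. nonzero w \<and> F w \<noteq> 0}" by blast
    then show "L \<in> topspace proj_topology" using openin_subset[OF basic[OF \<open>F \<in> homogeneous m\<close>]] by blast
  qed
  have "closedin (subtopology proj_topology ?SS) ?O"
    unfolding closedin_def
  proof
    have top: "topspace (subtopology proj_topology ?SS) = ?SS" using SSpts by auto
    show "?O \<subseteq> topspace (subtopology proj_topology ?SS)" unfolding top by (rule OSS)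
    show "openin (subtopology proj_topology ?SS) (topspace (subtopology proj_topology ?SS) - ?O)"
      unfolding top
    proof (subst openin_subopen, intro ballI)
      fix L assume L: "L \<in> ?SS - ?O"
      from separate[OF L] obtain F m where F: "F \<in> homogeneous m" "L \<in> proj_pt ` {w. nonzero w \<and> F w \<noteq> 0}"
        "\<And>g. g \<in> SL2 \<Longrightarrow> F (1, cot g y, g *v e1) = 0" by blast
      let ?U = "proj_pt ` {w. nonzero w \<and> F w \<noteq> 0} \<inter> ?SS"
      have "openin (subtopology proj_topology ?SS) ?U"
        using basic[OF F(1)] by (auto simp: openin_subtopology)
      moreover have "L \<in> ?U" using F(2) L by blast
      moreover have "?U \<subseteq> ?SS - ?O" using avoid[OF F(1,3)] by blast
      ultimately show "\<exists>T. openin (subtopology proj_topology ?SS) T \<and> L \<in> T \<and> T \<subseteq> ?SS - ?O" by blast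
    qed
  qed
  moreover have "{g \<in> SL2. big_act g ` ?L = ?L} \<subseteq> {mat 1}"
  proof
    fix g assume "g \<in> {g \<in> SL2. big_act g ` ?L = ?L}"
    then have g: "g \<in> SL2" and "big_act g ` ?L = ?L" by blast+
    then have eq: "?L = proj_pt (1, cot g y, g *v e1)"
      by (simp add: big_act_proj_pt big_act_eq)
    from eq obtain c where c: "(1::complex, cot g y, g *v e1) = cscale c (1, y, e1)" by (rule proj_pt_eqD)
    \<comment> \<open>The first coordinate is 1 on both sides, so equality of projective points
      becomes equality of vectors.\<close>
    then have "c = 1" by (simp add: cscale_prod_def cscale_complex_def)
    then have fix_y: "cot g y = y" and fix_e: "g *v e1 = e1" using c by (simp_all add: cscale_1)
    \<comment> \<open>The stabiliser of e1 in \<open>SL2\<close> is the unipotent subgroup, and the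
      slice function shows that it acts freely on the level set.\<close>
    have "g = unip (g $ 1 $ 2)"
      using fix_e g by (simp add: vec2_eq_iff mat2_eq_iff mat2_vec_nth SL2_iff unip_eq)
    then have "act (g $ 1 $ 2) y = y" using fix_y by (simp add: act_def)
    then have "g $ 1 $ 2 = 0" using s_act[OF y, of "g $ 1 $ 2"] by simp
    then show "g \<in> {mat 1}" using \<open>g = unip (g $ 1 $ 2)\<close> by (simp add: unip_0)
  qed
  ultimately have "?L \<in> proj_stable SL2 big_act"
    unfolding proj_stable_def stable_point_def using semistable finite_subset by blast
  then show ?thesis by (simp add: completely_stable_locus_def big_act_def[abs_def])
qed

end

text \<open>The given action enters through the agreement of its cotangent lift with
  \<open>cot\<close> along \<open>unip\<close>. The clause on \<theta> turns the orbit map into the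
  canonical map to the spectrum of the invariants, so the last clause is the surjectivity of the
  quotient map.\<close>

theorem theorem3p13:
  fixes \<sigma> :: "complex \<Rightarrow> complex^'n^'n"
    and \<rho> :: "complex^2^2 \<Rightarrow> complex^'n^'n"
    and \<xi> :: complex
  assumes "linear_Ga_action \<sigma>" and "\<exists>t. \<sigma> t \<noteq> mat 1"
    and "SL2_representation \<rho>" and "\<forall>t. \<rho> (unip t) = \<sigma> t"
    and "\<xi> \<noteq> 0"
  shows
    "let H = level_set \<rho> \<xi>;
         act = (\<lambda>t. cotangent_lift (\<sigma> t));
         X = subvariety H;
         Q = orbit_space UNIV act X;
         \<pi> = orb UNIV act;
         A = invariant_ring UNIV act H
     in H \<inter> completely_stable_locus (\<lambda>g. cotangent_lift (\<rho> g)) = mumford_stable_locus act X \<and>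
        mumford_stable_locus act X = H \<and>
        locally_trivial_Ga_quotient act X Q \<pi> \<and>
        smooth_variety Q \<and>
        affine_variety Q \<and>
        finitely_generated_algebra H A \<and>
        (\<forall>f\<in>A. \<exists>F\<in>invariant_ring UNIV act UNIV. f = restrict F H) \<and>
        trivial_Ga_torsor act X Q \<pi> \<and>
        (\<exists>\<theta>. isomorphism Q (Spec H A) \<theta> \<and> (\<forall>y\<in>H. \<theta> (\<pi> y) = spec_map A y)) \<and>
        spec_map A ` H = points (Spec H A)"
proof -
  interpret moment_level \<rho> \<xi>
    using assms(3,5) by (simp add: moment_level_def sl2_rep_def moment_level_axioms_def)
  have "(\<lambda>t. cotangent_lift (\<sigma> t)) = act"
    by (simp add: fun_eq_iff act_def cotangent_lift_eq[OF unip_SL2] flip: assms(4)[rule_format])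
  then show ?thesis
    unfolding Let_def
    using completely_stable mumford_stable_eq locally_trivial_Q smooth_Q affine_Q finitely_generated_A
      invariant_extension trivial_torsor_Q isomorphism_Spec spec_map_surj
    by auto
qed

end
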